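(* Let $n,l\in\mathbb{N}$ and $\alpha\in(1,2)$. Let $\rho_{Z^{\le n}\bar CE^N}$ be a state that is classical in $Z^{\le n}\bar C$, where the register $Z^{\le n}$ takes values in $\{0,1\}^{\le n}$ (bitstrings of length at most $n$), with the property that, conditioned on each possible value $\bar c$ of $\bar C$, the resulting distribution on $Z^{\le n}$ is supported only on $\{0,1\}^{k_{\bar c}}$ for some constant $k_{\bar c}\in\mathbb N$. Let $\rho_{K_A\widetilde CE^N}$ be the state obtained from $\rho_{Z^{\le n}\bar CE^N}$ by first computing the number of bits $\mathrm{len}(Z^{\le n})$ in the $Z^{\le n}$ register and then implementing a two-universal hashing procedure from $\mathrm{len}(Z^{\le n})$ bits to $l$ bits (with output $K_A$), where $\widetilde C:=\bar CC_P$ with $C_P$ the choice of hash function. Let $\rho^{(\mathrm{ideal})}_{K_A\widetilde CE^N}:=\frac{\mathbb I_{K_A}}{|K_A|}\otimes\rho_{\widetilde CE^N}$. Then for any event $\Omega$ on the classical register $\bar C$, $$\tfrac12\Pr(\Omega)\Big\|\rho_{K_A\widetilde CE^N|\Omega}-\rho^{(\mathrm{ideal})}_{K_A\widetilde CE^N|\Omega}\Big\|_1\le\tfrac12\Pr(\Omega)\,2^{-\left(\frac{\alpha-1}{\alpha}\right)\left(H_\alpha(Z^{\le n}|\bar CE^N)_{\rho|\Omega}-l\right)+\frac2\alpha-1}\le\tfrac12\,2^{-\left(\frac{\alpha-1}{\alpha}\right)\left(H_\alpha(Z^{\le n}|\bar CE^N)_{\rho}-l\right)+\frac2\alpha-1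}.$$
   Context: Finite-dimensional systems; $\log$ is base 2; $\|\cdot\|_1$ is the trace norm; $E^N$ is a quantum register. $\rho_{|\Omega}$ denotes the normalized state conditioned on $\Omega$ (with $\Pr(\Omega)>0$). Sandwiched Rényi entropy: $H_\alpha(A|B)_\rho:=\max_{\sigma_B}H_\alpha(A|B)_{\rho|\sigma}$, the maximum being over normalized states $\sigma_B$ on $B$, where $H_\alpha(A|B)_{\rho|\sigma}:=\frac1{1-\alpha}\log\mathrm{Tr}\big[\big(\sigma_B^{\frac{1-\alpha}{2\alpha}}\rho_{AB}\sigma_B^{\frac{1-\alpha}{2\alpha}}\big)^\alpha\big]$ if the support of $\rho_{AB}$ is contained in $A\otimes\mathrm{supp}(\sigma_B)$, and $-\infty$ otherwise. Hashing procedure: for each $i\in\{0,1,\dots,n\}$ a family $\mathcal F^{\mathrm{hash}}_i$ of functions $\{0,1\}^i\to\{0,1\}^l$ is given which is two-universal, i.e. for all $z\ne z'$ in $\{0,1\}^i$, $\Pr_f[f(z)=f(z')]\le2^{-l}$ for uniformly random $f\in\mathcal F^{\mathrm{hash}}_i$. On input $z\in\{0,1\}^{\le n}$ one samples $f$ uniformly from $\mathcal F^{\mathrm{hash}}_{\mathrm{len}(z)}$ (independently of everything else given the length), outputs $K_A=f(z)\in\{0,1\}^l$ and records $f$ in $C_P$. The procedure as a whole need not be two-universal on $\{0,1\}^{\le n}$. *)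

theory Defs
  imports "HOL-Analysis.Analysis" "HOL-Probability.Probability_Mass_Function"
begin

text \<open>
  A finite-dimensional register with orthonormal basis labelled by a finite set \<open>I\<close> is the
  Hilbert space of complex vectors indexed by \<open>I\<close>.  Vectors and operators are functions on the
  label type, and the label set is passed explicitly: only entries with labels in \<open>I\<close> are ever
  read.  Composite registers have label set \<open>A \<times> B\<close>.
\<close>

type_synonym 'i vec = "'i \<Rightarrow> complex"
type_synonym 'i op = "'i \<Rightarrow> 'i \<Rightarrow> complex"

definition op_id :: "'i op" where
  "op_id = (\<lambda>i j. if i = j then 1 else 0)"

definition op_mult :: "'i set \<Rightarrow> 'i op \<Rightarrow> 'i op \<Rightarrow> 'i op" where
  "op_mult I M N = (\<lambda>i j. \<Sum>k\<in>I. M i k * N k j)"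

definition op_adj :: "'i op \<Rightarrow> 'i op" where
  "op_adj M = (\<lambda>i j. cnj (M j i))"

definition op_minus :: "'i op \<Rightarrow> 'i op \<Rightarrow> 'i op" where
  "op_minus M N = (\<lambda>i j. M i j - N i j)"

definition op_trace :: "'i set \<Rightarrow> 'i op \<Rightarrow> complex" where
  "op_trace I M = (\<Sum>i\<in>I. M i i)"

definition op_tensor :: "'a op \<Rightarrow> 'b op \<Rightarrow> ('a \<times> 'b) op" where
  "op_tensor M N = (\<lambda>(a, b) (a', b'). M a a' * N b b')"

definition partial_trace_fst :: "'a set \<Rightarrow> ('a \<times> 'b) op \<Rightarrow> 'b op" where
  "partial_trace_fst A M = (\<lambda>b b'. \<Sum>a\<in>A. M (a, b) (a, b'))"

definition op_apply :: "'i set \<Rightarrow> 'i op \<Rightarrow> 'i vec \<Rightarrow> 'i vec" where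
  "op_apply I M v = (\<lambda>i. \<Sum>j\<in>I. M i j * v j)"

definition vec_inner :: "'i set \<Rightarrow> 'i vec \<Rightarrow> 'i vec \<Rightarrow> complex" where
  "vec_inner I v w = (\<Sum>i\<in>I. cnj (v i) * w i)"

text \<open>Over the complex numbers, real non-negative quadratic forms force Hermiticity.\<close>

definition op_psd :: "'i set \<Rightarrow> 'i op \<Rightarrow> bool" where
  "op_psd I M \<longleftrightarrow> (\<forall>v. vec_inner I v (op_apply I M v) \<in> \<real>\<^sub>\<ge>\<^sub>0)"

definition state_on :: "'i set \<Rightarrow> 'i op \<Rightarrow> bool" where
  "state_on I \<rho> \<longleftrightarrow> op_psd I \<rho> \<and> op_trace I \<rho> = 1"

text \<open>The support is the orthogonal complement of the kernel.\<close>

definition op_supp :: "'i set \<Rightarrow> 'i op \<Rightarrow> 'i vec set" where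
  "op_supp I M =
     {v. \<forall>w. (\<forall>i\<in>I. op_apply I M w i = 0) \<longrightarrow> vec_inner I w v = 0}"

definition op_unitary :: "'i set \<Rightarrow> 'i op \<Rightarrow> bool" where
  "op_unitary I U \<longleftrightarrow>
     (\<forall>i\<in>I. \<forall>j\<in>I. op_mult I (op_adj U) U i j = op_id i j \<and> op_mult I U (op_adj U) i j = op_id i j)"

definition op_diag :: "('i \<Rightarrow> real) \<Rightarrow> 'i op" where
  "op_diag d = (\<lambda>i j. if i = j then complex_of_real (d i) else 0)"

definition eigendecomposition :: "'i set \<Rightarrow> 'i op \<Rightarrow> 'i op \<Rightarrow> ('i \<Rightarrow> real) \<Rightarrow> bool" where
  "eigendecomposition I M U d \<longleftrightarrow> op_unitary I U \<and>
     (\<forall>i\<in>I. \<forall>j\<in>I. M i j = op_mult I U (op_mult I (op_diag d) (op_adj U)) i j)"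

text \<open>
  Functional calculus of a Hermitian operator: apply \<open>g\<close> to the eigenvalues.  On \<open>I\<close> the result
  does not depend on which eigendecomposition is chosen.
\<close>

definition op_fun :: "'i set \<Rightarrow> (real \<Rightarrow> real) \<Rightarrow> 'i op \<Rightarrow> 'i op" where
  "op_fun I g M =
     (case (SOME (U, d). eigendecomposition I M U d) of
        (U, d) \<Rightarrow> op_mult I U (op_mult I (op_diag (g \<circ> d)) (op_adj U)))"

text \<open>
  Since \<open>0 powr s = 0\<close> for every exponent \<open>s\<close>, negative powers are taken on the support only
  (generalized inverse).
\<close>

definition op_powr :: "'i set \<Rightarrow> 'i op \<Rightarrow> real \<Rightarrow> 'i op" where
  "op_powr I M s = op_fun I (\<lambda>x. x powr s) M"

definition trace_norm :: "'i set \<Rightarrow> 'i op \<Rightarrow> real" where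
  "trace_norm I M = Re (op_trace I (op_powr I (op_mult I (op_adj M) M) (1/2)))"

text \<open>
  In the support condition, \<open>op_supp (A \<times> B) (op_tensor op_id \<sigma>)\<close> is the tensor product of the
  whole space of \<open>A\<close> with the support of \<open>\<sigma>\<close>.
\<close>

definition sandwiched_renyi_rel ::
    "real \<Rightarrow> 'a set \<Rightarrow> 'b set \<Rightarrow> ('a \<times> 'b) op \<Rightarrow> 'b op \<Rightarrow> ereal" where
  "sandwiched_renyi_rel \<alpha> A B \<rho> \<sigma> =
     (if op_supp (A \<times> B) \<rho> \<subseteq> op_supp (A \<times> B) (op_tensor op_id \<sigma>)
      then
        (let S = op_tensor op_id (op_powr B \<sigma> ((1 - \<alpha>) / (2 * \<alpha>)));
             T = op_mult (A \<times> B) S (op_mult (A \<times> B) \<rho> S)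
         in ereal (1 / (1 - \<alpha>) * log 2 (Re (op_trace (A \<times> B) (op_powr (A \<times> B) T \<alpha>)))))
      else - \<infinity>)"

text \<open>
  The maximum over \<open>\<sigma>\<close> is written as a supremum in the extended reals; it is attained,
  and finite for every state \<open>\<rho>\<close>.
\<close>

definition sandwiched_renyi_entropy ::
    "real \<Rightarrow> 'a set \<Rightarrow> 'b set \<Rightarrow> ('a \<times> 'b) op \<Rightarrow> ereal" where
  "sandwiched_renyi_entropy \<alpha> A B \<rho> =
     (SUP \<sigma>\<in>{\<sigma>. state_on B \<sigma>}. sandwiched_renyi_rel \<alpha> A B \<rho> \<sigma>)"

text \<open>
  The classical registers are read off a basis label by a function \<open>x\<close>; classicality means
  block-diagonality with respect to the values of \<open>x\<close>.
\<close>

definition classical_in :: "'i set \<Rightarrow> ('i \<Rightarrow> 'x) \<Rightarrow> 'i op \<Rightarrow> bool" where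
  "classical_in I x \<rho> \<longleftrightarrow> (\<forall>i\<in>I. \<forall>j\<in>I. x i \<noteq> x j \<longrightarrow> \<rho> i j = 0)"

text \<open>An event on classical registers is given by the set \<open>W\<close> of basis labels satisfying it.\<close>

definition event_prob :: "'i set \<Rightarrow> 'i op \<Rightarrow> 'i set \<Rightarrow> real" where
  "event_prob I \<rho> W = Re (\<Sum>i\<in>I \<inter> W. \<rho> i i)"

definition cond_state :: "'i set \<Rightarrow> 'i op \<Rightarrow> 'i set \<Rightarrow> 'i op" where
  "cond_state I \<rho> W =
     (\<lambda>i j. if i \<in> W \<and> j \<in> W then \<rho> i j / complex_of_real (event_prob I \<rho> W) else 0)"

definition bits :: "nat \<Rightarrow> bool list set" where
  "bits i = {z. length z = i}"

definition bits_upto :: "nat \<Rightarrow> bool list set" where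
  "bits_upto n = {z. length z \<le> n}"

text \<open>
  A function from \<open>bits i\<close> to \<open>bits l\<close> is a partial map with domain \<open>bits i\<close>, so that hash
  functions for different input lengths are different objects.
\<close>

type_synonym hash_fun = "bool list \<rightharpoonup> bool list"

definition two_universal :: "nat \<Rightarrow> nat \<Rightarrow> hash_fun set \<Rightarrow> bool" where
  "two_universal i l F \<longleftrightarrow>
     F \<noteq> {} \<and> (\<forall>f\<in>F. dom f = bits i \<and> ran f \<subseteq> bits l) \<and>
     (\<forall>z\<in>bits i. \<forall>z'\<in>bits i. z \<noteq> z' \<longrightarrow>
        measure_pmf.prob (pmf_of_set F) {f. f z = f z'} \<le> 2 powr (- real l))"

definition hash_register :: "nat \<Rightarrow> (nat \<Rightarrow> hash_fun set) \<Rightarrow> hash_fun set" where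
  "hash_register n F = (\<Union>i\<le>n. F i)"

text \<open>
  The channel that reads \<open>z\<close>, samples \<open>f\<close> uniformly from \<open>F (length z)\<close>, outputs \<open>f z\<close> and \<open>f\<close>,
  and discards \<open>z\<close>:
  the sum over \<open>z\<close> and \<open>f\<close> of \<open>Pr(f | length z) |f z><f z| \<otimes> |f><f| \<otimes> <z| \<rho> |z>\<close>.
  Output labels are of the form \<open>(k, (c, f), e)\<close>.
\<close>

definition hashed_state ::
    "nat \<Rightarrow> (nat \<Rightarrow> hash_fun set) \<Rightarrow> (bool list \<times> 'c \<times> 'e) op
       \<Rightarrow> (bool list \<times> ('c \<times> hash_fun) \<times> 'e) op" where
  "hashed_state n F \<rho> =
     (\<lambda>(k, (c, f), e) (k', (c', f'), e').
        if k = k' \<and> f = f'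
        then \<Sum>z | z \<in> bits_upto n \<and> f \<in> F (length z) \<and> f z = Some k.
               complex_of_real (pmf (pmf_of_set (F (length z))) f) * \<rho> (z, c, e) (z, c', e')
        else 0)"

definition ideal_state :: "'k set \<Rightarrow> ('k \<times> 'b) op \<Rightarrow> ('k \<times> 'b) op" where
  "ideal_state K \<rho> =
     op_tensor (\<lambda>i j. op_id i j / of_nat (card K)) (partial_trace_fst K \<rho>)"

end

theory Submission
  imports Defs "HOL-Complex_Analysis.Conformal_Mappings"
begin

text \<open>
  Trace norm duality turns the distance into \<open>Re (Tr (X R(\<rho>)))\<close>, with a contraction \<open>X\<close> and \<open>R\<close>
  the difference of hashing and ideal channel.  For \<open>\<theta> = 2 (\<alpha> - 1) / \<alpha>\<close>,
  \<open>T = \<sigma>^(-\<theta>/4) \<rho> \<sigma>^(-\<theta>/4)\<close>, \<open>N = Tr (T^\<alpha>)\<close> and \<open>D = T^\<alpha> / N\<close>, it equals \<open>N^(1/\<alpha>) f(\<theta>)\<close> where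
  \<open>f(w) = Tr (X R(\<sigma>^(w/4) D^(1 - w/2) \<sigma>^(w/4)))\<close> is interpolated over \<open>0 \<le> Re w \<le> 1\<close>.  On the left
  edge \<open>|f| \<le> 2\<close>.  On the right edge Cauchy-Schwarz would give \<open>|f| \<le> 2^(l/2)\<close> if all collision
  probabilities were exactly \<open>2^-l\<close>; as they may be smaller and \<open>D^(1 - w/2)\<close> is not positive, one
  only gets \<open>2^(l/2) (1 - (\<Sum>k. m k * cos (\<mu> k * t)))\<close> with \<open>m k \<ge> 0\<close>.  The harmonic extension of
  this weight is at most 1 on the real axis, so \<open>|f(\<theta>)| \<le> 2^(1 - \<theta>) 2^(l \<theta>/2)\<close> survives.  The state
  \<open>\<sigma>\<close> need not be classical in \<open>C\<close>: a hash function determines its input length, hence only involves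
  the block of \<open>C\<close> with that length.  The second inequality follows from \<open>\<rho>|\<Omega> \<le> \<rho> / Pr(\<Omega>)\<close> and
  monotonicity of \<open>Tr (T^\<alpha>)\<close>.
\<close>

text \<open>The value of \<theta> is forced: \<open>1 / \<alpha> = 1 - \<theta> / 2\<close> makes
  \<open>N powr (1 / \<alpha>) * D powr (1 - \<theta> / 2)\<close> reproduce the eigenvalues of
  \<open>T\<close>. Then \<alpha> in (1,2) means \<theta> in (0,1), and the edge values 2 and
  \<open>2^(l/2)\<close> account for \<open>2 / \<alpha> - 1\<close> and
  \<open>(\<alpha> - 1) / \<alpha> * l\<close> in the exponent. The cosines come from
  \<open>D\<close> to the power \<open>(1 - \<i> * t) / 2\<close>: the overlap of its blocks at
  \<open>z\<close> and \<open>z'\<close> has as real part a nonnegative combination of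
  \<open>cos (t * (ln (D i) - ln (D i')) / 2)\<close>, which for \<open>z \<noteq> z'\<close> is
  multiplied by a collision excess of at most 0. At \<open>t = 0\<close> such terms could be
  discarded; elsewhere their sign is open, so they are kept until the strip argument. That argument
  needs a bound affine in the cosines, hence a weighted arithmetic-geometric inequality instead of a
  product of square roots, and a maximum principle for a real part instead of the logarithm of a
  modulus. The interpolation bound has abstract coefficients because it is used a second time, with
  the identity in place of hashing, to bound the entropy from above; at infinity
  \<open>real_of_ereal\<close> would yield the default 0.\<close>

abbreviation sqnorm :: "'i set \<Rightarrow> 'i vec \<Rightarrow> real" where
  "sqnorm I v \<equiv> \<Sum>i\<in>I. (cmod (v i))\<^sup>2"

lemmas sum_Times = sum.cartesian_product'
lemmas sum_distribs = sum_distrib_left sum_distrib_right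

lemma if_mult_left: "(if P then x else y) * z = (if P then x * z else y * (z :: 'a :: times))"
  and if_mult_right: "z * (if P then x else y) = (if P then z * x else z * y)"
  by simp_all

lemmas if_mults = if_mult_left if_mult_right

subsection \<open>Interpolation on a strip\<close>

text \<open>A Phragmen-Lindelof argument: the real part of \<open>w^2\<close> tends to minus
  infinity along the strip, so a small multiple of \<open>w^2\<close> beats the bound
  \<open>B\<close> on the short sides of a tall rectangle, where the maximum principle applies. Real
  parts are controlled, not moduli, so that harmonic corrections can be added to the boundary
  data.\<close>

lemma Re_nonpos_in_strip:
  fixes G :: "complex \<Rightarrow> complex"
  assumes hol: "G holomorphic_on UNIV"
    and bdd: "\<And>w. 0 \<le> Re w \<Longrightarrow> Re w \<le> 1 \<Longrightarrow> Re (G w) \<le> B"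
    and bdry: "\<And>w. Re w = 0 \<or> Re w = 1 \<Longrightarrow> Re (G w) \<le> 0"
    and w: "0 \<le> Re w" "Re w \<le> 1"
  shows "Re (G w) \<le> 0"
proof (rule field_le_epsilon)
  fix e :: real assume "e > 0"
  \<comment> \<open>Tuned to the point \<open>w\<close>: the error \<epsilon> allowed on the
    frontier and the cost \<open>\<epsilon> * (Im w)^2\<close> of removing the perturbation at
    \<open>w\<close> add up to \<open>e\<close>.\<close>
  define \<epsilon> where "\<epsilon> = e / (1 + (Im w)\<^sup>2)"
  have \<epsilon>: "\<epsilon> > 0" "\<epsilon> * (1 + (Im w)\<^sup>2) = e"
    using \<open>e > 0\<close> sum_power2_gt_zero_iff[of 1 "Im w"] by (auto simp: \<epsilon>_def)
  define R where "R = \<bar>Im w\<bar> + 1 + \<bar>B\<bar> / \<epsilon>"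
  have "1 \<le> R" using \<epsilon> by (simp add: R_def)
  have "\<bar>B\<bar> / \<epsilon> \<le> R" by (simp add: R_def)
  also have "\<dots> \<le> R\<^sup>2" using \<open>1 \<le> R\<close> by (simp add: power2_eq_square)
  finally have R: "B \<le> \<epsilon> * R\<^sup>2" using \<epsilon> by (simp add: field_simps)
  define S where "S = cbox (Complex 0 (-R)) (Complex 1 R)"
  have "Re (G w + of_real \<epsilon> * w\<^sup>2) \<le> \<epsilon>"
  proof (rule maximum_real_frontier[where S = S and f = "\<lambda>w. G w + of_real \<epsilon> * w\<^sup>2"])
    show "(\<lambda>w. G w + of_real \<epsilon> * w\<^sup>2) holomorphic_on interior S"
      by (intro holomorphic_intros holomorphic_on_subset[OF hol]) auto
    show "continuous_on (closure S) (\<lambda>w. G w + of_real \<epsilon> * w\<^sup>2)"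
      by (intro continuous_intros holomorphic_on_imp_continuous_on holomorphic_on_subset[OF hol]) auto
    show "bounded S" by (simp add: S_def)
    have "0 \<le> \<bar>B\<bar> / \<epsilon>" using \<epsilon> by simp
    then have "\<bar>Im w\<bar> \<le> R" by (simp add: R_def)
    then show "w \<in> S" using w by (auto simp: S_def in_cbox_complex_iff)
  next
    fix z assume "z \<in> frontier S"
    then have z: "0 \<le> Re z" "Re z \<le> 1" "Re z = 0 \<or> Re z = 1 \<or> \<bar>Im z\<bar> = R"
      by (auto simp: S_def frontier_def in_cbox_complex_iff in_box_complex_iff)
    have "(Re z)\<^sup>2 \<le> 1" using z by (simp add: abs_square_le_1)
    then have e1: "\<epsilon> * (Re z)\<^sup>2 \<le> \<epsilon>" using \<epsilon> by simp
    have e2: "0 \<le> \<epsilon> * (Im z)\<^sup>2" using \<epsilon> by simp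
    have "Re (G z) + \<epsilon> * (Re z)\<^sup>2 - \<epsilon> * (Im z)\<^sup>2 \<le> \<epsilon>"
    proof (cases "\<bar>Im z\<bar> = R")
      case True
      then have "(Im z)\<^sup>2 = R\<^sup>2" by (metis power2_abs)
      then show ?thesis using bdd[of z] z R e1 by simp
    next
      case False
      then show ?thesis using bdry[of z] z e1 e2 by linarith
    qed
    then show "Re (G z + of_real \<epsilon> * z\<^sup>2) \<le> \<epsilon>"
      by (simp add: power2_eq_square algebra_simps)
  qed
  moreover have "0 \<le> \<epsilon> * (Re w * Re w)" using \<epsilon> by simp
  moreover have "Re (G w + of_real \<epsilon> * w\<^sup>2) = Re (G w) + \<epsilon> * (Re w * Re w) - \<epsilon> * (Im w * Im w)"
    by (simp add: power2_eq_square algebra_simps)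
  moreover have "e = \<epsilon> + \<epsilon> * (Im w * Im w)"
    using \<epsilon> by (simp add: power2_eq_square algebra_simps)
  ultimately show "Re (G w) \<le> 0 + e" by linarith
qed

text \<open>
  The weights \<open>cos (\<mu> k * t)\<close> on the right edge of the strip extend harmonically to
  \<open>sinh (\<mu> k * s) / sinh (\<mu> k) * cos (\<mu> k * t)\<close>, which is nonnegative at \<open>t = 0\<close>.
\<close>

lemma three_lines_cos_defect:
  fixes K :: "'k set" and L :: "'l set" and c :: "'k \<Rightarrow> complex" and \<beta> :: "'k \<Rightarrow> real" and m \<mu> :: "'l \<Rightarrow> real"
  defines "f \<equiv> \<lambda>w. \<Sum>k\<in>K. c k * exp (of_real (\<beta> k) * w)"
  assumes K: "finite K" and L: "finite L"
    and M: "0 < M0" "0 < M1"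
    and m: "\<And>k. k \<in> L \<Longrightarrow> 0 \<le> m k"
    and left: "\<And>t. cmod (f (\<i> * of_real t)) \<le> M0"
    and right: "\<And>t. cmod (f (1 + \<i> * of_real t)) \<le> M1 * (1 - (\<Sum>k\<in>L. m k * cos (\<mu> k * t)))"
    and \<theta>: "0 \<le> \<theta>" "\<theta> \<le> 1"
  shows "cmod (f (of_real \<theta>)) \<le> M0 powr (1 - \<theta>) * M1 powr \<theta>"
proof -
  \<comment> \<open>Frequency 0 is excluded because \<open>h\<close> divides by
    \<open>sinh (\<mu> k)\<close>. On the right edge such a term subtracts
    \<open>m k \<ge> 0\<close>, so leaving it out only weakens the bound.\<close>
  define L' where "L' = {k\<in>L. \<mu> k \<noteq> 0}"
  have L': "finite L'" using L by (simp add: L'_def)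
  define h where "h = (\<lambda>k w. (exp (of_real (\<mu> k) * w) - exp (- of_real (\<mu> k) * w)) / of_real (2 * sinh (\<mu> k)) :: complex)"
  \<comment> \<open>Division by the entire function that interpolates between \<open>M0\<close> and
    \<open>M1\<close> normalises both edge bounds to 1, up to the cosine defect.\<close>
  define g where "g = (\<lambda>w. f w * exp (- (of_real (ln M0) + of_real (ln M1 - ln M0) * w)))"
  \<comment> \<open>A rotation that makes the value at \<theta> a nonnegative real, so that a bound
    on the real part there is a bound on the modulus.\<close>
  define u where "u = (if g (of_real \<theta>) = 0 then 1 else cnj (g (of_real \<theta>)) / of_real (cmod (g (of_real \<theta>))))"
  have u: "cmod u = 1" "u * g (of_real \<theta>) = of_real (cmod (g (of_real \<theta>)))"
    by (auto simp: u_def norm_divide complex_norm_square[symmetric] mult.commute[of "cnj _"] power2_eq_square)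
  define G where "G = (\<lambda>w. u * g w - 1 + (\<Sum>k\<in>L'. of_real (m k) * h k w))"
  let ?s = "\<lambda>w. \<Sum>k\<in>L'. m k * (sinh (\<mu> k * Re w) * cos (\<mu> k * Im w) / sinh (\<mu> k))"
  have Re_h: "Re (h k w) = sinh (\<mu> k * Re w) * cos (\<mu> k * Im w) / sinh (\<mu> k)" for k w
  proof -
    have "Re (h k w) = (Re (exp (of_real (\<mu> k) * w)) - Re (exp (- of_real (\<mu> k) * w))) / (2 * sinh (\<mu> k))"
      by (simp add: h_def)
    then show ?thesis by (simp add: Re_exp sinh_def algebra_simps diff_divide_distrib)
  qed
  have cmod_g: "cmod (g w) = cmod (f w) * exp (- (ln M0 + (ln M1 - ln M0) * Re w))" for w
    by (simp add: g_def norm_mult)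
  have ReG: "Re (G w) \<le> cmod (g w) - 1 + (?s w)" for w
  proof -
    have "Re (u * g w) \<le> cmod (g w)"
      using complex_Re_le_cmod[of "u * g w"] u by (simp add: norm_mult)
    then show ?thesis by (simp add: G_def Re_sum Re_h)
  qed
  have "Re (G (of_real \<theta>)) \<le> 0"
  proof (rule Re_nonpos_in_strip[where G = G])
    show "G holomorphic_on UNIV"
      unfolding G_def g_def f_def h_def by (intro holomorphic_intros) (simp_all add: L'_def)
  next
    define B where "B = (\<Sum>k\<in>K. cmod (c k) * exp \<bar>\<beta> k\<bar>) * exp (\<bar>ln M0\<bar> + \<bar>ln M1 - ln M0\<bar>)
       + (\<Sum>k\<in>L'. m k)"
    fix w :: complex assume w: "0 \<le> Re w" "Re w \<le> 1"
    have mono: "\<bar>a * Re w\<bar> \<le> \<bar>a\<bar>" for a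
      using w by (simp add: abs_mult mult_left_le)
    have "cmod (f w) \<le> (\<Sum>k\<in>K. cmod (c k) * exp \<bar>\<beta> k\<bar>)"
      unfolding f_def
    proof (rule sum_norm_le)
      fix k
      have "\<beta> k * Re w \<le> \<bar>\<beta> k\<bar>" using mono[of "\<beta> k"] by linarith
      then show "cmod (c k * exp (of_real (\<beta> k) * w)) \<le> cmod (c k) * exp \<bar>\<beta> k\<bar>"
        by (simp add: norm_mult mult_left_mono)
    qed
    moreover have "exp (- (ln M0 + (ln M1 - ln M0) * Re w)) \<le> exp (\<bar>ln M0\<bar> + \<bar>ln M1 - ln M0\<bar>)"
    proof -
      define a b where "a = ln M1 - ln M0" and "b = a * Re w"
      have "\<bar>b\<bar> \<le> \<bar>a\<bar>" using mono[of a] by (simp add: b_def)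
      then have "- (ln M0 + b) \<le> \<bar>ln M0\<bar> + \<bar>a\<bar>" by linarith
      then show ?thesis by (simp add: a_def b_def)
    qed
    ultimately have g: "cmod (g w) \<le> (\<Sum>k\<in>K. cmod (c k) * exp \<bar>\<beta> k\<bar>) * exp (\<bar>ln M0\<bar> + \<bar>ln M1 - ln M0\<bar>)"
      unfolding cmod_g by (intro mult_mono) (auto intro: sum_nonneg)
    have "(?s w) \<le> (\<Sum>k\<in>L'. m k)"
    proof (rule sum_mono)
      fix k assume k: "k \<in> L'"
      have "\<bar>sinh (\<mu> k * Re w)\<bar> \<le> \<bar>sinh (\<mu> k)\<bar>"
        by (metis mono sinh_real_abs sinh_real_le_iff)
      then have "\<bar>sinh (\<mu> k * Re w) * cos (\<mu> k * Im w)\<bar> \<le> \<bar>sinh (\<mu> k)\<bar> * 1"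
        unfolding abs_mult by (intro mult_mono) auto
      then have "\<bar>sinh (\<mu> k * Re w) * cos (\<mu> k * Im w) / sinh (\<mu> k)\<bar> \<le> 1"
        by (auto simp: abs_divide divide_le_eq)
      then have "sinh (\<mu> k * Re w) * cos (\<mu> k * Im w) / sinh (\<mu> k) \<le> 1" by linarith
      from mult_left_mono[OF this, of "m k"] m[of k] k
      show "m k * (sinh (\<mu> k * Re w) * cos (\<mu> k * Im w) / sinh (\<mu> k)) \<le> m k"
        by (simp only: mult_1_right) (simp add: L'_def)
    qed
    then show "Re (G w) \<le> B" using ReG[of w] g by (simp add: B_def)
  next
    fix w :: complex assume w: "Re w = 0 \<or> Re w = 1"
    have weq: "w = of_real (Re w) + \<i> * of_real (Im w)"
      using complex_eq by simp
    show "Re (G w) \<le> 0"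
    proof (cases "Re w = 0")
      case True
      have "cmod (f w) \<le> M0" using left[of "Im w"] weq True by simp
      then have "cmod (g w) \<le> 1"
        using M True by (simp add: cmod_g exp_minus field_simps)
      then show ?thesis using ReG[of w] True by simp
    next
      case False
      then have 1: "Re w = 1" using w by simp
      have "cmod (g w) \<le> 1 - (\<Sum>k\<in>L. m k * cos (\<mu> k * Im w))"
        using right[of "Im w"] weq 1 M by (simp add: cmod_g exp_minus field_simps)
      moreover have "(?s w) =
          (\<Sum>k\<in>L'. m k * cos (\<mu> k * Im w))"
        using 1 by (intro sum.cong) (auto simp: L'_def)
      moreover have "\<dots> \<le> (\<Sum>k\<in>L. m k * cos (\<mu> k * Im w))"
        by (rule sum_mono2) (use L m in \<open>auto simp: L'_def\<close>)
      ultimately show ?thesis using ReG[of w] by linarith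
    qed
  qed (use \<theta> in auto)
  moreover have "Re (G (of_real \<theta>)) \<ge> cmod (g (of_real \<theta>)) - 1"
  proof -
    have "0 \<le> (\<Sum>k\<in>L'. m k * (sinh (\<mu> k * \<theta>) / sinh (\<mu> k)))"
    proof (rule sum_nonneg)
      fix k assume k: "k \<in> L'"
      have "0 \<le> sinh (\<mu> k * \<theta>) / sinh (\<mu> k)"
        using \<theta> by (cases "\<mu> k \<ge> 0") (auto simp: zero_le_divide_iff mult_nonpos_nonneg)
      then show "0 \<le> m k * (sinh (\<mu> k * \<theta>) / sinh (\<mu> k))"
        using k m by (intro mult_nonneg_nonneg) (auto simp: L'_def)
    qed
    then show ?thesis unfolding G_def by (simp add: Re_sum Re_h u)
  qed
  ultimately have "cmod (f (of_real \<theta>)) * exp (- (ln M0 + (ln M1 - ln M0) * \<theta>)) \<le> 1"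
    by (simp add: cmod_g)
  then have "cmod (f (of_real \<theta>)) \<le> exp (ln M0 + (ln M1 - ln M0) * \<theta>)"
    by (simp only: exp_minus inverse_eq_divide) (simp add: divide_simps)
  also have "\<dots> = M0 powr (1 - \<theta>) * M1 powr \<theta>"
    using M by (simp add: powr_def exp_add[symmetric] algebra_simps)
  finally show ?thesis .
qed

subsection \<open>Spectral decomposition of positive operators\<close>

lemma of_real_sum_cmod_square:
  "complex_of_real (sqnorm I f) = (\<Sum>m\<in>I. cnj (f m) * f m)"
  by (simp only: of_real_sum complex_norm_square mult.commute)

lemma psd_form_nonneg:
  assumes "op_psd I M"
  shows "0 \<le> Re (\<Sum>i\<in>I. \<Sum>j\<in>I. cnj (v i) * M i j * v j)"
    and "Im (\<Sum>i\<in>I. \<Sum>j\<in>I. cnj (v i) * M i j * v j) = 0"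
  using assms unfolding op_psd_def vec_inner_def op_apply_def
  by (auto simp: complex_nonneg_Reals_iff sum_distrib_left mult.assoc)

lemma form_two_points:
  fixes M :: "'i op"
  assumes "finite I" "i \<in> I" "j \<in> I" "i \<noteq> j"
    and v: "v = (\<lambda>k. if k = i then a else if k = j then b else 0)"
  shows "(\<Sum>k\<in>I. \<Sum>l\<in>I. cnj (v k) * M k l * v l) =
    cnj a * M i i * a + cnj a * M i j * b + cnj b * M j i * a + cnj b * M j j * b"
proof -
  have *: "(\<Sum>k\<in>I. f k) = f i + f j" if "\<And>k. k \<in> I - {i, j} \<Longrightarrow> f k = 0" for f :: "'i \<Rightarrow> complex"
  proof -
    have "(\<Sum>k\<in>I. f k) = (\<Sum>k\<in>{i, j}. f k)"
      by (rule sum.mono_neutral_right) (use assms that in auto)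
    then show ?thesis using assms by simp
  qed
  show ?thesis using \<open>i \<noteq> j\<close> by (subst *; (subst *)?) (auto simp: v *)
qed

text \<open>Polarisation: the form is real at two basis vectors, at their sum, and at the sum with
  the second one multiplied by \<open>\<i>\<close>. The last two compare the imaginary and the real
  parts of the off-diagonal entries.\<close>

lemma psd_hermitian:
  assumes "finite I" "op_psd I M" "i \<in> I" "j \<in> I"
  shows "M j i = cnj (M i j)"
proof (cases "i = j")
  case True
  define v where "v = (\<lambda>k. if k = i then 1 else 0 :: complex)"
  have "(\<Sum>k\<in>I. \<Sum>l\<in>I. cnj (v k) * M k l * v l) = M i i"
    using assms by (simp add: v_def if_distrib[of cnj] if_mults cong: if_cong)
  then show ?thesis
    using psd_form_nonneg(2)[OF assms(2), of v] True by (simp add: complex_eq_iff)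
next
  case False
  note tp = form_two_points[OF assms(1,3,4) False refl, of _ _ M]
  have ii: "Im (M i i) = 0"
    using psd_form_nonneg(2)[OF assms(2), of "\<lambda>k. if k = i then 1 else if k = j then 0 else 0"]
    unfolding tp[of 1 0] by simp
  have jj: "Im (M j j) = 0"
    using psd_form_nonneg(2)[OF assms(2), of "\<lambda>k. if k = i then 0 else if k = j then 1 else 0"]
    unfolding tp[of 0 1] by simp
  have "Im (M i i + M i j + M j i + M j j) = 0"
    using psd_form_nonneg(2)[OF assms(2), of "\<lambda>k. if k = i then 1 else if k = j then 1 else 0"]
    unfolding tp[of 1 1] by simp
  moreover have "Im (M i i + M i j * \<i> - \<i> * M j i + M j j) = 0"
    using psd_form_nonneg(2)[OF assms(2), of "\<lambda>k. if k = i then 1 else if k = j then \<i> else 0"]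
    unfolding tp[of 1 \<i>] by simp
  ultimately show ?thesis using ii jj by (simp add: complex_eq_iff)
qed

text \<open>\<open>P\<close> is the component of the unit vector at \<open>i\<close> that is
  orthogonal to the columns of \<open>U\<close>; the second claim is Pythagoras.\<close>

lemma orthonormal_defect:
  fixes U :: "'i \<Rightarrow> 'j \<Rightarrow> complex"
  assumes fin: "finite I" "finite J"
    and orth: "\<And>j j'. j \<in> J \<Longrightarrow> j' \<in> J \<Longrightarrow> (\<Sum>m\<in>I. cnj (U m j) * U m j') = (if j = j' then 1 else 0)"
    and i: "i \<in> I"
  defines "P \<equiv> \<lambda>m. (if m = i then 1 else 0) - (\<Sum>j\<in>J. U m j * cnj (U i j))"
  shows "j \<in> J \<Longrightarrow> (\<Sum>m\<in>I. cnj (U m j) * P m) = 0"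
    and "sqnorm I P = 1 - (sqnorm J (U i))"
proof -
  show orthP: "(\<Sum>m\<in>I. cnj (U m j) * P m) = 0" if "j \<in> J" for j
  proof -
    have "(\<Sum>m\<in>I. cnj (U m j) * P m) = cnj (U i j) - (\<Sum>m\<in>I. \<Sum>j'\<in>J. cnj (U m j) * U m j' * cnj (U i j'))"
      using fin i by (simp add: P_def right_diff_distrib sum_subtractf sum_distrib_left mult.assoc if_mult_right cong: if_cong)
    also have "(\<Sum>m\<in>I. \<Sum>j'\<in>J. cnj (U m j) * U m j' * cnj (U i j')) = (\<Sum>j'\<in>J. (\<Sum>m\<in>I. cnj (U m j) * U m j') * cnj (U i j'))"
      by (subst sum.swap) (simp add: sum_distrib_right)
    also have "\<dots> = cnj (U i j)"
      using fin that orth[OF that] by (simp add: if_mult_left cong: if_cong)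
    finally show ?thesis by simp
  qed
  have "complex_of_real (sqnorm I P) = (\<Sum>m\<in>I. cnj (P m) * P m)"
    by (rule of_real_sum_cmod_square)
  also have "\<dots> = (\<Sum>m\<in>I. (if m = i then 1 else 0) * P m - (\<Sum>j\<in>J. U i j * (cnj (U m j) * P m)))"
    by (intro sum.cong refl) (simp add: P_def left_diff_distrib sum_distrib_right mult.assoc mult.left_commute)
  also have "\<dots> = P i - (\<Sum>j\<in>J. U i j * (\<Sum>m\<in>I. cnj (U m j) * P m))"
    using fin i by (simp add: sum_subtractf sum_distrib_left if_mult_left sum.swap[of _ I] cong: if_cong)
  also have "\<dots> = P i" by (simp add: orthP)
  also have "\<dots> = complex_of_real (1 - (sqnorm J (U i)))"
    by (simp only: P_def of_real_diff of_real_1 of_real_sum complex_norm_square) simp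
  finally show "sqnorm I P = 1 - (sqnorm J (U i))"
    using of_real_eq_iff by blast
qed

lemma sum_orthonormal_weights:
  fixes U :: "'i \<Rightarrow> 'j \<Rightarrow> complex"
  assumes orth: "\<And>j. j \<in> J \<Longrightarrow> (\<Sum>m\<in>I. cnj (U m j) * U m j) = 1"
  shows "(\<Sum>i\<in>I. \<Sum>j\<in>J. (cmod (U i j))\<^sup>2) = real (card J)"
proof -
  have "(\<Sum>i\<in>I. (cmod (U i j))\<^sup>2) = 1" if "j \<in> J" for j
  proof -
    have "complex_of_real (\<Sum>i\<in>I. (cmod (U i j))\<^sup>2) = 1"
      unfolding of_real_sum_cmod_square by (rule orth[OF that])
    then show ?thesis using of_real_eq_1_iff by blast
  qed
  then show ?thesis by (subst sum.swap) simp
qed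

text \<open>The squared defects of all unit vectors are nonnegative and sum to
  \<open>card I - card I = 0\<close>, so each of them vanishes. Counting thus turns the column
  relations into the row relations.\<close>

lemma square_unitary_rows:
  fixes U :: "'i op"
  assumes fin: "finite I"
    and orth: "\<And>j j'. j \<in> I \<Longrightarrow> j' \<in> I \<Longrightarrow> (\<Sum>m\<in>I. cnj (U m j) * U m j') = (if j = j' then 1 else 0)"
    and "i \<in> I" "i' \<in> I"
  shows "(\<Sum>j\<in>I. U i j * cnj (U i' j)) = (if i = i' then 1 else 0)"
proof -
  define P where "P = (\<lambda>i m. (if m = i then 1 else 0) - (\<Sum>j\<in>I. U m j * cnj (U i j)))"
  have P: "sqnorm I (P i) = 1 - (sqnorm I (U i))" if "i \<in> I" for i
    unfolding P_def by (rule orthonormal_defect(2)[OF fin fin orth that])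
  have "(\<Sum>i\<in>I. \<Sum>m\<in>I. (cmod (P i m))\<^sup>2) = (\<Sum>i\<in>I. 1 - (sqnorm I (U i)))"
    using P by (intro sum.cong) auto
  also have "\<dots> = 0" using sum_orthonormal_weights[where I = I and J = I and U = U] orth by (simp add: sum_subtractf)
  finally have "\<forall>i\<in>I. (sqnorm I (P i)) = 0"
    using fin by (subst (asm) sum_nonneg_eq_0_iff) (auto intro: sum_nonneg)
  then have "sqnorm I (P i') = 0" using assms by blast
  then have "P i' i = 0" using assms by (subst (asm) sum_nonneg_eq_0_iff) auto
  then show ?thesis by (simp add: P_def split: if_splits)
qed

text \<open>Vectors are functions on a whole type, so compactness is Tychonoff's theorem in the
  product topology, with all coordinates outside \<open>I\<close> pinned to 0.\<close>

lemma compact_unit_cube: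
  "compact (PiE UNIV (\<lambda>i. if i \<in> I then cball 0 1 else {0}) :: ('i \<Rightarrow> complex) set)"
proof -
  have "compactin (product_topology (\<lambda>i::'i. euclidean) UNIV)
     (PiE UNIV (\<lambda>i. if i \<in> I then cball 0 1 else {0::complex}))"
    unfolding compactin_PiE by simp
  then show ?thesis by (simp add: euclidean_product_topology)
qed

text \<open>The quadratic form is maximised over the unit vectors orthogonal to the columns found so
  far. The residual of the maximiser stays in that orthogonal complement, and if it were nonzero,
  moving along it would increase the Rayleigh quotient to first order.\<close>

lemma exists_next_eigenvector:
  fixes M :: "'i op" and U :: "'i \<Rightarrow> 'j \<Rightarrow> complex"
  assumes fin: "finite I" "finite J" and card: "card J < card I"
    and herm: "\<And>i j. i \<in> I \<Longrightarrow> j \<in> I \<Longrightarrow> M j i = cnj (M i j)"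
    and orth: "\<And>j j'. j \<in> J \<Longrightarrow> j' \<in> J \<Longrightarrow> (\<Sum>m\<in>I. cnj (U m j) * U m j') = (if j = j' then 1 else 0)"
    and eigen: "\<And>i j. i \<in> I \<Longrightarrow> j \<in> J \<Longrightarrow> (\<Sum>k\<in>I. M i k * U k j) = of_real (d j) * U i j"
  shows "\<exists>v \<kappa>. (\<Sum>m\<in>I. cnj (v m) * v m) = 1 \<and> (\<forall>j\<in>J. (\<Sum>m\<in>I. cnj (U m j) * v m) = 0) \<and>
    (\<forall>i\<in>I. (\<Sum>k\<in>I. M i k * v k) = of_real \<kappa> * v i)"
proof -
  define B where "B = (\<lambda>v w. \<Sum>i\<in>I. \<Sum>k\<in>I. cnj (v i) * M i k * w k)"
  define W where "W = {v. \<forall>j\<in>J. (\<Sum>m\<in>I. cnj (U m j) * v m) = 0}"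
  let ?p = "\<lambda>j x. \<Sum>m\<in>I. cnj (U m j) * x m"
  define S where "S = {v. (\<forall>i. i \<notin> I \<longrightarrow> v i = 0) \<and> (sqnorm I v) = 1 \<and> v \<in> W}"
  have cont_coord: "continuous_on X (\<lambda>v :: 'i \<Rightarrow> complex. v i)" for X i
    by (intro continuous_on_subset[OF continuous_on_product_coordinates]) auto
  have "closed S"
  proof -
    have S_eq: "S = (\<Inter>i\<in>-I. {v. v i = 0}) \<inter> {v. (sqnorm I v) = 1} \<inter>
       (\<Inter>j\<in>J. {v. (?p j v) = 0})"
      by (auto simp: S_def W_def)
    show ?thesis unfolding S_eq
      by (intro closed_Int closed_INT ballI closed_Collect_eq continuous_intros cont_coord)
  qed
  moreover have "S \<subseteq> PiE UNIV (\<lambda>i. if i \<in> I then cball 0 1 else {0})"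
  proof
    fix v assume v: "v \<in> S"
    have "cmod (v i) \<le> 1" if "i \<in> I" for i
    proof -
      have "(cmod (v i))\<^sup>2 \<le> sqnorm I v"
        using fin that by (intro member_le_sum) auto
      then show ?thesis using v by (simp add: S_def abs_square_le_1)
    qed
    then show "v \<in> PiE UNIV (\<lambda>i. if i \<in> I then cball 0 1 else {0})"
      using v by (auto simp: S_def)
  qed
  ultimately have "compact S"
    using compact_Int_closed[OF compact_unit_cube[of I], of S] by (simp add: Int_absorb1)
  moreover have "S \<noteq> {}"
  proof -
    \<comment> \<open>The defects of the unit vectors sum to a positive number because there are
      fewer columns than labels; a unit vector with positive defect yields, after normalisation, an
      element of \<open>S\<close>.\<close>
    have "(\<Sum>i\<in>I. 1 - (sqnorm J (U i))) = real (card I) - real (card J)"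
      using sum_orthonormal_weights[where I = I and J = J and U = U] orth by (simp add: sum_subtractf)
    then have "0 < (\<Sum>i\<in>I. 1 - (sqnorm J (U i)))" using card by simp
    then obtain i where i: "i \<in> I" "0 < 1 - (sqnorm J (U i))"
      by (meson not_le sum_nonpos)
    define P where "P = (\<lambda>m. (if m = i then 1 else 0) - (\<Sum>j\<in>J. U m j * cnj (U i j)))"
    define r where "r = sqrt (sqnorm I P)"
    have defect: "\<And>j. j \<in> J \<Longrightarrow> (?p j P) = 0"
        "sqnorm I P = 1 - (sqnorm J (U i))"
      unfolding P_def by (rule orthonormal_defect[OF fin orth i(1)]; assumption)+
    have r: "r > 0" using i unfolding r_def defect(2) by simp
    define v where "v = (\<lambda>m. if m \<in> I then P m / of_real r else 0)"
    have "(?p j v) = 0" if "j \<in> J" for j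
    proof -
      have "(?p j v) = (?p j P) / of_real r"
        unfolding sum_divide_distrib by (intro sum.cong) (auto simp: v_def)
      then show ?thesis using defect(1)[OF that] by simp
    qed
    moreover have "sqnorm I v = 1"
    proof -
      have "sqnorm I v = (\<Sum>m\<in>I. (cmod (P m))\<^sup>2 / r\<^sup>2)"
        using r by (intro sum.cong) (auto simp: v_def norm_divide power_divide)
      also have "\<dots> = (sqnorm I P) / r\<^sup>2" by (simp add: sum_divide_distrib)
      also have "r\<^sup>2 = sqnorm I P" by (simp add: r_def sum_nonneg)
      finally show ?thesis using r by (auto simp: r_def)
    qed
    ultimately have "v \<in> S" by (auto simp: S_def W_def v_def)
    then show ?thesis by blast
  qed
  moreover have "continuous_on S (\<lambda>v. Re (B v v))"
    unfolding B_def
    by (intro continuous_on_Re continuous_on_sum continuous_on_mult continuous_on_cnj continuous_on_const cont_coord)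
  ultimately obtain v where v: "v \<in> S" and max: "\<And>w. w \<in> S \<Longrightarrow> Re (B w w) \<le> Re (B v v)"
    using continuous_attains_sup[of S "\<lambda>v. Re (B v v)"] by blast
  define \<kappa> where "\<kappa> = Re (B v v)"
  have homog: "Re (B w w) \<le> \<kappa> * (sqnorm I w)" if w: "w \<in> W" for w
  proof (cases "sqnorm I w = 0")
    case True
    then have "w m = 0" if "m \<in> I" for m
      using fin that by (subst (asm) sum_nonneg_eq_0_iff) auto
    then have "B w w = 0" by (simp add: B_def)
    then show ?thesis using True by simp
  next
    case False
    define r where "r = sqrt (sqnorm I w)"
    have "0 \<le> sqnorm I w" by (intro sum_nonneg) auto
    then have r: "r > 0" "r\<^sup>2 = sqnorm I w" using False by (auto simp: r_def)
    define w' where "w' = (\<lambda>m. if m \<in> I then w m / of_real r else 0)"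
    have "sqnorm I w' = (sqnorm I w) / r\<^sup>2"
      using r unfolding sum_divide_distrib
      by (intro sum.cong) (auto simp: w'_def norm_divide power_divide)
    then have "sqnorm I w' = 1" using r(1) by (simp flip: r(2))
    moreover have "(?p j w') = 0" if "j \<in> J" for j
    proof -
      have "(?p j w') = (?p j w) / of_real r"
        unfolding sum_divide_distrib by (intro sum.cong) (auto simp: w'_def)
      then show ?thesis using w that by (simp add: W_def)
    qed
    ultimately have "w' \<in> S" by (simp add: S_def W_def w'_def)
    then have "Re (B w' w') \<le> \<kappa>" using max by (simp add: \<kappa>_def)
    moreover have "B w' w' = B w w / of_real (r\<^sup>2)"
      unfolding B_def sum_divide_distrib
      by (intro sum.cong) (auto simp: w'_def power2_eq_square)
    ultimately have "Re (B w w) / r\<^sup>2 \<le> \<kappa>" by (simp only: Re_divide_of_real)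
    then show ?thesis unfolding r(2)[symmetric] using r(1) by (simp add: divide_le_eq)
  qed
  define w where "w = (\<lambda>i. of_real \<kappa> * v i - (\<Sum>k\<in>I. M i k * v k))"
  let ?wv = "(\<Sum>m\<in>I. cnj (w m) * v m)"
  have vW: "v \<in> W" and v1: "sqnorm I v = 1" using v by (auto simp: S_def)
  have "w \<in> W"
    unfolding W_def
  proof (clarify)
    fix j assume j: "j \<in> J"
    have "(\<Sum>m\<in>I. cnj (U m j) * (\<Sum>k\<in>I. M m k * v k)) = (\<Sum>k\<in>I. cnj (\<Sum>m\<in>I. M k m * U m j) * v k)"
    proof -
      have "(\<Sum>m\<in>I. cnj (U m j) * (\<Sum>k\<in>I. M m k * v k)) = (\<Sum>k\<in>I. \<Sum>m\<in>I. cnj (U m j) * M m k * v k)"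
        by (subst sum.swap) (simp add: sum_distrib_left mult.assoc)
      also have "\<dots> = (\<Sum>k\<in>I. \<Sum>m\<in>I. cnj (M k m * U m j) * v k)"
      proof (intro sum.cong refl)
        fix k m assume "k \<in> I" "m \<in> I"
        from herm[OF this] show "cnj (U m j) * M m k * v k = cnj (M k m * U m j) * v k" by simp
      qed
      finally show ?thesis by (simp add: sum_distrib_right)
    qed
    also have "\<dots> = (\<Sum>k\<in>I. of_real (d j) * (cnj (U k j) * v k))"
      using eigen j by (intro sum.cong) auto
    also have "\<dots> = 0" using vW j by (simp add: W_def flip: sum_distrib_left)
    finally have "(\<Sum>m\<in>I. cnj (U m j) * (\<Sum>k\<in>I. M m k * v k)) = 0" .
    moreover have "(\<Sum>m\<in>I. cnj (U m j) * (of_real \<kappa> * v m)) = of_real \<kappa> * (?p j v)"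
      by (simp add: sum_distrib_left mult.left_commute)
    ultimately show "(?p j w) = 0"
      using vW j by (simp add: w_def W_def right_diff_distrib sum_subtractf)
  qed
  define a where "a = sqnorm I w"
  define b where "b = \<kappa> * a - Re (B w w)"
  \<comment> \<open>Maximality compared with the varied vector \<open>y = v - t w\<close>: the
    first-order gain \<open>2 * a\<close> is dominated by the second-order term for every
    \<open>t > 0\<close>. A small enough \<open>t\<close> then forces \<open>a = 0\<close>.\<close>
  have ineq: "2 * a \<le> t * b" if "t > 0" for t
  proof -
    define y where "y = (\<lambda>m. v m - of_real t * w m)"
    have "y \<in> W"
      unfolding W_def
    proof (clarify)
      fix j assume j: "j \<in> J"
      have "(?p j y) = (\<Sum>m\<in>I. cnj (U m j) * v m - of_real t * (cnj (U m j) * w m))"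
        by (intro sum.cong refl) (simp add: y_def algebra_simps)
      also have "\<dots> = (?p j v) - of_real t * (?p j w)"
        by (simp only: sum_subtractf sum_distrib_left)
      finally show "(?p j y) = 0"
        using j vW \<open>w \<in> W\<close> by (simp add: W_def)
    qed
    have Byy: "B y y = B v v - of_real t * (B w v + B v w) + of_real (t\<^sup>2) * B w w"
    proof -
      have "B y y = (\<Sum>i\<in>I. \<Sum>k\<in>I. cnj (v i) * M i k * v k - of_real t * (cnj (w i) * M i k * v k + cnj (v i) * M i k * w k)
          + of_real (t\<^sup>2) * (cnj (w i) * M i k * w k))"
        unfolding B_def y_def by (intro sum.cong refl) (simp add: algebra_simps power2_eq_square)
      then show ?thesis
        by (simp only: B_def sum.distrib sum_subtractf sum_distrib_left[symmetric])
    qed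
    have Bvw: "B v w = cnj (B w v)"
    proof -
      have "B v w = (\<Sum>k\<in>I. \<Sum>i\<in>I. cnj (v i) * M i k * w k)" unfolding B_def by (rule sum.swap)
      also have "\<dots> = cnj (B w v)" unfolding B_def
        unfolding cnj_sum
      proof (intro sum.cong refl)
        fix k i assume "k \<in> I" "i \<in> I"
        from herm[OF this] show "cnj (v i) * M i k * w k = cnj (cnj (w k) * M k i * v i)" by simp
      qed
      finally show ?thesis .
    qed
    have yy: "sqnorm I y = 1 - 2 * t * Re ?wv + t\<^sup>2 * a"
    proof -
      have "(cmod (y m))\<^sup>2 = (cmod (v m))\<^sup>2 - 2 * t * Re (cnj (w m) * v m) + t\<^sup>2 * (cmod (w m))\<^sup>2" for m
        unfolding y_def cmod_power2 by (simp add: power2_eq_square algebra_simps)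
      then show ?thesis
        by (simp only: sum.distrib sum_subtractf v1 a_def sum_distrib_left[symmetric] Re_sum)
    qed
    have ww: "of_real \<kappa> * ?wv - B w v = of_real a"
    proof -
      have "of_real a = (\<Sum>m\<in>I. cnj (w m) * w m)"
        unfolding a_def by (rule of_real_sum_cmod_square)
      also have "\<dots> = (\<Sum>m\<in>I. cnj (w m) * (of_real \<kappa> * v m) - (\<Sum>k\<in>I. cnj (w m) * M m k * v k))"
        by (intro sum.cong refl) (simp add: w_def right_diff_distrib sum_distrib_left mult.assoc)
      also have "\<dots> = of_real \<kappa> * ?wv - B w v"
        unfolding B_def sum_subtractf sum_distrib_left by (simp add: mult.left_commute)
      finally show ?thesis by simp
    qed
    have "Re (B y y) = \<kappa> - 2 * t * Re (B w v) + t\<^sup>2 * Re (B w w)"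
      by (simp add: Byy Bvw \<kappa>_def)
    moreover have "\<kappa> * Re ?wv - Re (B w v) = a"
      using arg_cong[OF ww, of Re] by simp
    ultimately have "0 \<le> \<kappa> * (- 2 * t * Re ?wv + t\<^sup>2 * a)
       + 2 * t * (\<kappa> * Re ?wv - a) - t\<^sup>2 * Re (B w w)"
      using homog[OF \<open>y \<in> W\<close>] unfolding yy by (simp add: algebra_simps)
    then have "t * (2 * a) \<le> t * (t * b)" by (simp add: b_def algebra_simps power2_eq_square)
    then show ?thesis using that by simp
  qed
  have "a \<le> 0"
  proof (rule ccontr)
    assume "\<not> a \<le> 0"
    then have "0 < a / (\<bar>b\<bar> + 1)" by (simp add: add_nonneg_pos)
    from ineq[OF this] have "2 * a \<le> a * (b / (\<bar>b\<bar> + 1))" by simp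
    also have "\<dots> \<le> a * 1"
      using \<open>\<not> a \<le> 0\<close> by (intro mult_left_mono) (auto simp: divide_le_eq)
    finally show False using \<open>\<not> a \<le> 0\<close> by simp
  qed
  moreover have "0 \<le> a" unfolding a_def by (intro sum_nonneg) auto
  ultimately have "a = 0" by simp
  then have "w i = 0" if "i \<in> I" for i
    using that fin unfolding a_def by (subst (asm) sum_nonneg_eq_0_iff) auto
  then have "(\<Sum>k\<in>I. M i k * v k) = of_real \<kappa> * v i" if "i \<in> I" for i
    using that by (simp add: w_def)
  moreover have "(\<Sum>m\<in>I. cnj (v m) * v m) = 1"
    using arg_cong[OF v1, of complex_of_real] unfolding of_real_sum_cmod_square by simp
  ultimately show ?thesis using vW unfolding W_def by blast
qed

text \<open>Columns are labelled by elements of \<open>I\<close> itself, so that the case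
  \<open>J = I\<close> delivers a square matrix.\<close>

lemma exists_orthonormal_eigenvectors:
  fixes M :: "'i op"
  assumes fin: "finite I"
    and herm: "\<And>i j. i \<in> I \<Longrightarrow> j \<in> I \<Longrightarrow> M j i = cnj (M i j)"
    and "J \<subseteq> I"
  shows "\<exists>U d. (\<forall>j\<in>J. \<forall>j'\<in>J. (\<Sum>m\<in>I. cnj (U m j) * U m j') = (if j = j' then 1 else 0)) \<and>
    (\<forall>j\<in>J. \<forall>i\<in>I. (\<Sum>k\<in>I. M i k * U k j) = of_real (d j) * U i j)"
  using finite_subset[OF \<open>J \<subseteq> I\<close> fin] \<open>J \<subseteq> I\<close>
proof (induction J)
  case (insert n J)
  then obtain U d where "\<forall>j\<in>J. \<forall>j'\<in>J. (\<Sum>m\<in>I. cnj (U m j) * U m j') = (if j = j' then 1 else 0)"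
    "\<forall>j\<in>J. \<forall>i\<in>I. (\<Sum>k\<in>I. M i k * U k j) = of_real (d j) * U i j" by auto
  then have orth: "\<And>j j'. j \<in> J \<Longrightarrow> j' \<in> J \<Longrightarrow> (\<Sum>m\<in>I. cnj (U m j) * U m j') = (if j = j' then 1 else 0)" and
    eigen: "\<And>i j. i \<in> I \<Longrightarrow> j \<in> J \<Longrightarrow> (\<Sum>k\<in>I. M i k * U k j) = of_real (d j) * U i j"
    by blast+
  have "card (insert n J) \<le> card I" using insert fin by (intro card_mono) auto
  then have card: "card J < card I" using insert by simp
  have "\<exists>v \<kappa>. (\<Sum>m\<in>I. cnj (v m) * v m) = 1 \<and> (\<forall>j\<in>J. (\<Sum>m\<in>I. cnj (U m j) * v m) = 0) \<and>
    (\<forall>i\<in>I. (\<Sum>k\<in>I. M i k * v k) = of_real \<kappa> * v i)"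
    by (rule exists_next_eigenvector[OF fin \<open>finite J\<close> card]) (fact herm, fact orth, fact eigen)
  then obtain v \<kappa> where v: "(\<Sum>m\<in>I. cnj (v m) * v m) = 1" "\<forall>j\<in>J. (\<Sum>m\<in>I. cnj (U m j) * v m) = 0"
    "\<forall>i\<in>I. (\<Sum>k\<in>I. M i k * v k) = of_real \<kappa> * v i" by blast
  have v': "(\<Sum>m\<in>I. cnj (v m) * U m j) = 0" if "j \<in> J" for j
    using arg_cong[OF bspec[OF v(2) that], of cnj] by (simp add: mult.commute)
  define U' where "U' = (\<lambda>m j. if j = n then v m else U m j)"
  define d' where "d' = (\<lambda>j. if j = n then \<kappa> else d j)"
  have "(\<Sum>m\<in>I. cnj (U' m j) * U' m j') = (if j = j' then 1 else 0)" if "j \<in> insert n J" "j' \<in> insert n J" for j j'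
  proof -
    have "j \<noteq> n" if "j \<in> J" for j using that insert(2) by blast
    then show ?thesis
      using that insert(2) v(1,2) v' orth by (cases "j = n"; cases "j' = n") (auto simp: U'_def)
  qed
  moreover have "(\<Sum>k\<in>I. M i k * U' k j) = of_real (d' j) * U' i j" if "j \<in> insert n J" "i \<in> I" for i j
    using that v eigen by (auto simp: U'_def d'_def)
  ultimately show ?case by (intro exI[of _ U'] exI[of _ d']) auto
qed auto

lemma op_mult_diag_conj:
  assumes "finite I"
  shows "op_mult I U (op_mult I (op_diag d) (op_adj U)) i i' = (\<Sum>j\<in>I. U i j * of_real (d j) * cnj (U i' j))"
  unfolding op_mult_def op_diag_def op_adj_def
  using assms by (intro sum.cong refl) (simp add: if_mult_left cong: if_cong)

text \<open>The last clause ties \<open>op_fun\<close> to the very \<open>U\<close> and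
  \<open>d\<close> that diagonalise \<open>M\<close>. Working with the pair chosen inside
  \<open>op_fun\<close> avoids comparing different eigendecompositions.\<close>

definition spectral_data :: "'i set \<Rightarrow> 'i op \<Rightarrow> 'i op \<Rightarrow> ('i \<Rightarrow> real) \<Rightarrow> bool" where
  "spectral_data I M U d \<longleftrightarrow>
     (\<forall>j\<in>I. \<forall>j'\<in>I. (\<Sum>i\<in>I. cnj (U i j) * U i j') = (if j = j' then 1 else 0)) \<and>
     (\<forall>i\<in>I. \<forall>i'\<in>I. (\<Sum>j\<in>I. U i j * cnj (U i' j)) = (if i = i' then 1 else 0)) \<and>
     (\<forall>j\<in>I. 0 \<le> d j) \<and>
     (\<forall>i\<in>I. \<forall>i'\<in>I. M i i' = (\<Sum>j\<in>I. U i j * of_real (d j) * cnj (U i' j))) \<and>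
     (\<forall>g i i'. op_fun I g M i i' = (\<Sum>j\<in>I. U i j * of_real (g (d j)) * cnj (U i' j)))"

lemma spectralD:
  assumes "spectral_data I M U d"
  shows "j \<in> I \<Longrightarrow> j' \<in> I \<Longrightarrow> (\<Sum>i\<in>I. cnj (U i j) * U i j') = (if j = j' then 1 else 0)"
    and "i \<in> I \<Longrightarrow> i' \<in> I \<Longrightarrow> (\<Sum>j\<in>I. U i j * cnj (U i' j)) = (if i = i' then 1 else 0)"
    and "j \<in> I \<Longrightarrow> 0 \<le> d j"
    and "i \<in> I \<Longrightarrow> i' \<in> I \<Longrightarrow> M i i' = (\<Sum>j\<in>I. U i j * of_real (d j) * cnj (U i' j))"
    and "op_fun I g M i i' = (\<Sum>j\<in>I. U i j * of_real (g (d j)) * cnj (U i' j))"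
  using assms unfolding spectral_data_def by blast+

lemma psd_spectral:
  fixes M :: "'i op"
  assumes fin: "finite I" and psd: "op_psd I M"
  shows "\<exists>U d. spectral_data I M U d"
proof -
  have herm: "\<And>i j. i \<in> I \<Longrightarrow> j \<in> I \<Longrightarrow> M j i = cnj (M i j)"
    using psd_hermitian[OF fin psd] .
  have "\<exists>U d. (\<forall>j\<in>I. \<forall>j'\<in>I. (\<Sum>m\<in>I. cnj (U m j) * U m j') = (if j = j' then 1 else 0)) \<and>
    (\<forall>j\<in>I. \<forall>i\<in>I. (\<Sum>k\<in>I. M i k * U k j) = of_real (d j) * U i j)"
    by (rule exists_orthonormal_eigenvectors[OF fin]) (fact herm, rule order_refl)
  then obtain V e where "\<forall>j\<in>I. \<forall>j'\<in>I. (\<Sum>m\<in>I. cnj (V m j) * V m j') = (if j = j' then 1 else 0)"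
    "\<forall>j\<in>I. \<forall>i\<in>I. (\<Sum>k\<in>I. M i k * V k j) = of_real (e j) * V i j" by blast
  then have V: "\<And>j j'. j \<in> I \<Longrightarrow> j' \<in> I \<Longrightarrow> (\<Sum>m\<in>I. cnj (V m j) * V m j') = (if j = j' then 1 else 0)" and
    eigen: "\<And>i j. i \<in> I \<Longrightarrow> j \<in> I \<Longrightarrow> (\<Sum>k\<in>I. M i k * V k j) = of_real (e j) * V i j"
    by blast+
  have Vrows: "(\<Sum>j\<in>I. V i j * cnj (V i' j)) = (if i = i' then 1 else 0)" if "i \<in> I" "i' \<in> I" for i i'
    by (rule square_unitary_rows[OF fin V that])
  have "M i i' = (\<Sum>j\<in>I. V i j * of_real (e j) * cnj (V i' j))" if i: "i \<in> I" "i' \<in> I" for i i'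
  proof -
    have "M i i' = (\<Sum>k\<in>I. M i k * (\<Sum>j\<in>I. V k j * cnj (V i' j)))"
      using fin i by (simp add: Vrows if_mult_right cong: if_cong)
    also have "\<dots> = (\<Sum>j\<in>I. (\<Sum>k\<in>I. M i k * V k j) * cnj (V i' j))"
      unfolding sum_distribs by (subst sum.swap) (simp add: mult.assoc)
    also have "\<dots> = (\<Sum>j\<in>I. V i j * of_real (e j) * cnj (V i' j))"
      using i by (intro sum.cong) (auto simp: eigen)
    finally show ?thesis .
  qed
  then have "eigendecomposition I M V e"
    unfolding eigendecomposition_def op_unitary_def
    using V Vrows fin by (simp add: op_mult_diag_conj) (simp add: op_mult_def op_adj_def op_id_def)
  then have ex: "case (V, e) of (U, d) \<Rightarrow> eigendecomposition I M U d" by simp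
  \<comment> \<open>\<open>V\<close> and \<open>e\<close> only show that an eigendecomposition
    exists; from here on the pair selected by \<open>op_fun\<close> is used.\<close>
  define Ud where "Ud = (SOME (U, d). eigendecomposition I M U d)"
  obtain U d where Ud: "Ud = (U, d)" by (cases Ud)
  have eig: "eigendecomposition I M U d"
    using someI[of "\<lambda>(U, d). eigendecomposition I M U d", OF ex] by (simp flip: Ud_def add: Ud)
  have cols: "(\<Sum>i\<in>I. cnj (U i j) * U i j') = (if j = j' then 1 else 0)"
    and rows: "(\<Sum>i\<in>I. U j i * cnj (U j' i)) = (if j = j' then 1 else 0)"
    if "j \<in> I" "j' \<in> I" for j j'
    using eig that unfolding eigendecomposition_def op_unitary_def
    by (auto simp: op_mult_def op_adj_def op_id_def)
  have M: "M i i' = (\<Sum>j\<in>I. U i j * of_real (d j) * cnj (U i' j))" if "i \<in> I" "i' \<in> I" for i i'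
    using eig that fin unfolding eigendecomposition_def by (simp add: op_mult_diag_conj)
  have nonneg: "0 \<le> d j" if "j \<in> I" for j
  proof -
    have eq: "(\<Sum>k\<in>I. M i k * U k j) = of_real (d j) * U i j" if "i \<in> I" for i
    proof -
      have "(\<Sum>k\<in>I. M i k * U k j) = (\<Sum>l\<in>I. U i l * of_real (d l) * (\<Sum>k\<in>I. cnj (U k l) * U k j))"
        unfolding sum_distrib_left using that
        by (subst sum.swap) (simp add: M sum_distrib_right mult.assoc)
      also have "\<dots> = of_real (d j) * U i j"
        using \<open>j \<in> I\<close> fin by (simp add: cols if_mult_right cong: if_cong)
      finally show ?thesis .
    qed
    have "(\<Sum>i\<in>I. \<Sum>k\<in>I. cnj (U i j) * M i k * U k j) = (\<Sum>i\<in>I. of_real (d j) * (cnj (U i j) * U i j))"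
    proof (intro sum.cong refl)
      fix i assume "i \<in> I"
      have "(\<Sum>k\<in>I. cnj (U i j) * M i k * U k j) = cnj (U i j) * (\<Sum>k\<in>I. M i k * U k j)"
        by (simp add: sum_distrib_left mult.assoc)
      then show "(\<Sum>k\<in>I. cnj (U i j) * M i k * U k j) = of_real (d j) * (cnj (U i j) * U i j)"
        using eq[OF \<open>i \<in> I\<close>] by simp
    qed
    also have "\<dots> = of_real (d j)" using that by (simp add: cols flip: sum_distrib_left)
    finally show ?thesis using psd_form_nonneg(1)[OF psd, of "\<lambda>i. U i j"] by simp
  qed
  have "op_fun I g M i i' = (\<Sum>j\<in>I. U i j * of_real (g (d j)) * cnj (U i' j))" for g i i'
    using fin by (simp add: op_fun_def Ud op_mult_diag_conj flip: Ud_def)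
  with cols rows nonneg M have "spectral_data I M U d"
    unfolding spectral_data_def by blast
  then show ?thesis by blast
qed

subsection \<open>Interpolation in an eigenbasis of the reference state\<close>

text \<open>The Hilbert-Schmidt inner product of two combinations of rank-one operators, reduced to
  the Gram matrices of their left and right vectors.\<close>

lemma sum_rank_one_inner:
  fixes g g' :: "'i \<Rightarrow> complex"
  shows "(\<Sum>a\<in>A. \<Sum>b\<in>B. cnj (\<Sum>i\<in>I. g i * x i a * cnj (y i b)) * (\<Sum>i'\<in>I. g' i' * x' i' a * cnj (y' i' b))) =
    (\<Sum>i\<in>I. \<Sum>i'\<in>I. cnj (g i) * g' i' * (\<Sum>a\<in>A. cnj (x i a) * x' i' a) * (\<Sum>b\<in>B. y i b * cnj (y' i' b)))"
proof -
  have "(\<Sum>a\<in>A. \<Sum>b\<in>B. cnj (\<Sum>i\<in>I. g i * x i a * cnj (y i b)) * (\<Sum>i'\<in>I. g' i' * x' i' a * cnj (y' i' b))) =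
     (\<Sum>(a,b)\<in>A \<times> B. \<Sum>(i,i')\<in>I \<times> I. cnj (g i) * g' i' * (cnj (x i a) * x' i' a) * (y i b * cnj (y' i' b)))"
    unfolding sum.cartesian_product[symmetric] cnj_sum sum_product
    by (intro sum.cong refl) (simp add: mult_ac)
  also have "\<dots> = (\<Sum>(i,i')\<in>I \<times> I. \<Sum>(a,b)\<in>A \<times> B. cnj (g i) * g' i' * (cnj (x i a) * x' i' a) * (y i b * cnj (y' i' b)))"
    unfolding case_prod_unfold by (rule sum.swap)
  also have "\<dots> = (\<Sum>i\<in>I. \<Sum>i'\<in>I. cnj (g i) * g' i' * (\<Sum>a\<in>A. cnj (x i a) * x' i' a) * (\<Sum>b\<in>B. y i b * cnj (y' i' b)))"
    unfolding sum.cartesian_product[symmetric]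
    unfolding mult.assoc[of "cnj _ * _"] sum_product unfolding sum_distrib_left ..
  finally show ?thesis .
qed

text \<open>All data are coordinates in an eigenbasis of \<sigma>: \<open>s\<close> holds its
  eigenvalues, positive on \<open>B0\<close>; \<open>D\<close> and \<open>u\<close> are the
  eigenvalues and eigenvectors of the normalised power of the sandwiched operator;
  \<open>A j z\<close> are the coefficients of the difference channel at outcome \<open>j\<close>,
  and \<open>X j\<close> is the matching part of the contraction. \<open>trace_bound\<close> serves
  the left edge, \<open>coll\<close> and \<open>L\<close> serve the right edge.\<close>

lemma interpolation_core:
  fixes Z :: "'z set" and B B0 :: "'b set" and I :: "'i set" and J :: "'j set"
    and u :: "'i \<Rightarrow> 'z \<Rightarrow> 'b \<Rightarrow> complex" and X :: "'j \<Rightarrow> 'b \<Rightarrow> 'b \<Rightarrow> complex"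
    and s :: "'b \<Rightarrow> real" and D :: "'i \<Rightarrow> real" and A :: "'j \<Rightarrow> 'z \<Rightarrow> real" and w :: "'j \<Rightarrow> real"
  assumes fin: "finite Z" "finite B" "finite I" "finite J" and B0: "B0 \<subseteq> B"
    and s: "\<And>a. a \<in> B0 \<Longrightarrow> 0 < s a"
    and D: "\<And>i. i \<in> I \<Longrightarrow> 0 < D i" "(\<Sum>i\<in>I. D i) = 1"
    and orth: "\<And>i i'. i \<in> I \<Longrightarrow> i' \<in> I \<Longrightarrow>
       (\<Sum>z\<in>Z. \<Sum>a\<in>B. cnj (u i z a) * u i' z a) = (if i = i' then 1 else 0)"
    and trace_bound: "\<And>x y. cmod (\<Sum>z\<in>Z. \<Sum>j\<in>J. of_real (A j z) * (\<Sum>a\<in>B. \<Sum>b\<in>B. cnj (y z b) * X j b a * x z a))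
       \<le> (\<Sum>z\<in>Z. \<Sum>a\<in>B. (cmod (x z a))\<^sup>2) + (\<Sum>z\<in>Z. \<Sum>a\<in>B. (cmod (y z a))\<^sup>2)"
    and w: "\<And>j. j \<in> J \<Longrightarrow> 0 < w j"
    and coll: "\<And>z z'. z \<in> Z \<Longrightarrow> z' \<in> Z \<Longrightarrow> (\<Sum>j\<in>J. A j z * A j z' / w j) \<le> (if z = z' then 1 else 0)"
    and L: "0 < L" "(\<Sum>j\<in>J. w j * (\<Sum>a\<in>B0. \<Sum>b\<in>B0. sqrt (s a * s b) * (cmod (X j b a))\<^sup>2)) \<le> L"
    and \<theta>: "0 \<le> \<theta>" "\<theta> \<le> 1"
  shows "cmod (\<Sum>i\<in>I. \<Sum>a\<in>B0. \<Sum>b\<in>B0. of_real (D i powr (1 - \<theta> / 2) * s a powr (\<theta> / 4) * s b powr (\<theta> / 4)) *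
      (\<Sum>z\<in>Z. \<Sum>j\<in>J. of_real (A j z) * X j b a * u i z a * cnj (u i z b)))
    \<le> 2 powr (1 - \<theta>) * sqrt L powr \<theta>"
proof -
  have finB0: "finite B0" using fin B0 finite_subset by blast
  define \<Phi> where "\<Phi> = (\<lambda>i a b. \<Sum>z\<in>Z. \<Sum>j\<in>J. of_real (A j z) * X j b a * u i z a * cnj (u i z b))"
  define c where "c = (\<lambda>(i, a, b). of_real (D i) * \<Phi> i a b)"
  define \<beta> where "\<beta> = (\<lambda>(i, a, b). (ln (s a) + ln (s b)) / 4 - ln (D i) / 2)"
  define f where "f = (\<lambda>v. \<Sum>k\<in>I \<times> B0 \<times> B0. c k * exp (of_real (\<beta> k) * v))"
  define M where "M = (\<lambda>z z'. \<Sum>j\<in>J. A j z * A j z' / w j)"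
  define G where "G = (\<lambda>i z i' z'. \<Sum>a\<in>B. cnj (u i z a) * u i' z' a)"
  \<comment> \<open>Nonnegative because \<open>M z z' \<le> 0\<close> off the diagonal. The factor
    1/2 is the share of this term in the arithmetic-geometric mean taken on the right edge.\<close>
  define m where "m = (\<lambda>(z, z', i, i'). - M z z' * sqrt (D i * D i') * (cmod (G i z i' z'))\<^sup>2 / 2)"
  define \<mu> where "\<mu> = (\<lambda>(z :: 'z, z' :: 'z, i, i'). (ln (D i) - ln (D i')) / 2)"
  define K' where "K' = (SIGMA z:Z. SIGMA z':Z - {z}. I \<times> I)"
  have f_eq: "f v = (\<Sum>i\<in>I. \<Sum>a\<in>B0. \<Sum>b\<in>B0. of_real (D i) * exp (- of_real (ln (D i)) / 2 * v) *
      exp (of_real (ln (s a)) / 4 * v) * exp (of_real (ln (s b)) / 4 * v) * \<Phi> i a b)" for v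
    unfolding f_def sum_Times
  proof (intro sum.cong refl)
    fix i a b
    have "exp (of_real (\<beta> (i, a, b)) * v) = exp (- of_real (ln (D i)) / 2 * v + of_real (ln (s a)) / 4 * v + of_real (ln (s b)) / 4 * v)"
      by (rule arg_cong[of _ _ exp]) (simp add: \<beta>_def field_simps)
    then show "c (i, a, b) * exp (of_real (\<beta> (i, a, b)) * v) = of_real (D i) * exp (- of_real (ln (D i)) / 2 * v) *
      exp (of_real (ln (s a)) / 4 * v) * exp (of_real (ln (s b)) / 4 * v) * \<Phi> i a b"
      by (simp only: c_def prod.case exp_add mult_ac)
  qed
  have "cmod (f (of_real \<theta>)) \<le> 2 powr (1 - \<theta>) * sqrt L powr \<theta>"
    unfolding f_def
  proof (rule three_lines_cos_defect[where m = m and \<mu> = \<mu> and L = K'])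
    show "finite (I \<times> B0 \<times> B0)" "finite K'" using fin finB0 by (auto simp: K'_def)
    show "0 \<le> m k" if "k \<in> K'" for k
    proof -
      obtain z z' i i' where k: "k = (z, z', i, i')" by (cases k) auto
      have zz: "z \<in> Z" "z' \<in> Z" "z \<noteq> z'" "i \<in> I" "i' \<in> I" using that by (auto simp: K'_def k)
      have "M z z' \<le> 0" using coll[of z z'] zz by (simp add: M_def)
      moreover have "0 \<le> D i" "0 \<le> D i'" using D(1) zz by (auto simp: less_imp_le)
      ultimately show ?thesis by (simp add: m_def k mult_nonpos_nonneg)
    qed
  next
    fix t
    define \<phi> where "\<phi> = (\<lambda>x. exp (\<i> * of_real (t * x)))"
    have \<phi>: "cmod (\<phi> x) = 1" for x by (simp add: \<phi>_def)
    let ?w = "\<lambda>i. \<Sum>a\<in>B0. \<Sum>b\<in>B0. \<phi> (ln (s a) / 4) * \<phi> (ln (s b) / 4) * \<Phi> i a b"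
    have "f (\<i> * of_real t) = (\<Sum>i\<in>I. of_real (D i) * \<phi> (- ln (D i) / 2) *
       (?w i))"
      unfolding f_eq \<phi>_def by (simp add: sum_distrib_left mult_ac)
    moreover have "cmod (?w i) \<le> 2" if i: "i \<in> I" for i
    proof -
      \<comment> \<open>On the imaginary axis the powers of \<open>s\<close> are phases. They are
        absorbed into two test vectors, conjugated in \<open>y\<close> because that slot is
        antilinear; the norms can only shrink, by the restriction to \<open>B0\<close>.\<close>
      define x where "x = (\<lambda>z a. if a \<in> B0 then \<phi> (ln (s a) / 4) * u i z a else 0)"
      define y where "y = (\<lambda>z a. if a \<in> B0 then cnj (\<phi> (ln (s a) / 4)) * u i z a else 0)"
      let ?t = "\<lambda>j z a b. of_real (A j z) * (cnj (y z b) * X j b a * x z a)"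
      have "(?w i) =
        (\<Sum>a\<in>B0. \<Sum>b\<in>B0. \<Sum>z\<in>Z. \<Sum>j\<in>J. ?t j z a b)"
        by (intro sum.cong refl) (simp add: \<Phi>_def x_def y_def sum_distrib_left mult_ac)
      also have "\<dots> = (\<Sum>a\<in>B. \<Sum>b\<in>B. \<Sum>z\<in>Z. \<Sum>j\<in>J. ?t j z a b)"
      proof -
        have "(\<Sum>a\<in>B0. \<Sum>b\<in>B0. \<Sum>z\<in>Z. \<Sum>j\<in>J. ?t j z a b) =
           (\<Sum>a\<in>B0. \<Sum>b\<in>B. \<Sum>z\<in>Z. \<Sum>j\<in>J. ?t j z a b)"
          by (intro sum.cong refl sum.mono_neutral_left) (use fin B0 in \<open>auto simp: y_def\<close>)
        also have "\<dots> = (\<Sum>a\<in>B. \<Sum>b\<in>B. \<Sum>z\<in>Z. \<Sum>j\<in>J. ?t j z a b)"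
          by (intro sum.mono_neutral_left) (use fin B0 in \<open>auto simp: x_def\<close>)
        finally show ?thesis .
      qed
      also have "\<dots> = (\<Sum>p\<in>B \<times> B. \<Sum>q\<in>Z \<times> J. ?t (snd q) (fst q) (fst p) (snd p))"
        by (simp add: sum_Times)
      also have "\<dots> = (\<Sum>q\<in>Z \<times> J. \<Sum>p\<in>B \<times> B. ?t (snd q) (fst q) (fst p) (snd p))"
        by (rule sum.swap)
      also have "\<dots> = (\<Sum>z\<in>Z. \<Sum>j\<in>J. of_real (A j z) * (\<Sum>a\<in>B. \<Sum>b\<in>B. cnj (y z b) * X j b a * x z a))"
        by (simp add: sum_Times sum_distrib_left)
      finally have eq: "(?w i) =
        (\<Sum>z\<in>Z. \<Sum>j\<in>J. of_real (A j z) * (\<Sum>a\<in>B. \<Sum>b\<in>B. cnj (y z b) * X j b a * x z a))" .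
      have "complex_of_real (\<Sum>z\<in>Z. \<Sum>a\<in>B. (cmod (u i z a))\<^sup>2) = 1"
        using orth[OF i i] by (simp only: of_real_sum complex_norm_square mult.commute) simp
      then have u1: "(\<Sum>z\<in>Z. \<Sum>a\<in>B. (cmod (u i z a))\<^sup>2) = 1" by (simp only: of_real_eq_1_iff)
      have "(\<Sum>z\<in>Z. \<Sum>a\<in>B. (cmod (x z a))\<^sup>2) \<le> (\<Sum>z\<in>Z. \<Sum>a\<in>B. (cmod (u i z a))\<^sup>2)"
        "(\<Sum>z\<in>Z. \<Sum>a\<in>B. (cmod (y z a))\<^sup>2) \<le> (\<Sum>z\<in>Z. \<Sum>a\<in>B. (cmod (u i z a))\<^sup>2)"
        by (intro sum_mono; simp add: x_def y_def norm_mult \<phi>)+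
      then show ?thesis unfolding eq using trace_bound[of y x] u1 by linarith
    qed
    ultimately have "cmod (f (\<i> * of_real t)) \<le> (\<Sum>i\<in>I. D i * 2)"
      by (auto intro!: sum_norm_le mult_mono simp: norm_mult \<phi> less_imp_le[OF D(1)])
    also have "\<dots> = 2" using D(2) by (simp flip: sum_distrib_right)
    finally show "cmod (\<Sum>k\<in>I \<times> B0 \<times> B0. c k * exp (of_real (\<beta> k) * (\<i> * of_real t))) \<le> 2"
      by (simp add: f_def)
  next
    fix t
    \<comment> \<open>\<open>g i\<close> is \<open>D i\<close> to the power
      \<open>(1 - \<i> * t) / 2\<close>; \<open>Y z\<close> is the diagonal block at
      \<open>z\<close> of the operator with these eigenvalues, and \<open>T z z'\<close> the overlap
      of two blocks.\<close>
    define g where "g = (\<lambda>i. exp (of_real (ln (D i)) * (1/2 - \<i> * of_real t / 2)))"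
    define Y where "Y = (\<lambda>z a b. \<Sum>i\<in>I. g i * u i z a * cnj (u i z b))"
    define V where "V = (\<lambda>j a b. \<Sum>z\<in>Z. of_real (A j z) * Y z a b)"
    let ?V2 = "\<lambda>S j. \<Sum>a\<in>S. \<Sum>b\<in>S. (cmod (V j a b))\<^sup>2"
    define e where "e = (\<lambda>a. exp (of_real (ln (s a)) / 4 * (1 + \<i> * of_real t)))"
    define T where "T = (\<lambda>z z'. \<Sum>a\<in>B. \<Sum>b\<in>B. cnj (Y z a b) * Y z' a b)"
    let ?r = "\<lambda>i z i' z'. sqrt (D i * D i') * (cmod (G i z i' z'))\<^sup>2 * cos (t * (ln (D i) - ln (D i')) / 2)"
    let ?MT = "(\<Sum>z\<in>Z. \<Sum>z'\<in>Z. M z z' * Re (T z z'))"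
    let ?c = "(\<Sum>k\<in>K'. m k * cos (\<mu> k * t))"
    have gg: "Re (cnj (g i) * g i') = sqrt (D i * D i') * cos (t * (ln (D i) - ln (D i')) / 2)" if "i \<in> I" "i' \<in> I" for i i'
    proof -
      have "cnj (g i) * g i' = exp (of_real ((ln (D i) + ln (D i')) / 2)) * exp (\<i> * of_real (t * (ln (D i) - ln (D i')) / 2))"
        unfolding g_def exp_cnj exp_add[symmetric] by (rule arg_cong[of _ _ exp]) (simp add: field_simps)
      moreover have "exp ((ln (D i) + ln (D i')) / 2) = sqrt (D i * D i')"
      proof -
        have "exp ((ln (D i) + ln (D i')) / 2) = exp (ln (D i * D i') * (1/2))"
          using D(1)[OF that(1)] D(1)[OF that(2)] by (simp add: ln_mult)
        also have "\<dots> = (D i * D i') powr (1/2)"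
          using D(1)[OF that(1)] D(1)[OF that(2)] by (simp add: powr_def)
        finally show ?thesis using D(1)[OF that(1)] D(1)[OF that(2)] by (simp add: powr_half_sqrt)
      qed
      ultimately show ?thesis by (simp add: Re_exp exp_of_real del: of_real_divide)
    qed
    have ReT: "Re (T z z') = (\<Sum>i\<in>I. \<Sum>i'\<in>I. ?r i z i' z')" for z z'
    proof -
      have "T z z' = (\<Sum>i\<in>I. \<Sum>i'\<in>I. cnj (g i) * g i' * G i z i' z' * cnj (G i z i' z'))"
        unfolding T_def Y_def sum_rank_one_inner G_def by (simp add: cnj_sum)
      then have "Re (T z z') = (\<Sum>i\<in>I. \<Sum>i'\<in>I. Re (cnj (g i) * g i' * of_real ((cmod (G i z i' z'))\<^sup>2)))"
        by (simp add: mult.assoc Re_sum flip: complex_norm_square of_real_power)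
      also have "\<dots> = (\<Sum>i\<in>I. \<Sum>i'\<in>I. ?r i z i' z')"
      proof (intro sum.cong refl)
        fix i i' assume "i \<in> I" "i' \<in> I"
        have "Re (cnj (g i) * g i' * of_real r) = Re (cnj (g i) * g i') * r" for r
          by (simp add: algebra_simps)
        then show "Re (cnj (g i) * g i' * of_real ((cmod (G i z i' z'))\<^sup>2)) =
            ?r i z i' z'"
          using gg[OF \<open>i \<in> I\<close> \<open>i' \<in> I\<close>] by (simp only:) simp
      qed
      finally show ?thesis .
    qed
    have T_diag: "Re (T z z) = (\<Sum>a\<in>B. \<Sum>b\<in>B. (cmod (Y z a b))\<^sup>2)" for z
    proof -
      have "T z z = complex_of_real (\<Sum>a\<in>B. \<Sum>b\<in>B. (cmod (Y z a b))\<^sup>2)"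
        unfolding T_def of_real_sum by (simp only: complex_norm_square mult.commute)
      then show ?thesis by simp
    qed
    \<comment> \<open>The diagonal blocks carry at most the whole Hilbert-Schmidt norm, which is the
      sum of the \<open>D i\<close> since \<open>g i\<close> has squared modulus
      \<open>D i\<close>.\<close>
    have diag: "(\<Sum>z\<in>Z. Re (T z z)) \<le> 1"
    proof -
      define F where "F = (\<lambda>p q. \<Sum>i\<in>I. g i * u i (fst p) (snd p) * cnj (u i (fst q) (snd q)))"
      let ?O = "\<lambda>i i'. \<Sum>p\<in>Z \<times> B. cnj (u i (fst p) (snd p)) * u i' (fst p) (snd p)"
      let ?F2 = "(\<Sum>p\<in>Z \<times> B. \<Sum>q\<in>Z \<times> B. (cmod (F p q))\<^sup>2)"
      have orth': "(?O i i') = (if i = i' then 1 else 0)"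
        if "i \<in> I" "i' \<in> I" for i i'
        using orth[OF that] by (simp add: sum_Times)
      have "(\<Sum>z\<in>Z. Re (T z z)) = (\<Sum>z\<in>Z. \<Sum>a\<in>B. \<Sum>b\<in>B. (cmod (F (z, a) (z, b)))\<^sup>2)"
        by (simp add: T_diag F_def Y_def)
      also have "\<dots> \<le> (\<Sum>z\<in>Z. \<Sum>a\<in>B. \<Sum>z'\<in>Z. \<Sum>b\<in>B. (cmod (F (z, a) (z', b)))\<^sup>2)"
      proof (intro sum_mono)
        fix z a assume "z \<in> Z" "a \<in> B"
        then show "(\<Sum>b\<in>B. (cmod (F (z, a) (z, b)))\<^sup>2) \<le> (\<Sum>z'\<in>Z. \<Sum>b\<in>B. (cmod (F (z, a) (z', b)))\<^sup>2)"
          using fin by (intro member_le_sum[of z Z "\<lambda>z'. \<Sum>b\<in>B. (cmod (F (z, a) (z', b)))\<^sup>2"]) (auto intro: sum_nonneg)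
      qed
      also have "\<dots> = ?F2"
        by (simp add: sum_Times)
      finally have le: "(\<Sum>z\<in>Z. Re (T z z)) \<le> ?F2" .
      have "complex_of_real ?F2 = (\<Sum>p\<in>Z \<times> B. \<Sum>q\<in>Z \<times> B. cnj (F p q) * F p q)"
        unfolding of_real_sum by (simp only: complex_norm_square mult.commute)
      also have "\<dots> = (\<Sum>i\<in>I. \<Sum>i'\<in>I. cnj (g i) * g i' * (?O i i') *
          cnj (?O i i'))"
        unfolding F_def sum_rank_one_inner by (simp add: cnj_sum)
      also have "\<dots> = (\<Sum>i\<in>I. \<Sum>i'\<in>I. if i = i' then cnj (g i) * g i' else 0)"
      proof (intro sum.cong refl)
        fix i i' assume "i \<in> I" "i' \<in> I"
        show "cnj (g i) * g i' * (?O i i') *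
          cnj (?O i i') = (if i = i' then cnj (g i) * g i' else 0)"
          unfolding orth'[OF \<open>i \<in> I\<close> \<open>i' \<in> I\<close>] by simp
      qed
      also have "\<dots> = (\<Sum>i\<in>I. cnj (g i) * g i)" using fin by simp
      finally have "complex_of_real ?F2 = (\<Sum>i\<in>I. cnj (g i) * g i)" .
      from arg_cong[OF this, of Re]
      have "?F2 = (\<Sum>i\<in>I. Re (cnj (g i) * g i))"
        by (simp only: Re_complex_of_real Re_sum)
      also have "\<dots> = (\<Sum>i\<in>I. D i)"
        using gg D(1) by (intro sum.cong refl) (simp add: less_imp_le)
      finally show ?thesis using le D(2) by simp
    qed
    have V_sum: "(\<Sum>j\<in>J. (?V2 B j) / w j) = ?MT"
    proof -
      have V2: "(?V2 B j) = (\<Sum>z\<in>Z. \<Sum>z'\<in>Z. A j z * A j z' * Re (T z z'))" for j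
      proof -
        have "complex_of_real (?V2 B j) = (\<Sum>a\<in>B. \<Sum>b\<in>B. cnj (V j a b) * V j a b)"
          unfolding of_real_sum by (simp only: complex_norm_square mult.commute)
        also have "\<dots> = (\<Sum>p\<in>B \<times> B. \<Sum>q\<in>Z \<times> Z. of_real (A j (fst q) * A j (snd q)) * (cnj (Y (fst q) (fst p) (snd p)) * Y (snd q) (fst p) (snd p)))"
          unfolding sum_Times V_def cnj_sum sum_product
          by (intro sum.cong refl) (simp add: mult_ac)
        also have "\<dots> = (\<Sum>q\<in>Z \<times> Z. \<Sum>p\<in>B \<times> B. of_real (A j (fst q) * A j (snd q)) * (cnj (Y (fst q) (fst p) (snd p)) * Y (snd q) (fst p) (snd p)))"
          by (rule sum.swap)
        also have "\<dots> = (\<Sum>z\<in>Z. \<Sum>z'\<in>Z. of_real (A j z * A j z') * T z z')"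
          by (simp add: T_def sum_Times sum_distrib_left)
        finally have "complex_of_real (?V2 B j) = (\<Sum>z\<in>Z. \<Sum>z'\<in>Z. of_real (A j z * A j z') * T z z')" .
        from arg_cong[OF this, of Re] show ?thesis by (simp only: Re_complex_of_real Re_sum) simp
      qed
      have "(\<Sum>j\<in>J. (?V2 B j) / w j) = (\<Sum>j\<in>J. \<Sum>q\<in>Z \<times> Z. A j (fst q) * A j (snd q) / w j * Re (T (fst q) (snd q)))"
        unfolding V2 by (simp add: sum_Times sum_divide_distrib mult_ac)
      also have "\<dots> = (\<Sum>q\<in>Z \<times> Z. \<Sum>j\<in>J. A j (fst q) * A j (snd q) / w j * Re (T (fst q) (snd q)))"
        by (rule sum.swap)
      also have "\<dots> = ?MT"
        by (simp add: M_def sum_Times sum_distrib_right)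
      finally show ?thesis .
    qed
    \<comment> \<open>Only diagonal terms can be estimated one by one. Off the diagonal
      \<open>Re (T z z')\<close> has no fixed sign, so these terms are kept exactly and become the
      cosine sum.\<close>
    have "?MT = (\<Sum>z\<in>Z. M z z * Re (T z z) + (\<Sum>z'\<in>Z - {z}. M z z' * Re (T z z')))"
      using fin by (intro sum.cong refl) (simp add: sum.remove)
    also have "\<dots> \<le> (\<Sum>z\<in>Z. Re (T z z) + (\<Sum>z'\<in>Z - {z}. M z z' * Re (T z z')))"
    proof (intro sum_mono add_right_mono)
      fix z assume "z \<in> Z"
      have "0 \<le> Re (T z z)" unfolding T_diag by (intro sum_nonneg) auto
      then show "M z z * Re (T z z) \<le> Re (T z z)"
        using coll[OF \<open>z \<in> Z\<close> \<open>z \<in> Z\<close>] by (simp add: M_def mult_left_le_one_le mult_right_le_one_le mult.commute[of _ "Re _"] mult_left_le)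
    qed
    also have "\<dots> \<le> 1 + (\<Sum>z\<in>Z. \<Sum>z'\<in>Z - {z}. M z z' * Re (T z z'))"
      using diag by (simp add: sum.distrib)
    also have "(\<Sum>z\<in>Z. \<Sum>z'\<in>Z - {z}. M z z' * Re (T z z')) = - 2 * ?c"
    proof -
      have "sum h K' = (\<Sum>z\<in>Z. \<Sum>z'\<in>Z - {z}. \<Sum>i\<in>I. \<Sum>i'\<in>I. h (z, z', i, i'))" for h :: "_ \<Rightarrow> real"
      proof -
        have "sum h K' = (\<Sum>z\<in>Z. \<Sum>r\<in>(SIGMA z':Z - {z}. I \<times> I). h (z, r))"
          unfolding K'_def using fin by (subst sum.Sigma) auto
        also have "\<dots> = (\<Sum>z\<in>Z. \<Sum>z'\<in>Z - {z}. \<Sum>r\<in>I \<times> I. h (z, z', r))"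
          using fin by (intro sum.cong refl) (subst sum.Sigma, auto)
        finally show ?thesis by (simp only: sum_Times)
      qed
      then show ?thesis unfolding ReT sum_distrib_left
        by (auto intro!: sum.cong simp: m_def \<mu>_def mult.commute[of t])
    qed
    finally have V_le: "(\<Sum>j\<in>J. (?V2 B j) / w j) \<le> 1 - 2 * ?c"
      unfolding V_sum by simp
    have "f (1 + \<i> * of_real t) = (\<Sum>i\<in>I. \<Sum>p\<in>B0 \<times> B0. \<Sum>z\<in>Z. \<Sum>j\<in>J. g i * e (fst p) * e (snd p) *
        (of_real (A j z) * X j (snd p) (fst p) * u i z (fst p) * cnj (u i z (snd p))))"
    proof -
      have "of_real (D i) * exp (- of_real (ln (D i)) / 2 * (1 + \<i> * of_real t)) = g i" if "i \<in> I" for i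
      proof -
        have "complex_of_real (D i) = exp (of_real (ln (D i)))" using D(1)[OF that] by (simp only: exp_of_real exp_ln)
        then have "of_real (D i) * exp (- of_real (ln (D i)) / 2 * (1 + \<i> * of_real t)) =
          exp (of_real (ln (D i)) + - of_real (ln (D i)) / 2 * (1 + \<i> * of_real t))"
          by (simp only: exp_add)
        then show ?thesis unfolding g_def
          by (simp only:) (rule arg_cong[of _ _ exp], simp add: field_simps)
      qed
      then show ?thesis unfolding f_eq
        by (simp add: sum_Times e_def \<Phi>_def sum_distrib_left mult.assoc)
    qed
    also have "\<dots> = (\<Sum>j\<in>J. \<Sum>a\<in>B0. \<Sum>b\<in>B0. e a * e b * X j b a * V j a b)"
    proof -
      define h where "h = (\<lambda>i p z j. g i * e (fst p) * e (snd p) *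
        (of_real (A j z) * X j (snd p) (fst p) * u i z (fst p) * cnj (u i z (snd p))))"
      have "(\<Sum>i\<in>I. \<Sum>p\<in>B0 \<times> B0. \<Sum>z\<in>Z. \<Sum>j\<in>J. h i p z j) = (\<Sum>q\<in>I \<times> (B0 \<times> B0) \<times> Z. \<Sum>j\<in>J. h (fst q) (fst (snd q)) (snd (snd q)) j)"
        by (simp add: sum_Times)
      also have "\<dots> = (\<Sum>j\<in>J. \<Sum>q\<in>I \<times> (B0 \<times> B0) \<times> Z. h (fst q) (fst (snd q)) (snd (snd q)) j)"
        by (rule sum.swap)
      also have "\<dots> = (\<Sum>j\<in>J. \<Sum>i\<in>I. \<Sum>p\<in>B0 \<times> B0. \<Sum>z\<in>Z. h i p z j)"
        by (simp add: sum_Times[where A = I] sum_Times[where A = "B0 \<times> B0"])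
      also have "\<dots> = (\<Sum>j\<in>J. \<Sum>p\<in>B0 \<times> B0. \<Sum>i\<in>I. \<Sum>z\<in>Z. h i p z j)"
        by (intro sum.cong refl sum.swap)
      also have "\<dots> = (\<Sum>j\<in>J. \<Sum>p\<in>B0 \<times> B0. \<Sum>z\<in>Z. \<Sum>i\<in>I. h i p z j)"
        by (intro sum.cong refl sum.swap)
      also have "\<dots> = (\<Sum>j\<in>J. \<Sum>a\<in>B0. \<Sum>b\<in>B0. e a * e b * X j b a * V j a b)"
        unfolding sum_Times
        by (intro sum.cong refl) (simp add: h_def V_def Y_def sum_distrib_left mult_ac)
      finally show ?thesis unfolding h_def .
    qed
    finally have "cmod (f (1 + \<i> * of_real t)) \<le> (\<Sum>j\<in>J. \<Sum>a\<in>B0. \<Sum>b\<in>B0. cmod (e a * e b * X j b a * V j a b))"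
      by (simp add: sum_norm_le)
    \<comment> \<open>The arithmetic-geometric inequality with weight \<open>w j\<close> and scale
      \<open>sqrt L\<close>. The outcome is linear in the squared entries of \<open>V j\<close>, and
      therefore affine in the cosines.\<close>
    also have "\<dots> \<le> (\<Sum>j\<in>J. \<Sum>a\<in>B0. \<Sum>b\<in>B0. (w j * (sqrt (s a * s b) * (cmod (X j b a))\<^sup>2) / L + (cmod (V j a b))\<^sup>2 / w j) * (sqrt L / 2))"
    proof (intro sum_mono)
      fix j a b assume j: "j \<in> J" and ab: "a \<in> B0" "b \<in> B0"
      define r P Q where "r = sqrt L" and "P = cmod (e a * e b * X j b a)" and "Q = cmod (V j a b)"
      have r: "0 < r" "L = r * r" using L by (simp_all add: r_def)
      have e2: "(cmod (e a))\<^sup>2 = sqrt (s a)" if "a \<in> B0" for a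
      proof -
        have "(cmod (e a))\<^sup>2 = exp (ln (s a) / 4) * exp (ln (s a) / 4)" by (simp add: e_def power2_eq_square)
        also have "\<dots> = exp (1 / 2 * ln (s a))" by (simp flip: exp_add)
        also have "\<dots> = s a powr (1 / 2)" using s[OF that] by (simp add: powr_def)
        also have "\<dots> = sqrt (s a)" using s[OF that] by (simp add: powr_half_sqrt)
        finally show ?thesis .
      qed
      have P2: "P\<^sup>2 = sqrt (s a * s b) * (cmod (X j b a))\<^sup>2"
        by (simp add: P_def norm_mult power_mult_distrib e2 ab real_sqrt_mult)
      have "0 \<le> (w j * P / r - Q)\<^sup>2 / w j" using w[OF j] by simp
      also have "\<dots> = w j * P\<^sup>2 / L + Q\<^sup>2 / w j - 2 * P * Q / r"
        using w[OF j] r by (simp add: power2_eq_square field_simps)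
      finally have "2 * P * Q / r \<le> w j * P\<^sup>2 / L + Q\<^sup>2 / w j" by simp
      then have "P * Q \<le> (w j * P\<^sup>2 / L + Q\<^sup>2 / w j) * (r / 2)"
        using r(1) by (simp add: field_simps)
      then show "cmod (e a * e b * X j b a * V j a b) \<le>
          (w j * (sqrt (s a * s b) * (cmod (X j b a))\<^sup>2) / L + (cmod (V j a b))\<^sup>2 / w j) * (sqrt L / 2)"
        unfolding P2 by (simp add: P_def Q_def r_def norm_mult)
    qed
    also have "\<dots> = ((\<Sum>j\<in>J. w j * (\<Sum>a\<in>B0. \<Sum>b\<in>B0. sqrt (s a * s b) * (cmod (X j b a))\<^sup>2)) / L +
        (\<Sum>j\<in>J. (?V2 B0 j) / w j)) * (sqrt L / 2)"
      unfolding sum_distrib_left sum_divide_distrib sum.distrib[symmetric] sum_distrib_right by simp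
    also have "\<dots> \<le> (1 + (1 - 2 * ?c)) * (sqrt L / 2)"
    proof (intro mult_right_mono add_mono)
      have "(\<Sum>j\<in>J. (?V2 B0 j) / w j) \<le> (\<Sum>j\<in>J. (?V2 B j) / w j)"
      proof (intro sum_mono divide_right_mono)
        fix j assume "j \<in> J"
        show "0 \<le> w j" using w[OF \<open>j \<in> J\<close>] by simp
        have "(?V2 B0 j) \<le> (\<Sum>a\<in>B0. \<Sum>b\<in>B. (cmod (V j a b))\<^sup>2)"
          by (intro sum_mono sum_mono2) (use fin B0 in auto)
        also have "\<dots> \<le> (?V2 B j)"
          by (intro sum_mono2) (use fin B0 in \<open>auto intro: sum_nonneg\<close>)
        finally show "(?V2 B0 j) \<le> (?V2 B j)" .
      qed
      then show "(\<Sum>j\<in>J. (?V2 B0 j) / w j) \<le> 1 - 2 * ?c"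
        using V_le by linarith
    qed (use L in auto)
    finally show "cmod (\<Sum>k\<in>I \<times> B0 \<times> B0. c k * exp (of_real (\<beta> k) * (1 + \<i> * of_real t))) \<le> sqrt L * (1 - ?c)"
      by (simp add: f_def algebra_simps)
  qed (use L \<theta> in auto)
  moreover have "f (of_real \<theta>) = (\<Sum>i\<in>I. \<Sum>a\<in>B0. \<Sum>b\<in>B0. of_real (D i powr (1 - \<theta> / 2) * s a powr (\<theta> / 4) * s b powr (\<theta> / 4)) * \<Phi> i a b)"
    unfolding f_eq
  proof (intro sum.cong refl arg_cong2[of _ _ _ _ "(*)"])
    fix i a b assume "i \<in> I" "a \<in> B0" "b \<in> B0"
    have pos: "0 < D i" "0 < s a" "0 < s b" using D(1) s \<open>i \<in> I\<close> \<open>a \<in> B0\<close> \<open>b \<in> B0\<close> by auto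
    have "D i * exp (- ln (D i) / 2 * \<theta>) = D i powr (1 - \<theta> / 2)"
    proof -
      have "D i * exp (- ln (D i) / 2 * \<theta>) = exp (ln (D i)) * exp (- ln (D i) / 2 * \<theta>)" using pos by simp
      also have "\<dots> = exp ((1 - \<theta> / 2) * ln (D i))" unfolding exp_add[symmetric] by (simp add: field_simps)
      finally show ?thesis using pos by (simp add: powr_def)
    qed
    moreover have "exp (ln (s a) / 4 * \<theta>) = s a powr (\<theta> / 4)" "exp (ln (s b) / 4 * \<theta>) = s b powr (\<theta> / 4)"
      using pos by (simp_all add: powr_def mult.commute)
    ultimately have "complex_of_real (D i powr (1 - \<theta> / 2) * s a powr (\<theta> / 4) * s b powr (\<theta> / 4)) =
      of_real (D i * exp (- ln (D i) / 2 * \<theta>) * exp (ln (s a) / 4 * \<theta>) * exp (ln (s b) / 4 * \<theta>))" by simp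
    then show "of_real (D i) * exp (- of_real (ln (D i)) / 2 * of_real \<theta>) *
      exp (of_real (ln (s a)) / 4 * of_real \<theta>) * exp (of_real (ln (s b)) / 4 * of_real \<theta>) =
      complex_of_real (D i powr (1 - \<theta> / 2) * s a powr (\<theta> / 4) * s b powr (\<theta> / 4))"
      by (simp flip: exp_of_real)
  qed
  ultimately show ?thesis by (simp add: \<Phi>_def)
qed

subsection \<open>Quadratic forms, trace monotonicity and trace norm duality\<close>

definition quad_form :: "'i set \<Rightarrow> 'i op \<Rightarrow> 'i vec \<Rightarrow> complex" where
  "quad_form I M v = (\<Sum>i\<in>I. \<Sum>j\<in>I. cnj (v i) * M i j * v j)"

lemma quad_form_conj:
  fixes S :: "'a op"
  assumes S: "\<And>i j. i \<in> I \<Longrightarrow> j \<in> I \<Longrightarrow> S j i = cnj (S i j)"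
  shows "quad_form I (op_mult I S (op_mult I M S)) v = quad_form I M (op_apply I S v)"
proof -
  let ?g = "\<lambda>p q. cnj (v (fst p)) * S (fst p) (fst q) * M (fst q) (snd q) * S (snd q) (snd p) * v (snd p)"
  have "quad_form I (op_mult I S (op_mult I M S)) v =
    (\<Sum>p\<in>I \<times> I. \<Sum>q\<in>I \<times> I. ?g p q)"
    unfolding quad_form_def op_mult_def sum_Times by (simp add: sum_distribs mult_ac)
  also have "\<dots> = (\<Sum>q\<in>I \<times> I. \<Sum>p\<in>I \<times> I. ?g p q)"
    by (rule sum.swap)
  also have "\<dots> = (\<Sum>k\<in>I. \<Sum>l\<in>I. \<Sum>i\<in>I. \<Sum>j\<in>I. cnj (S k i * v i) * M k l * (S l j * v j))"
    unfolding sum_Times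
  proof (intro sum.cong refl)
    fix k l i j assume "k \<in> I" "l \<in> I" "i \<in> I" "j \<in> I"
    from S[OF \<open>k \<in> I\<close> \<open>i \<in> I\<close>]
    show "cnj (v (fst (i, j))) * S (fst (i, j)) (fst (k, l)) * M (fst (k, l)) (snd (k, l)) * S (snd (k, l)) (snd (i, j)) * v (snd (i, j))
       = cnj (S k i * v i) * M k l * (S l j * v j)" by simp
  qed
  also have "\<dots> = quad_form I M (op_apply I S v)"
  proof -
    have "(\<Sum>i\<in>I. \<Sum>j\<in>I. f i * m * h j) = (\<Sum>i\<in>I. f i) * m * (\<Sum>j\<in>I. h j)" for f h :: "'a \<Rightarrow> complex" and m
    proof -
      have "(\<Sum>i\<in>I. f i) * m * (\<Sum>j\<in>I. h j) = (\<Sum>i\<in>I. f i * m) * (\<Sum>j\<in>I. h j)" by (simp only: sum_distrib_right)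
      then show ?thesis by (simp only: sum_product)
    qed
    then show ?thesis unfolding quad_form_def op_apply_def cnj_sum by simp
  qed
  finally show ?thesis .
qed

lemma op_psd_iff: "op_psd I M \<longleftrightarrow> (\<forall>v. quad_form I M v \<in> \<real>\<^sub>\<ge>\<^sub>0)"
  unfolding op_psd_def vec_inner_def op_apply_def quad_form_def by (simp add: sum_distrib_left mult.assoc)

lemma quad_form_nonneg: "op_psd I M \<Longrightarrow> 0 \<le> Re (quad_form I M v)"
  unfolding op_psd_iff complex_nonneg_Reals_iff by blast

lemma op_psd_conj:
  assumes "op_psd I M" "\<And>i j. i \<in> I \<Longrightarrow> j \<in> I \<Longrightarrow> S j i = cnj (S i j)"
  shows "op_psd I (op_mult I S (op_mult I M S))"
  using assms(1) unfolding op_psd_iff by (subst quad_form_conj) (use assms(2) in blast)+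

lemma unitary_expand:
  assumes "finite I" and rows: "\<And>i i'. i \<in> I \<Longrightarrow> i' \<in> I \<Longrightarrow> (\<Sum>j\<in>J. W i j * cnj (W i' j)) = (if i = i' then 1 else 0)"
    and "i \<in> I"
  shows "(\<Sum>j\<in>J. W i j * (\<Sum>k\<in>I. cnj (W k j) * h k)) = (h i :: complex)"
proof -
  have "(\<Sum>j\<in>J. W i j * (\<Sum>k\<in>I. cnj (W k j) * h k)) = (\<Sum>k\<in>I. (\<Sum>j\<in>J. W i j * cnj (W k j)) * h k)"
    unfolding sum_distribs by (subst sum.swap) (simp add: mult.assoc)
  then show ?thesis using assms by (simp add: if_mult_left cong: if_cong)
qed

lemma unitary_inner:
  assumes "finite I" and rows: "\<And>i i'. i \<in> I \<Longrightarrow> i' \<in> I \<Longrightarrow> (\<Sum>j\<in>J. W i j * cnj (W i' j)) = (if i = i' then 1 else 0)"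
  shows "(\<Sum>j\<in>J. cnj (\<Sum>k\<in>I. cnj (W k j) * g k) * (\<Sum>k\<in>I. cnj (W k j) * h k)) = (\<Sum>i\<in>I. cnj (g i) * (h i :: complex))"
proof -
  have "(\<Sum>j\<in>J. cnj (\<Sum>k\<in>I. cnj (W k j) * g k) * (\<Sum>k\<in>I. cnj (W k j) * h k)) =
     (\<Sum>j\<in>J. \<Sum>i\<in>I. cnj (g i) * (W i j * (\<Sum>k\<in>I. cnj (W k j) * h k)))"
  proof -
    have "(\<Sum>j\<in>J. cnj (\<Sum>k\<in>I. cnj (W k j) * g k) * H j) = (\<Sum>j\<in>J. \<Sum>i\<in>I. cnj (g i) * (W i j * H j))" for H
      by (simp add: cnj_sum sum_distribs mult_ac)
    then show ?thesis .
  qed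
  also have "\<dots> = (\<Sum>i\<in>I. cnj (g i) * (\<Sum>j\<in>J. W i j * (\<Sum>k\<in>I. cnj (W k j) * h k)))"
    unfolding sum_distrib_left by (rule sum.swap)
  also have "\<dots> = (\<Sum>i\<in>I. cnj (g i) * h i)"
    by (intro sum.cong refl arg_cong2[of _ _ _ _ "(*)"] unitary_expand[OF assms(1)]) (use rows in auto)
  finally show ?thesis .
qed

lemma unitary_norm:
  assumes "finite I" and rows: "\<And>i i'. i \<in> I \<Longrightarrow> i' \<in> I \<Longrightarrow> (\<Sum>j\<in>J. W i j * cnj (W i' j)) = (if i = i' then 1 else 0)"
  shows "(\<Sum>j\<in>J. (cmod (\<Sum>k\<in>I. cnj (W k j) * g k))\<^sup>2) = sqnorm I g"
proof -
  have "complex_of_real (\<Sum>j\<in>J. (cmod (\<Sum>k\<in>I. cnj (W k j) * g k))\<^sup>2) = complex_of_real (sqnorm I g)"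
    unfolding of_real_sum_cmod_square by (rule unitary_inner[OF assms])
  then show ?thesis by (simp only: of_real_eq_iff)
qed

text \<open>Meant for orthonormal families that need not be complete, such as the singular vectors
  with positive singular value. The proof expands the squared distance to the projection
  \<open>y\<close>.\<close>

lemma bessel_inequality:
  fixes W :: "'i \<Rightarrow> 'j \<Rightarrow> complex"
  assumes "finite I" "finite J"
    and orth: "\<And>j j'. j \<in> J \<Longrightarrow> j' \<in> J \<Longrightarrow> (\<Sum>i\<in>I. cnj (W i j) * W i j') = (if j = j' then 1 else 0)"
  shows "(\<Sum>j\<in>J. (cmod (\<Sum>i\<in>I. cnj (W i j) * x i))\<^sup>2) \<le> sqnorm I x"
proof -
  define a where "a = (\<lambda>j. \<Sum>i\<in>I. cnj (W i j) * x i)"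
  define y where "y = (\<lambda>i. \<Sum>j\<in>J. W i j * a j)"
  have yy: "(\<Sum>i\<in>I. cnj (y i) * y i) = (\<Sum>j\<in>J. cnj (a j) * a j)"
    using unitary_inner[where I = J and J = I and W = "\<lambda>j i. cnj (W i j)" and g = a and h = a] orth assms by (simp add: y_def)
  have xy: "(\<Sum>i\<in>I. cnj (y i) * x i) = (\<Sum>j\<in>J. cnj (a j) * a j)"
  proof -
    have "(\<Sum>i\<in>I. cnj (y i) * x i) = (\<Sum>i\<in>I. \<Sum>j\<in>J. cnj (a j) * (cnj (W i j) * x i))"
      by (simp add: y_def cnj_sum sum_distribs mult_ac)
    also have "\<dots> = (\<Sum>j\<in>J. cnj (a j) * a j)"
      unfolding a_def sum_distrib_left by (rule sum.swap)
    finally show ?thesis .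
  qed
  have "0 \<le> (\<Sum>i\<in>I. (cmod (x i - y i))\<^sup>2)" by (intro sum_nonneg) auto
  also have "\<dots> = (sqnorm I x) - 2 * Re (\<Sum>i\<in>I. cnj (y i) * x i) + Re (\<Sum>i\<in>I. cnj (y i) * y i)"
  proof -
    have "(cmod (x i - y i))\<^sup>2 = (cmod (x i))\<^sup>2 - 2 * Re (cnj (y i) * x i) + Re (cnj (y i) * y i)" for i
      unfolding cmod_power2 by (simp add: power2_eq_square algebra_simps)
    then show ?thesis by (simp only: sum.distrib sum_subtractf sum_distrib_left Re_sum)
  qed
  also have "\<dots> = (sqnorm I x) - Re (\<Sum>j\<in>J. cnj (a j) * a j)"
    unfolding yy xy by simp
  also have "(\<Sum>j\<in>J. cnj (a j) * a j) = complex_of_real (sqnorm J a)"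
    by (rule of_real_sum_cmod_square[symmetric])
  finally show ?thesis by (simp add: a_def)
qed

lemma trace_op_powr:
  assumes "finite I"
    and spec: "spectral_data I M U d"
  shows "Re (op_trace I (op_powr I M p)) = (\<Sum>j\<in>I. d j powr p)"
proof -
  have "op_trace I (op_powr I M p) = (\<Sum>i\<in>I. \<Sum>j\<in>I. of_real (d j powr p) * (cnj (U i j) * U i j))"
    by (simp add: op_trace_def op_powr_def spectralD(5)[OF spec] mult_ac)
  also have "\<dots> = (\<Sum>j\<in>I. of_real (d j powr p) * (\<Sum>i\<in>I. cnj (U i j) * U i j))"
    unfolding sum_distrib_left by (rule sum.swap)
  also have "\<dots> = of_real (\<Sum>j\<in>I. d j powr p)" by (simp add: spectralD(1)[OF spec])
  finally show ?thesis by simp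
qed

lemma quad_form_spectral:
  assumes "spectral_data I M V e"
  shows "quad_form I M v = of_real (\<Sum>j\<in>I. e j * (cmod (\<Sum>i\<in>I. cnj (V i j) * v i))\<^sup>2)"
proof -
  let ?g = "\<lambda>i i' j. of_real (e j) * (cnj (cnj (V i j) * v i) * (cnj (V i' j) * v i'))"
  have "quad_form I M v = (\<Sum>i\<in>I. \<Sum>i'\<in>I. \<Sum>j\<in>I. ?g i i' j)"
    unfolding quad_form_def by (intro sum.cong refl) (simp add: spectralD(4)[OF assms] sum_distribs mult_ac)
  also have "\<dots> = (\<Sum>i\<in>I. \<Sum>j\<in>I. \<Sum>i'\<in>I. ?g i i' j)"
    by (intro sum.cong refl sum.swap)
  also have "\<dots> = (\<Sum>j\<in>I. \<Sum>i\<in>I. \<Sum>i'\<in>I. ?g i i' j)"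
    by (rule sum.swap)
  also have "\<dots> = (\<Sum>j\<in>I. of_real (e j) * (cnj (\<Sum>i\<in>I. cnj (V i j) * v i) * (\<Sum>i\<in>I. cnj (V i j) * v i)))"
    unfolding cnj_sum sum_product unfolding sum_distrib_left ..
  also have "\<dots> = of_real (\<Sum>j\<in>I. e j * (cmod (\<Sum>i\<in>I. cnj (V i j) * v i))\<^sup>2)"
    by (simp only: of_real_sum of_real_mult complex_norm_square mult.commute)
  finally show ?thesis .
qed

lemma powr_Young:
  fixes x y p :: real
  assumes "0 \<le> x" "0 \<le> y" "1 < p"
  shows "x powr (p - 1) * y \<le> (p - 1) / p * x powr p + y powr p / p"
proof -
  have "x powr (p - 1) * y \<le> (x powr (p - 1)) powr (p / (p - 1)) / (p / (p - 1)) + y powr p / p"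
    using assms by (intro Youngs_inequality) (auto simp: field_simps)
  moreover have "(p - 1) * (p / (p - 1)) = p" using assms by simp
  ultimately show ?thesis using assms by (simp only: powr_powr) (simp add: field_simps)
qed

text \<open>
  Expanding in both eigenbases, the overlaps \<open>|<v j, u k>|^2\<close> are doubly stochastic, and Young's
  inequality is applied to each term.
\<close>

lemma trace_powr_mono:
  assumes fin: "finite I" and psd: "op_psd I X" "op_psd I Y" and p: "1 < p" and c: "0 \<le> c"
    and le: "\<And>v. Re (quad_form I X v) \<le> c * Re (quad_form I Y v)"
  shows "Re (op_trace I (op_powr I X p)) \<le> c powr p * Re (op_trace I (op_powr I Y p))"
proof -
  obtain U d where U': "spectral_data I X U d" using psd_spectral[OF fin psd(1)] by blast
  note U = spectralD[OF U']
  obtain V e where V': "spectral_data I Y V e" using psd_spectral[OF fin psd(2)] by blast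
  note V = spectralD[OF V']
  define P where "P = (\<lambda>k j. (cmod (\<Sum>i\<in>I. cnj (V i j) * U i k))\<^sup>2)"
  have norm1: "sqnorm I f = 1" if "(\<Sum>i\<in>I. cnj (f i) * f i) = 1" for f
    using that unfolding of_real_sum_cmod_square[symmetric] by (simp only: of_real_eq_1_iff)
  have P_row: "(\<Sum>j\<in>I. P k j) = 1" if "k \<in> I" for k
    unfolding P_def using unitary_norm[OF fin V(2), of "\<lambda>i. U i k"] norm1[of "\<lambda>i. U i k"] U(1) that by simp
  have P_col: "(\<Sum>k\<in>I. P k j) = 1" if "j \<in> I" for j
  proof -
    have "P k j = (cmod (\<Sum>i\<in>I. cnj (U i k) * V i j))\<^sup>2" for k
      unfolding P_def complex_mod_cnj[of "\<Sum>i\<in>I. cnj (V i j) * U i k", symmetric] by (simp add: cnj_sum mult.commute)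
    then show ?thesis
      using unitary_norm[OF fin U(2), of "\<lambda>i. V i j"] norm1[of "\<lambda>i. V i j"] V(1) that by simp
  qed
  have d_le: "d k \<le> c * (\<Sum>j\<in>I. e j * P k j)" if k: "k \<in> I" for k
  proof -
    have "quad_form I X (\<lambda>i. U i k) = of_real (\<Sum>j\<in>I. d j * (if j = k then 1 else 0))"
      unfolding quad_form_spectral[OF U'] using U(1) k by (intro arg_cong[of _ _ of_real] sum.cong refl) simp
    then have "Re (quad_form I X (\<lambda>i. U i k)) = (\<Sum>j\<in>I. d j * (if j = k then 1 else 0))"
      by (simp only: Re_complex_of_real)
    then have "Re (quad_form I X (\<lambda>i. U i k)) = d k"
      using fin k by (simp add: if_mult_right cong: if_cong)
    moreover have "Re (quad_form I Y (\<lambda>i. U i k)) = (\<Sum>j\<in>I. e j * P k j)"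
      unfolding quad_form_spectral[OF V'] P_def by simp
    ultimately show ?thesis using le[of "\<lambda>i. U i k"] by simp
  qed
  have "(\<Sum>k\<in>I. d k powr p) \<le> (\<Sum>k\<in>I. \<Sum>j\<in>I. P k j * ((p - 1) / p * d k powr p + (c * e j) powr p / p))"
  proof (rule sum_mono)
    fix k assume k: "k \<in> I"
    have "d k powr p = d k powr (p - 1) * d k"
      using U(3)[OF k] by (cases "d k = 0") (auto simp: powr_diff)
    also have "\<dots> \<le> d k powr (p - 1) * (c * (\<Sum>j\<in>I. e j * P k j))"
      using d_le[OF k] by (intro mult_left_mono) auto
    also have "\<dots> = (\<Sum>j\<in>I. P k j * (d k powr (p - 1) * (c * e j)))"
      by (simp add: sum_distrib_left mult_ac)
    also have "\<dots> \<le> (\<Sum>j\<in>I. P k j * ((p - 1) / p * d k powr p + (c * e j) powr p / p))"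
      using U(3)[OF k] V(3) c p by (intro sum_mono mult_left_mono powr_Young) (auto simp: P_def)
    finally show "d k powr p \<le> \<dots>" .
  qed
  also have "\<dots> = (p - 1) / p * (\<Sum>k\<in>I. d k powr p * (\<Sum>j\<in>I. P k j)) + (\<Sum>k\<in>I. \<Sum>j\<in>I. (c * e j) powr p / p * P k j)"
    unfolding sum_distrib_left sum.distrib[symmetric] by (intro sum.cong refl) (simp add: algebra_simps)
  also have "(\<Sum>k\<in>I. \<Sum>j\<in>I. (c * e j) powr p / p * P k j) = (\<Sum>j\<in>I. (c * e j) powr p / p * (\<Sum>k\<in>I. P k j))"
    unfolding sum_distrib_left by (rule sum.swap)
  finally have "(\<Sum>k\<in>I. d k powr p) \<le> (p - 1) / p * (\<Sum>k\<in>I. d k powr p) + (\<Sum>j\<in>I. (c * e j) powr p) / p"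
    by (simp add: P_row P_col sum_divide_distrib)
  then have "(\<Sum>k\<in>I. d k powr p) \<le> (\<Sum>j\<in>I. (c * e j) powr p)"
    using p by (simp add: field_simps)
  also have "\<dots> = c powr p * (\<Sum>j\<in>I. e j powr p)"
    using c V(3) by (simp add: powr_mult sum_distrib_left)
  finally show ?thesis
    unfolding trace_op_powr[OF fin U'] trace_op_powr[OF fin V'] by simp
qed

text \<open>The optimal \<open>X\<close> is the adjoint of the partial isometry in the polar
  decomposition of \<open>M\<close>: it sends each normalised image \<open>n k\<close> back to the
  right singular vector. Contractivity is expressed through a mean of squared norms, an inequality
  that adds up over blocks.\<close>

lemma trace_norm_dual:
  assumes fin: "finite I"
  shows "\<exists>X. (\<forall>x y. cmod (\<Sum>i\<in>I. \<Sum>j\<in>I. cnj (y i) * X i j * x j) \<le>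
      (sqnorm I x + sqnorm I y) / 2) \<and>
    trace_norm I M = Re (\<Sum>i\<in>I. \<Sum>j\<in>I. X i j * M j i)"
proof -
  let ?A = "op_mult I (op_adj M) M"
  have form: "quad_form I (?A) v = of_real (\<Sum>k\<in>I. (cmod (\<Sum>i\<in>I. M k i * v i))\<^sup>2)" for v
  proof -
    have "quad_form I (?A) v = (\<Sum>p\<in>I \<times> I. \<Sum>k\<in>I. cnj (M k (fst p) * v (fst p)) * (M k (snd p) * v (snd p)))"
      unfolding quad_form_def op_mult_def op_adj_def sum_Times
      by (simp add: sum_distribs mult_ac)
    also have "\<dots> = (\<Sum>k\<in>I. \<Sum>p\<in>I \<times> I. cnj (M k (fst p) * v (fst p)) * (M k (snd p) * v (snd p)))"
      by (rule sum.swap)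
    also have "\<dots> = (\<Sum>k\<in>I. cnj (\<Sum>i\<in>I. M k i * v i) * (\<Sum>i\<in>I. M k i * v i))"
      unfolding cnj_sum sum_product sum_Times by simp
    finally show ?thesis by (simp only: of_real_sum_cmod_square)
  qed
  have psd: "op_psd I (?A)"
    unfolding op_psd_iff form nonneg_Reals_of_real_iff by (simp add: sum_nonneg)
  obtain U d where U': "spectral_data I (?A) U d" using psd_spectral[OF fin psd] by blast
  note U = spectralD[OF U']
  define m where "m = (\<lambda>i k. \<Sum>j\<in>I. M i j * U j k)"
  have mm: "(\<Sum>i\<in>I. cnj (m i k) * m i k') = (if k = k' then of_real (d k) else 0)" if k: "k \<in> I" "k' \<in> I" for k k'
  proof -
    have "(\<Sum>i\<in>I. cnj (m i k) * m i k') = (\<Sum>i\<in>I. \<Sum>p\<in>I \<times> I. cnj (U (fst p) k) * (cnj (M i (fst p)) * M i (snd p)) * U (snd p) k')"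
      unfolding m_def cnj_sum sum_product sum_Times by (simp add: mult_ac)
    also have "\<dots> = (\<Sum>p\<in>I \<times> I. \<Sum>i\<in>I. cnj (U (fst p) k) * (cnj (M i (fst p)) * M i (snd p)) * U (snd p) k')"
      by (rule sum.swap)
    also have "\<dots> = (\<Sum>a\<in>I. \<Sum>b\<in>I. cnj (U a k) * ?A a b * U b k')"
      unfolding op_mult_def op_adj_def sum_Times by (simp add: sum_distribs)
    also have "\<dots> = (\<Sum>p\<in>I \<times> I. \<Sum>j\<in>I. of_real (d j) * (cnj (U (fst p) k) * U (fst p) j) * (cnj (U (snd p) j) * U (snd p) k'))"
      unfolding sum_Times by (intro sum.cong refl) (simp add: U(4) sum_distribs mult_ac)
    also have "\<dots> = (\<Sum>j\<in>I. \<Sum>p\<in>I \<times> I. of_real (d j) * (cnj (U (fst p) k) * U (fst p) j) * (cnj (U (snd p) j) * U (snd p) k'))"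
      by (rule sum.swap)
    also have "\<dots> = (\<Sum>j\<in>I. of_real (d j) * ((\<Sum>a\<in>I. cnj (U a k) * U a j) * (\<Sum>b\<in>I. cnj (U b j) * U b k')))"
      unfolding sum_Times sum_product unfolding sum_distrib_left by (simp add: mult.assoc)
    also have "\<dots> = (\<Sum>j\<in>I. if j = k then (if k = k' then of_real (d k) else 0) else 0)"
      using k by (intro sum.cong refl) (simp add: U(1))
    also have "\<dots> = (if k = k' then of_real (d k) else 0)" using fin k by simp
    finally show ?thesis .
  qed
  \<comment> \<open>Singular vectors with value 0 add nothing to the trace norm, and their images
    cannot be normalised.\<close>
  define K where "K = {k\<in>I. 0 < d k}"
  have K: "finite K" "K \<subseteq> I" using fin by (auto simp: K_def)
  define n where "n = (\<lambda>i k. m i k / of_real (sqrt (d k)))"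
  have nn: "(\<Sum>i\<in>I. cnj (n i k) * n i k') = (if k = k' then 1 else 0)" if k: "k \<in> K" "k' \<in> K" for k k'
  proof -
    have "(\<Sum>i\<in>I. cnj (n i k) * n i k') = (\<Sum>i\<in>I. cnj (m i k) * m i k') / of_real (sqrt (d k) * sqrt (d k'))"
      by (simp add: n_def sum_divide_distrib)
    also have "\<dots> = (if k = k' then 1 else 0)"
      using k K by (subst mm) (auto simp: K_def real_sqrt_mult_self simp flip: of_real_mult)
    finally show ?thesis .
  qed
  define X where "X = (\<lambda>i j. \<Sum>k\<in>K. U i k * cnj (n j k))"
  have "cmod (\<Sum>i\<in>I. \<Sum>j\<in>I. cnj (y i) * X i j * x j) \<le> (sqnorm I x + sqnorm I y) / 2" for x y
  proof -
    let ?g = "\<lambda>p k. cnj (cnj (U (fst p) k) * y (fst p)) * (cnj (n (snd p) k) * x (snd p))"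
    let ?n = "\<lambda>k. \<Sum>i\<in>I. cnj (n i k) * x i"
    let ?u = "\<lambda>k. \<Sum>i\<in>I. cnj (U i k) * y i"
    have "(\<Sum>i\<in>I. \<Sum>j\<in>I. cnj (y i) * X i j * x j) = (\<Sum>p\<in>I \<times> I. \<Sum>k\<in>K. ?g p k)"
      unfolding sum_Times by (simp add: X_def sum_distribs mult_ac)
    also have "\<dots> = (\<Sum>k\<in>K. \<Sum>p\<in>I \<times> I. ?g p k)"
      by (rule sum.swap)
    also have "\<dots> = (\<Sum>k\<in>K. cnj (?u k) * (?n k))"
      unfolding sum_Times cnj_sum sum_product by simp
    also have "cmod \<dots> \<le> (\<Sum>k\<in>K. ((cmod (?n k))\<^sup>2 + (cmod (?u k))\<^sup>2) / 2)"
    proof (rule sum_norm_le)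
      fix k
      define r q where "r = cmod (?u k)" and "q = cmod (?n k)"
      have "r * q \<le> (q\<^sup>2 + r\<^sup>2) / 2" using sum_squares_bound[of r q] by simp
      then show "cmod (cnj (?u k) * (?n k)) \<le>
        ((cmod (?n k))\<^sup>2 + (cmod (?u k))\<^sup>2) / 2"
        unfolding norm_mult complex_mod_cnj r_def q_def .
    qed
    also have "\<dots> = ((\<Sum>k\<in>K. (cmod (?n k))\<^sup>2) + (\<Sum>k\<in>K. (cmod (?u k))\<^sup>2)) / 2"
      by (simp add: sum.distrib sum_divide_distrib add_divide_distrib)
    also have "\<dots> \<le> (sqnorm I x + sqnorm I y) / 2"
      by (intro divide_right_mono add_mono bessel_inequality[OF fin K(1)] nn U(1)) (use K in auto)
    finally show ?thesis .
  qed
  moreover have "trace_norm I M = Re (\<Sum>i\<in>I. \<Sum>j\<in>I. X i j * M j i)"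
  proof -
    have "(\<Sum>i\<in>I. \<Sum>j\<in>I. X i j * M j i) = (\<Sum>p\<in>I \<times> I. \<Sum>k\<in>K. cnj (n (snd p) k) * (M (snd p) (fst p) * U (fst p) k))"
      unfolding sum_Times by (simp add: X_def sum_distribs mult_ac)
    also have "\<dots> = (\<Sum>k\<in>K. \<Sum>p\<in>I \<times> I. cnj (n (snd p) k) * (M (snd p) (fst p) * U (fst p) k))"
      by (rule sum.swap)
    also have "\<dots> = (\<Sum>k\<in>K. \<Sum>j\<in>I. \<Sum>i\<in>I. cnj (n j k) * (M j i * U i k))"
      unfolding sum_Times by (rule sum.cong[OF refl]) (subst sum.swap, simp)
    also have "\<dots> = (\<Sum>k\<in>K. (\<Sum>j\<in>I. cnj (m j k) * m j k) / of_real (sqrt (d k)))"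
    proof (rule sum.cong[OF refl])
      fix k
      have eq: "(\<Sum>i\<in>I. a * (M j i * U i k)) = a * m j k" for a j by (simp add: m_def sum_distrib_left)
      show "(\<Sum>j\<in>I. \<Sum>i\<in>I. cnj (n j k) * (M j i * U i k)) = (\<Sum>j\<in>I. cnj (m j k) * m j k) / of_real (sqrt (d k))"
        unfolding eq by (simp add: n_def sum_divide_distrib)
    qed
    also have "\<dots> = (\<Sum>k\<in>K. of_real (sqrt (d k)))"
    proof (intro sum.cong refl)
      fix k assume "k \<in> K"
      then have "0 < d k" "k \<in> I" by (auto simp: K_def)
      moreover from this have "of_real (d k) / of_real (sqrt (d k)) = complex_of_real (sqrt (d k))"
        by (metis of_real_divide real_div_sqrt less_imp_le)
      ultimately show "(\<Sum>j\<in>I. cnj (m j k) * m j k) / of_real (sqrt (d k)) = complex_of_real (sqrt (d k))"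
        by (simp add: mm)
    qed
    finally have "Re (\<Sum>i\<in>I. \<Sum>j\<in>I. X i j * M j i) = (\<Sum>k\<in>K. sqrt (d k))" by simp
    also have "\<dots> = (\<Sum>k\<in>I. d k powr (1/2))"
      using fin U(3) by (intro sum.mono_neutral_cong_left) (auto simp: K_def powr_half_sqrt not_less antisym)
    also have "\<dots> = trace_norm I M"
      unfolding trace_norm_def using trace_op_powr[OF fin U'] by simp
    finally show ?thesis by simp
  qed
  ultimately show ?thesis by blast
qed

subsection \<open>Sandwiched operators\<close>

definition sandwich :: "real \<Rightarrow> 'a set \<Rightarrow> 'b set \<Rightarrow> ('a \<times> 'b) op \<Rightarrow> 'b op \<Rightarrow> ('a \<times> 'b) op" where
  "sandwich r A B \<rho> \<sigma> = op_mult (A \<times> B) (op_tensor op_id (op_powr B \<sigma> r))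
     (op_mult (A \<times> B) \<rho> (op_tensor op_id (op_powr B \<sigma> r)))"

abbreviation supported_by :: "'a set \<Rightarrow> 'b set \<Rightarrow> ('a \<times> 'b) op \<Rightarrow> 'b op \<Rightarrow> bool" where
  "supported_by A B \<rho> \<sigma> \<equiv> op_supp (A \<times> B) \<rho> \<subseteq> op_supp (A \<times> B) (op_tensor op_id \<sigma>)"

lemma sandwiched_renyi_rel_eq:
  "sandwiched_renyi_rel \<alpha> A B \<rho> \<sigma> =
     (if supported_by A B \<rho> \<sigma>
      then ereal (1 / (1 - \<alpha>) * log 2 (Re (op_trace (A \<times> B)
         (op_powr (A \<times> B) (sandwich ((1 - \<alpha>) / (2 * \<alpha>)) A B \<rho> \<sigma>) \<alpha>))))
      else - \<infinity>)"
  by (simp add: sandwiched_renyi_rel_def sandwich_def Let_def)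

lemma sum_mid_product:
  "(\<Sum>i\<in>I. f i) * m * (\<Sum>j\<in>J. h j) = (\<Sum>i\<in>I. \<Sum>j\<in>J. f i * m * (h j :: 'a :: semiring_0))"
proof -
  have "(\<Sum>i\<in>I. f i) * m * (\<Sum>j\<in>J. h j) = (\<Sum>i\<in>I. f i * m) * (\<Sum>j\<in>J. h j)" by (simp only: sum_distrib_right)
  then show ?thesis by (simp only: sum_product)
qed

lemma op_mult_tensor_id_left:
  assumes "finite A" "z \<in> A"
  shows "op_mult (A \<times> B) (op_tensor op_id R) M (z, b) q = (\<Sum>c\<in>B. R b c * M (z, c) q)"
  using assms by (simp add: op_mult_def op_tensor_def op_id_def sum_Times
     if_mult_left if_distrib[of "sum _"] sum.delta' cong: if_cong)
    (subst sum.swap, simp)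

lemma op_mult_tensor_id_right:
  assumes "finite A" "z \<in> A"
  shows "op_mult (A \<times> B) M (op_tensor op_id R) q (z, b) = (\<Sum>c\<in>B. M q (z, c) * R c b)"
  using assms by (simp add: op_mult_def op_tensor_def op_id_def sum_Times
     if_mults cong: if_cong)
    (subst sum.swap, simp)

lemma sandwich_entry:
  assumes "finite A" "z \<in> A" "z' \<in> A"
  shows "sandwich r A B \<rho> \<sigma> (z, b) (z', b') =
    (\<Sum>c\<in>B. \<Sum>c'\<in>B. op_powr B \<sigma> r b c * \<rho> (z, c) (z', c') * op_powr B \<sigma> r c' b')"
  using assms by (simp add: sandwich_def op_mult_tensor_id_left op_mult_tensor_id_right sum_distrib_left mult.assoc)

lemma op_powr_hermitian:
  assumes "spectral_data B \<sigma> V s"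
  shows "op_powr B \<sigma> r b' b = cnj (op_powr B \<sigma> r b b')"
  by (simp add: op_powr_def spectralD(5)[OF assms] cnj_sum mult_ac)

lemma tensor_powr_hermitian:
  assumes "spectral_data B \<sigma> V s"
  shows "op_tensor op_id (op_powr B \<sigma> r) q p = cnj (op_tensor op_id (op_powr B \<sigma> r) p q)"
  using op_powr_hermitian[OF assms, of r "snd q" "snd p"]
  by (auto simp: op_tensor_def op_id_def case_prod_unfold)

lemma sandwich_psd:
  assumes "finite B" "op_psd B \<sigma>" "op_psd (A \<times> B) \<rho>"
  shows "op_psd (A \<times> B) (sandwich r A B \<rho> \<sigma>)"
proof -
  obtain V s where "spectral_data B \<sigma> V s" using psd_spectral[OF assms(1,2)] by blast
  then show ?thesis unfolding sandwich_def by (intro op_psd_conj assms tensor_powr_hermitian)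
qed

lemma quad_form_sandwich:
  assumes "finite B" "op_psd B \<sigma>"
  shows "quad_form (A \<times> B) (sandwich r A B \<rho> \<sigma>) v =
     quad_form (A \<times> B) \<rho> (op_apply (A \<times> B) (op_tensor op_id (op_powr B \<sigma> r)) v)"
proof -
  obtain V s where "spectral_data B \<sigma> V s" using psd_spectral[OF assms(1,2)] by blast
  then show ?thesis unfolding sandwich_def by (intro quad_form_conj tensor_powr_hermitian)
qed

text \<open>Testing with \<open>y = X x\<close> bounds the squared norm of \<open>X x\<close> by the
  mean of itself and that of \<open>x\<close> on \<open>Q\<close>, which can be solved. Measuring
  norms on \<open>Q\<close> alone also encodes that \<open>X\<close> does not see the other
  labels.\<close>

lemma form_bound_norm_le:
  fixes X :: "'b op"
  assumes "finite B" "Q \<subseteq> B"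
    and X: "\<And>x y. cmod (\<Sum>b\<in>B. \<Sum>b'\<in>B. cnj (y b) * X b b' * x b') \<le> (sqnorm Q x + sqnorm Q y) / 2"
  shows "(\<Sum>b\<in>B. (cmod (\<Sum>b'\<in>B. X b b' * x b'))\<^sup>2) \<le> sqnorm Q x"
    and "(\<Sum>b'\<in>B. (cmod (\<Sum>b\<in>B. cnj (x b) * X b b'))\<^sup>2) \<le> sqnorm Q x"
proof -
  have QB: "sqnorm Q y \<le> sqnorm B y" for y
    using assms by (intro sum_mono2) auto
  define y where "y = (\<lambda>b. \<Sum>b'\<in>B. X b b' * x b')"
  have "(\<Sum>b\<in>B. \<Sum>b'\<in>B. cnj (y b) * X b b' * x b') = (\<Sum>b\<in>B. cnj (y b) * (\<Sum>b'\<in>B. X b b' * x b'))"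
    by (simp only: mult.assoc sum_distrib_left)
  also have "\<dots> = (\<Sum>b\<in>B. cnj (y b) * y b)" by (simp only: y_def)
  also have "\<dots> = of_real (sqnorm B y)" by (rule of_real_sum_cmod_square[symmetric])
  finally have "cmod (of_real (sqnorm B y)) \<le> (sqnorm Q x + sqnorm Q y) / 2"
    using X[of y x] by simp
  then have "sqnorm B y \<le> (sqnorm Q x + sqnorm Q y) / 2"
    by (simp only: norm_of_real)
  then show "(\<Sum>b\<in>B. (cmod (\<Sum>b'\<in>B. X b b' * x b'))\<^sup>2) \<le> sqnorm Q x"
    using QB[of y] by (simp add: y_def)
  define u where "u = (\<lambda>b'. cnj (\<Sum>b\<in>B. cnj (x b) * X b b'))"
  have "(\<Sum>b\<in>B. \<Sum>b'\<in>B. cnj (x b) * X b b' * u b') = (\<Sum>b'\<in>B. (\<Sum>b\<in>B. cnj (x b) * X b b') * u b')"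
    by (subst sum.swap) (simp only: sum_distrib_right)
  also have "\<dots> = (\<Sum>b'\<in>B. cnj (u b') * u b')" by (simp only: u_def complex_cnj_cnj)
  also have "\<dots> = of_real (sqnorm B u)" by (rule of_real_sum_cmod_square[symmetric])
  finally have "cmod (of_real (sqnorm B u)) \<le> (sqnorm Q u + sqnorm Q x) / 2"
    using X[of x u] by simp
  then have "sqnorm B u \<le> (sqnorm Q u + sqnorm Q x) / 2"
    by (simp only: norm_of_real)
  then show "(\<Sum>b'\<in>B. (cmod (\<Sum>b\<in>B. cnj (x b) * X b b'))\<^sup>2) \<le> sqnorm Q x"
  proof -
    have *: "a \<le> (b + c) / 2 \<Longrightarrow> b \<le> a \<Longrightarrow> a \<le> c" for a b c :: real by simp
    assume "sqnorm B u \<le> (sqnorm Q u + sqnorm Q x) / 2"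
    from *[OF this QB[of u]] show ?thesis unfolding u_def complex_mod_cnj .
  qed
qed

lemma column_in_supp:
  assumes "finite I" "op_psd I \<rho>" "q \<in> I"
  shows "(\<lambda>p. \<rho> p q) \<in> op_supp I \<rho>"
  unfolding op_supp_def
proof (clarify)
  fix w assume w: "\<forall>i\<in>I. op_apply I \<rho> w i = 0"
  have "vec_inner I w (\<lambda>p. \<rho> p q) = (\<Sum>p\<in>I. cnj (\<rho> q p * w p))"
    unfolding vec_inner_def using psd_hermitian[OF assms(1,2) \<open>q \<in> I\<close>] by (intro sum.cong refl) simp
  also have "\<dots> = cnj (op_apply I \<rho> w q)" by (simp add: op_apply_def cnj_sum)
  finally show "vec_inner I w (\<lambda>p. \<rho> p q) = 0" using w assms(3) by simp
qed

text \<open>A kernel vector of \<sigma> placed at \<open>z\<close> lies in the kernel of the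
  identity tensored with \<sigma>; the columns of \<rho> lie in the support of \<rho> and are thus
  orthogonal to it.\<close>

lemma supp_kernel_column:
  assumes fin: "finite A" "finite B" and psd: "op_psd (A \<times> B) \<rho>"
    and supp: "supported_by A B \<rho> \<sigma>"
    and V: "spectral_data B \<sigma> V s" and a: "a \<in> B" "s a = 0" and z: "z \<in> A" and q: "q \<in> A \<times> B"
  shows "(\<Sum>b\<in>B. cnj (V b a) * \<rho> (z, b) q) = 0"
proof -
  define w where "w = (\<lambda>(z', b). if z' = z then V b a else 0)"
  have "op_apply (A \<times> B) (op_tensor op_id \<sigma>) w p = 0" if "p \<in> A \<times> B" for p
  proof -
    obtain z' b where p: "p = (z', b)" "z' \<in> A" "b \<in> B" using \<open>p \<in> A \<times> B\<close> by auto
    have "op_apply (A \<times> B) (op_tensor op_id \<sigma>) w p = (\<Sum>b'\<in>B. (if z' = z then \<sigma> b b' * V b' a else 0))"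
      unfolding op_apply_def sum_Times using fin z p
      by (subst sum.swap) (simp add: op_tensor_def op_id_def w_def if_mults cong: if_cong)
    moreover have "(\<Sum>b'\<in>B. \<sigma> b b' * V b' a) = 0"
    proof -
      have "(\<Sum>b'\<in>B. \<sigma> b b' * V b' a) = (\<Sum>b'\<in>B. \<Sum>c\<in>B. V b c * of_real (s c) * (cnj (V b' c) * V b' a))"
        using p by (intro sum.cong refl) (simp add: spectralD(4)[OF V] sum_distrib_right mult.assoc)
      also have "\<dots> = (\<Sum>c\<in>B. V b c * of_real (s c) * (\<Sum>b'\<in>B. cnj (V b' c) * V b' a))"
        unfolding sum_distrib_left by (rule sum.swap)
      also have "\<dots> = 0" using a by (intro sum.neutral) (auto simp: spectralD(1)[OF V])
      finally show ?thesis .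
    qed
    ultimately show ?thesis by (cases "z' = z") simp_all
  qed
  moreover have "(\<lambda>p. \<rho> p q) \<in> op_supp (A \<times> B) (op_tensor op_id \<sigma>)"
    using column_in_supp[OF _ psd q] fin supp by blast
  ultimately have "vec_inner (A \<times> B) w (\<lambda>p. \<rho> p q) = 0"
    unfolding op_supp_def by blast
  moreover have "vec_inner (A \<times> B) w (\<lambda>p. \<rho> p q) = (\<Sum>b\<in>B. cnj (V b a) * \<rho> (z, b) q)"
    unfolding vec_inner_def sum_Times using fin z
    by (subst sum.swap) (simp add: w_def if_mult_left if_distrib[of cnj] cong: if_cong)
  ultimately show ?thesis by simp
qed

text \<open>One entry of the diagonal block at \<open>z\<close> of the sandwiched operator, in an
  eigenbasis of \<sigma>, computed twice: from the definition, where powers of \<sigma> act as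
  scalars, and from its own spectral decomposition.\<close>

lemma sandwich_eigenbasis:
  assumes fin: "finite A" "finite B" and V: "spectral_data B \<sigma> V s"
    and U: "spectral_data (A \<times> B) (sandwich r A B \<rho> \<sigma>) U \<tau>"
    and z: "z \<in> A" and a: "a \<in> B" "a' \<in> B"
  shows "of_real (s a powr r) * (\<Sum>b\<in>B. \<Sum>b'\<in>B. cnj (V b a) * \<rho> (z, b) (z, b') * V b' a') * of_real (s a' powr r) =
    (\<Sum>i\<in>A \<times> B. of_real (\<tau> i) * (\<Sum>b\<in>B. cnj (V b a) * U (z, b) i) * cnj (\<Sum>b\<in>B. cnj (V b a') * U (z, b) i))"
proof -
  define R where "R = op_powr B \<sigma> r"
  define T where "T = sandwich r A B \<rho> \<sigma>"
  let ?g = "\<lambda>p q. cnj (V (fst p) a) * R (fst p) (fst q) * \<rho> (z, fst q) (z, snd q) * (R (snd q) (snd p) * V (snd p) a')"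
  let ?T = "(\<Sum>b\<in>B. \<Sum>b'\<in>B. cnj (V b a) * T (z, b) (z, b') * V b' a')"
  have R1: "(\<Sum>b\<in>B. cnj (V b a) * R b c) = of_real (s a powr r) * cnj (V c a)" if "a \<in> B" for a c
  proof -
    have "(\<Sum>b\<in>B. cnj (V b a) * R b c) = (\<Sum>b\<in>B. \<Sum>d\<in>B. (cnj (V b a) * V b d) * (of_real (s d powr r) * cnj (V c d)))"
      by (simp add: R_def op_powr_def spectralD(5)[OF V] sum_distrib_left mult.assoc)
    also have "\<dots> = (\<Sum>d\<in>B. (\<Sum>b\<in>B. cnj (V b a) * V b d) * (of_real (s d powr r) * cnj (V c d)))"
      unfolding sum_distrib_right by (rule sum.swap)
    also have "\<dots> = of_real (s a powr r) * cnj (V c a)"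
      using that fin by (simp add: spectralD(1)[OF V] if_mult_left cong: if_cong)
    finally show ?thesis .
  qed
  have R2: "(\<Sum>b\<in>B. R c b * V b a) = of_real (s a powr r) * V c a" if "a \<in> B" for a c
    using arg_cong[OF R1[OF that, of c], of cnj] op_powr_hermitian[OF V, of r c]
    by (simp add: R_def cnj_sum mult.commute)
  have "?T =
     (\<Sum>p\<in>B \<times> B. \<Sum>q\<in>B \<times> B. ?g p q)"
    unfolding sum_Times using fin z
    by (simp add: T_def sandwich_entry R_def sum_distribs mult.assoc)
  also have "\<dots> = (\<Sum>q\<in>B \<times> B. \<Sum>p\<in>B \<times> B. ?g p q)"
    by (rule sum.swap)
  also have "\<dots> = (\<Sum>c\<in>B. \<Sum>c'\<in>B. (\<Sum>b\<in>B. cnj (V b a) * R b c) * \<rho> (z, c) (z, c') * (\<Sum>b'\<in>B. R c' b' * V b' a'))"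
    unfolding sum_mid_product sum_Times by simp
  also have "\<dots> = of_real (s a powr r) * (\<Sum>b\<in>B. \<Sum>b'\<in>B. cnj (V b a) * \<rho> (z, b) (z, b') * V b' a') * of_real (s a' powr r)"
    unfolding R1[OF a(1)] R2[OF a(2)] by (simp add: sum_distribs mult_ac)
  finally have 1: "?T = \<dots>" .
  have "?T =
     (\<Sum>p\<in>B \<times> B. \<Sum>i\<in>A \<times> B. cnj (V (fst p) a) * U (z, fst p) i * of_real (\<tau> i) * (cnj (U (z, snd p) i) * V (snd p) a'))"
    unfolding sum_Times[where A = B and B = B]
    by (intro sum.cong refl) (simp add: T_def spectralD(4)[OF U] z sum_distribs mult_ac)
  also have "\<dots> = (\<Sum>i\<in>A \<times> B. \<Sum>p\<in>B \<times> B. cnj (V (fst p) a) * U (z, fst p) i * of_real (\<tau> i) * (cnj (U (z, snd p) i) * V (snd p) a'))"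
    by (rule sum.swap)
  also have "\<dots> = (\<Sum>i\<in>A \<times> B. (\<Sum>b\<in>B. cnj (V b a) * U (z, b) i) * of_real (\<tau> i) * (\<Sum>b'\<in>B. cnj (U (z, b') i) * V b' a'))"
    unfolding sum_mid_product sum_Times[where A = B and B = B] by simp
  finally show ?thesis unfolding 1 by (simp add: cnj_sum mult_ac)
qed

text \<open>The core estimate for general \<rho> and \<sigma>. \<open>Q j\<close> is the set of
  labels seen by \<open>X j\<close>, and only the total weight of the outcomes seeing a given label
  enters \<open>L\<close>. This is what exploits the length structure without asking \<sigma> to be
  block diagonal.\<close>

lemma decoupling_interpolation:
  fixes Z :: "'z set" and B :: "'b set" and J :: "'j set" and \<rho> :: "('z \<times> 'b) op" and \<sigma> :: "'b op"
    and A :: "'j \<Rightarrow> 'z \<Rightarrow> real" and w :: "'j \<Rightarrow> real" and X :: "'j \<Rightarrow> 'b op" and Q :: "'j \<Rightarrow> 'b set"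
  defines "N \<equiv> \<lambda>\<alpha>. Re (op_trace (Z \<times> B) (op_powr (Z \<times> B) (sandwich ((1 - \<alpha>) / (2 * \<alpha>)) Z B \<rho> \<sigma>) \<alpha>))"
  assumes fin: "finite Z" "finite B" "finite J" and \<alpha>: "1 < \<alpha>" "\<alpha> < 2"
    and \<rho>: "state_on (Z \<times> B) \<rho>" and \<sigma>: "state_on B \<sigma>"
    and supp: "supported_by Z B \<rho> \<sigma>"
    and Q: "\<And>j. j \<in> J \<Longrightarrow> Q j \<subseteq> B"
    and X: "\<And>j x y. j \<in> J \<Longrightarrow> cmod (\<Sum>b\<in>B. \<Sum>b'\<in>B. cnj (y b) * X j b b' * x b') \<le>
       (sqnorm (Q j) x + sqnorm (Q j) y) / 2"
    and A: "\<And>z. z \<in> Z \<Longrightarrow> (\<Sum>j\<in>J. \<bar>A j z\<bar>) \<le> 2"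
    and w: "\<And>j. j \<in> J \<Longrightarrow> 0 < w j"
    and coll: "\<And>z z'. z \<in> Z \<Longrightarrow> z' \<in> Z \<Longrightarrow> (\<Sum>j\<in>J. A j z * A j z' / w j) \<le> (if z = z' then 1 else 0)"
    and L: "0 < L" "\<And>b. b \<in> B \<Longrightarrow> (\<Sum>j | j \<in> J \<and> b \<in> Q j. w j) \<le> L"
  shows "0 < N \<alpha>"
    and "cmod (\<Sum>z\<in>Z. \<Sum>j\<in>J. of_real (A j z) * (\<Sum>b\<in>B. \<Sum>b'\<in>B. X j b b' * \<rho> (z, b') (z, b)))
       \<le> 2 powr (2 / \<alpha> - 1) * sqrt L powr (2 * (\<alpha> - 1) / \<alpha>) * N \<alpha> powr (1 / \<alpha>)" (is ?bound)
proof -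
  let ?S = "(\<Sum>z\<in>Z. \<Sum>j\<in>J. of_real (A j z) * (\<Sum>b\<in>B. \<Sum>b'\<in>B. X j b b' * \<rho> (z, b') (z, b)))"
  define r where "r = (1 - \<alpha>) / (2 * \<alpha>)"
  define \<theta> where "\<theta> = 2 * (\<alpha> - 1) / \<alpha>"
  have \<theta>: "0 \<le> \<theta>" "\<theta> \<le> 1" "r = - \<theta> / 4" "1 / \<alpha> = 1 - \<theta> / 2" "1 - \<theta> = 2 / \<alpha> - 1"
    using \<alpha> by (auto simp: \<theta>_def r_def field_simps)
  have psd: "op_psd (Z \<times> B) \<rho>" "op_psd B \<sigma>" and tr: "op_trace (Z \<times> B) \<rho> = 1" "op_trace B \<sigma> = 1"
    using \<rho> \<sigma> by (auto simp: state_on_def)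
  have finZB: "finite (Z \<times> B)" using fin by simp
  obtain V s where V: "spectral_data B \<sigma> V s" using psd_spectral[OF fin(2) psd(2)] by blast
  obtain U \<tau> where U: "spectral_data (Z \<times> B) (sandwich r Z B \<rho> \<sigma>) U \<tau>"
    using psd_spectral[OF finZB sandwich_psd[OF fin(2) psd(2,1)]] by blast
  define Rh where "Rh = (\<lambda>z a a'. \<Sum>b\<in>B. \<Sum>b'\<in>B. cnj (V b a) * \<rho> (z, b) (z, b') * V b' a')"
  define uh where "uh = (\<lambda>i z a. \<Sum>b\<in>B. cnj (V b a) * U (z, b) i)"
  define Xh where "Xh = (\<lambda>j a' a. \<Sum>b\<in>B. \<Sum>b'\<in>B. cnj (V b a') * X j b b' * V b' a)"
  define B0 where "B0 = {a\<in>B. 0 < s a}"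
  define I0 where "I0 = {i\<in>Z \<times> B. 0 < \<tau> i}"
  have fin0: "finite I0" "B0 \<subseteq> B" "I0 \<subseteq> Z \<times> B" using finZB by (auto simp: I0_def B0_def)
  have N_eq: "N \<alpha> = (\<Sum>i\<in>I0. \<tau> i powr \<alpha>)"
  proof -
    have "N \<alpha> = (\<Sum>i\<in>Z \<times> B. \<tau> i powr \<alpha>)"
      unfolding N_def r_def[symmetric] by (rule trace_op_powr[OF finZB U])
    also have "\<dots> = (\<Sum>i\<in>I0. \<tau> i powr \<alpha>)"
      using finZB spectralD(3)[OF U] by (intro sum.mono_neutral_right) (auto simp: I0_def not_less antisym)
    finally show ?thesis .
  qed
  have rows: "(\<Sum>a\<in>B. V b a * cnj (V b' a)) = (if b = b' then 1 else 0)"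
    and cols: "(\<Sum>a\<in>B. cnj (V a b) * V a b') = (if b = b' then 1 else 0)" if "b \<in> B" "b' \<in> B" for b b'
    using that by (auto simp: spectralD(1,2)[OF V])
  have rows': "(\<Sum>a\<in>B. cnj (V b a) * cnj (cnj (V b' a))) = (if b = b' then 1 else 0)" if "b \<in> B" "b' \<in> B" for b b'
    using rows[OF that(2,1)] by (auto simp: mult.commute)
  have cols': "(\<Sum>a\<in>B. cnj (V a b) * cnj (cnj (V a b'))) = (if b = b' then 1 else 0)" if "b \<in> B" "b' \<in> B" for b b'
    using cols[OF that] by simp
  \<comment> \<open>The support condition at work: the negative power of \<sigma> is 0 on its
    kernel, so the sandwiching can be undone only because \<rho> has no entries there.\<close>
  have Rh0: "Rh z a a' = 0" if "z \<in> Z" "a \<in> B" "a' \<in> B" "a \<notin> B0 \<or> a' \<notin> B0" for z a a'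
  proof -
    have ker: "(\<Sum>b\<in>B. cnj (V b a) * \<rho> (z, b) (z, b')) = 0" if "a \<in> B - B0" "b' \<in> B" for a b'
    proof -
      have "s a = 0" using spectralD(3)[OF V, of a] that by (auto simp: B0_def)
      then show ?thesis using that \<open>z \<in> Z\<close>
        by (intro supp_kernel_column[OF fin(1,2) psd(1) supp V]) auto
    qed
    show ?thesis
    proof (cases "a \<in> B0")
      case False
      have "Rh z a a' = (\<Sum>b'\<in>B. (\<Sum>b\<in>B. cnj (V b a) * \<rho> (z, b) (z, b')) * V b' a')"
        unfolding Rh_def sum_distrib_right by (rule sum.swap)
      then show ?thesis using False that ker[of a] by simp
    next
      case True
      then have a': "a' \<in> B - B0" using that by auto
      have "(\<Sum>b'\<in>B. \<rho> (z, b) (z, b') * V b' a') = 0" if "b \<in> B" for b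
      proof -
        have "(\<Sum>b'\<in>B. \<rho> (z, b) (z, b') * V b' a') = (\<Sum>b'\<in>B. cnj (cnj (V b' a') * \<rho> (z, b') (z, b)))"
        proof (intro sum.cong refl)
          fix b' assume "b' \<in> B"
          have "\<rho> (z, b) (z, b') = cnj (\<rho> (z, b') (z, b))"
            using psd_hermitian[OF finZB psd(1), of "(z, b')" "(z, b)"] \<open>b' \<in> B\<close> that \<open>z \<in> Z\<close> by simp
          then show "\<rho> (z, b) (z, b') * V b' a' = cnj (cnj (V b' a') * \<rho> (z, b') (z, b))" by simp
        qed
        also have "\<dots> = 0" using ker[OF a' that] by (simp only: cnj_sum[symmetric] complex_cnj_zero)
        finally show ?thesis .
      qed
      moreover have "Rh z a a' = (\<Sum>b\<in>B. cnj (V b a) * (\<Sum>b'\<in>B. \<rho> (z, b) (z, b') * V b' a'))"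
        unfolding Rh_def by (simp add: sum_distrib_left mult.assoc)
      ultimately show ?thesis by simp
    qed
  qed
  have Rh_eq: "Rh z a a' = of_real (s a powr (\<theta> / 4) * s a' powr (\<theta> / 4)) * (\<Sum>i\<in>I0. of_real (\<tau> i) * uh i z a * cnj (uh i z a'))"
    if "z \<in> Z" "a \<in> B0" "a' \<in> B0" for z a a'
  proof -
    have pos: "0 < s a" "0 < s a'" and aB: "a \<in> B" "a' \<in> B" using that by (auto simp: B0_def)
    have inv: "complex_of_real (x powr (\<theta> / 4)) * of_real (x powr r) = 1" if "0 < x" for x
      using that \<theta>(3) by (simp add: powr_add[symmetric] flip: of_real_mult)
    have "Rh z a a' = (of_real (s a powr (\<theta> / 4)) * of_real (s a powr r)) * Rh z a a' *
        (of_real (s a' powr r) * of_real (s a' powr (\<theta> / 4)))"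
      using inv[OF pos(1)] inv[OF pos(2)] by (simp add: mult.commute)
    also have "\<dots> = of_real (s a powr (\<theta> / 4) * s a' powr (\<theta> / 4)) * (of_real (s a powr r) * Rh z a a' * of_real (s a' powr r))"
      by simp
    also have "of_real (s a powr r) * Rh z a a' * of_real (s a' powr r) = (\<Sum>i\<in>Z \<times> B. of_real (\<tau> i) * uh i z a * cnj (uh i z a'))"
      unfolding Rh_def uh_def by (rule sandwich_eigenbasis[OF fin(1,2) V U \<open>z \<in> Z\<close> aB])
    also have "\<dots> = (\<Sum>i\<in>I0. of_real (\<tau> i) * uh i z a * cnj (uh i z a'))"
      using finZB spectralD(3)[OF U] by (intro sum.mono_neutral_right) (auto simp: I0_def not_less antisym)
    finally show ?thesis .
  qed
  have rho_expand: "\<rho> (z, b') (z, b) = (\<Sum>a\<in>B. \<Sum>a'\<in>B. V b' a * Rh z a a' * cnj (V b a'))" if "z \<in> Z" "b \<in> B" "b' \<in> B" for z b b'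
  proof -
    have "Rh z a a' = (\<Sum>c\<in>B. cnj (V c a) * (\<Sum>c'\<in>B. V c' a' * \<rho> (z, c) (z, c')))" for a a'
      unfolding Rh_def sum_distrib_left by (simp add: mult_ac)
    then have 1: "(\<Sum>a\<in>B. V b' a * Rh z a a') = (\<Sum>c'\<in>B. V c' a' * \<rho> (z, b') (z, c'))" for a'
      using unitary_expand[where W = V and h = "\<lambda>c. \<Sum>c'\<in>B. V c' a' * \<rho> (z, c) (z, c')" for a', OF fin(2) rows \<open>b' \<in> B\<close>] by simp
    have "(\<Sum>a\<in>B. \<Sum>a'\<in>B. V b' a * Rh z a a' * cnj (V b a')) = (\<Sum>a'\<in>B. cnj (V b a') * (\<Sum>a\<in>B. V b' a * Rh z a a'))"
      unfolding sum_distrib_left by (subst sum.swap) (simp add: mult_ac)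
    also have "\<dots> = (\<Sum>a'\<in>B. cnj (V b a') * (\<Sum>c'\<in>B. cnj (cnj (V c' a')) * \<rho> (z, b') (z, c')))"
      by (simp add: 1)
    also have "\<dots> = \<rho> (z, b') (z, b)"
      by (rule unitary_expand[OF fin(2) rows' \<open>b \<in> B\<close>])
    finally show ?thesis by simp
  qed
  have trace_hat: "(\<Sum>b\<in>B. \<Sum>b'\<in>B. Y b b' * \<rho> (z, b') (z, b)) =
      (\<Sum>a\<in>B0. \<Sum>a'\<in>B0. Rh z a a' * (\<Sum>b\<in>B. \<Sum>b'\<in>B. cnj (V b a') * Y b b' * V b' a))" if "z \<in> Z" for z Y
  proof -
    let ?y = "\<lambda>p q. Rh z (fst q) (snd q) * (cnj (V (fst p) (snd q)) * Y (fst p) (snd p) * V (snd p) (fst q))"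
    have "(\<Sum>b\<in>B. \<Sum>b'\<in>B. Y b b' * \<rho> (z, b') (z, b)) =
      (\<Sum>p\<in>B \<times> B. \<Sum>q\<in>B \<times> B. ?y p q)"
      unfolding sum_Times using that
      by (intro sum.cong refl) (simp add: rho_expand sum_distrib_left mult_ac)
    also have "\<dots> = (\<Sum>q\<in>B \<times> B. \<Sum>p\<in>B \<times> B. ?y p q)"
      by (rule sum.swap)
    also have "\<dots> = (\<Sum>q\<in>B0 \<times> B0. \<Sum>p\<in>B \<times> B. ?y p q)"
    proof (rule sum.mono_neutral_right)
      show "\<forall>q\<in>B \<times> B - B0 \<times> B0. (\<Sum>p\<in>B \<times> B. ?y p q) = 0"
      proof
        fix q assume "q \<in> B \<times> B - B0 \<times> B0"
        then have "Rh z (fst q) (snd q) = 0" by (intro Rh0 that) auto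
        then show "(\<Sum>p\<in>B \<times> B. ?y p q) = 0" by simp
      qed
    qed (use fin fin0 in auto)
    finally show ?thesis unfolding sum_Times by (simp add: sum_distrib_left)
  qed
  \<comment> \<open>If all eigenvalues of the sandwiched operator vanished, so would
    \<open>Rh\<close>, and with it the trace of \<rho>.\<close>
  have "I0 \<noteq> {}"
  proof
    assume "I0 = {}"
    then have "(\<Sum>b\<in>B. \<Sum>b'\<in>B. op_id b b' * \<rho> (z, b') (z, b)) = 0" if "z \<in> Z" for z
      unfolding trace_hat[OF that] using Rh_eq[OF that] by simp
    then have "(\<Sum>b\<in>B. \<rho> (z, b) (z, b)) = 0" if "z \<in> Z" for z
      using that fin by (simp add: op_id_def if_mult_left cong: if_cong)
    then have "op_trace (Z \<times> B) \<rho> = 0" by (simp add: op_trace_def sum_Times)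
    then show False using tr by simp
  qed
  then show Npos: "0 < N \<alpha>"
    unfolding N_eq using fin0 by (intro sum_pos) (auto simp: I0_def)
  define D where "D = (\<lambda>i. \<tau> i powr \<alpha> / N \<alpha>)"
  have \<tau>D: "\<tau> i = N \<alpha> powr (1 / \<alpha>) * D i powr (1 - \<theta> / 2)" if "i \<in> I0" for i
  proof -
    have "0 < \<tau> i" using that by (simp add: I0_def)
    then have "N \<alpha> powr (1 / \<alpha>) * D i powr (1 / \<alpha>) = (\<tau> i powr \<alpha>) powr (1 / \<alpha>)"
      using Npos by (simp add: D_def powr_mult[symmetric])
    also have "\<dots> = \<tau> i" using \<open>0 < \<tau> i\<close> \<alpha> by (simp add: powr_powr)
    finally show ?thesis by (simp add: \<theta>(4))
  qed
  have uh_orth: "(\<Sum>z\<in>Z. \<Sum>a\<in>B. cnj (uh i z a) * uh i' z a) = (if i = i' then 1 else 0)" if "i \<in> I0" "i' \<in> I0" for i i'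
  proof -
    have "(\<Sum>a\<in>B. cnj (uh i z a) * uh i' z a) = (\<Sum>b\<in>B. cnj (U (z, b) i) * U (z, b) i')" for z
      unfolding uh_def by (rule unitary_inner[OF fin(2) rows])
    then have "(\<Sum>z\<in>Z. \<Sum>a\<in>B. cnj (uh i z a) * uh i' z a) = (\<Sum>p\<in>Z \<times> B. cnj (U p i) * U p i')"
      by (simp add: sum_Times)
    also have "\<dots> = (if i = i' then 1 else 0)"
      using that fin0(3) by (intro spectralD(1)[OF U]) blast+
    finally show ?thesis .
  qed
  have norm_V: "(\<Sum>b\<in>B. (cmod (\<Sum>a\<in>B. V b a * x a))\<^sup>2) = sqnorm B x" for x
    using unitary_norm[where W = "\<lambda>a b. cnj (V b a)", OF fin(2) cols', of x] by simp
  have form_hat: "(\<Sum>a\<in>B. \<Sum>b\<in>B. cnj (y b) * Xh j b a * x a) =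
      (\<Sum>b\<in>B. \<Sum>b'\<in>B. cnj (\<Sum>a\<in>B. V b a * y a) * X j b b' * (\<Sum>a\<in>B. V b' a * x a))" for j x y
  proof -
    have "(\<Sum>a\<in>B. \<Sum>b\<in>B. cnj (y b) * Xh j b a * x a) =
      (\<Sum>q\<in>B \<times> B. \<Sum>p\<in>B \<times> B. cnj (V (fst p) (fst q) * y (fst q)) * X j (fst p) (snd p) * (V (snd p) (snd q) * x (snd q)))"
      unfolding sum_Times by (subst sum.swap) (simp add: Xh_def sum_distribs mult_ac)
    also have "\<dots> = (\<Sum>p\<in>B \<times> B. \<Sum>q\<in>B \<times> B. cnj (V (fst p) (fst q) * y (fst q)) * X j (fst p) (snd p) * (V (snd p) (snd q) * x (snd q)))"
      by (rule sum.swap)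
    finally show ?thesis unfolding cnj_sum sum_mid_product sum_Times by simp
  qed
  let ?d = "\<lambda>i a b. D i powr (1 - \<theta> / 2) * s a powr (\<theta> / 4) * s b powr (\<theta> / 4)"
  let ?C = "\<Sum>i\<in>I0. \<Sum>a\<in>B0. \<Sum>b\<in>B0. of_real (?d i a b) *
    (\<Sum>z\<in>Z. \<Sum>j\<in>J. of_real (A j z) * Xh j b a * uh i z a * cnj (uh i z b))"
  have core: "cmod ?C
    \<le> 2 powr (1 - \<theta>) * sqrt L powr \<theta>"
  proof (rule interpolation_core[where B = B and w = w])
    show "0 < D i" if "i \<in> I0" for i using that Npos by (simp add: D_def I0_def)
    show "(\<Sum>i\<in>I0. D i) = 1" using Npos by (simp add: D_def N_eq flip: sum_divide_distrib)
  next
    fix x y :: "'z \<Rightarrow> 'b \<Rightarrow> complex"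
    define g where "g = (\<lambda>z. (sqnorm B (x z)) + sqnorm B (y z))"
    let ?f = "\<lambda>z j. \<Sum>a\<in>B. \<Sum>b\<in>B. cnj (y z b) * Xh j b a * x z a"
    have form: "cmod (?f z j) \<le> g z / 2" if "j \<in> J" for z j
    proof -
      have QB: "sqnorm (Q j) v \<le> sqnorm B v" for v
        using fin Q[OF that] by (intro sum_mono2) auto
      have QV: "(\<Sum>b\<in>Q j. (cmod (\<Sum>a\<in>B. V b a * v a))\<^sup>2) \<le> sqnorm B v" for v
        using QB[of "\<lambda>b. \<Sum>a\<in>B. V b a * v a"] norm_V[of v] by simp
      show ?thesis unfolding form_hat g_def
        by (rule order.trans[OF X[OF that]]) (intro divide_right_mono add_mono QV, simp)
    qed
    have "cmod (\<Sum>z\<in>Z. \<Sum>j\<in>J. of_real (A j z) * (?f z j)) \<le> (\<Sum>z\<in>Z. g z)"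
    proof (rule sum_norm_le)
      fix z assume z: "z \<in> Z"
      have g0: "0 \<le> g z" by (simp add: g_def sum_nonneg)
      have "cmod (\<Sum>j\<in>J. of_real (A j z) * (?f z j)) \<le> (\<Sum>j\<in>J. \<bar>A j z\<bar> * (g z / 2))"
        unfolding norm_mult norm_of_real
        by (intro sum_norm_le) (simp only: norm_mult norm_of_real, intro mult_left_mono form, auto)
      also have "\<dots> \<le> 2 * (g z / 2)"
        unfolding sum_distrib_right[symmetric] using A[OF z] g0 by (intro mult_right_mono) auto
      finally show "cmod (\<Sum>j\<in>J. of_real (A j z) * (?f z j)) \<le> g z" by simp
    qed
    then show "cmod (\<Sum>z\<in>Z. \<Sum>j\<in>J. of_real (A j z) * (?f z j))
       \<le> (\<Sum>z\<in>Z. \<Sum>a\<in>B. (cmod (x z a))\<^sup>2) + (\<Sum>z\<in>Z. \<Sum>a\<in>B. (cmod (y z a))\<^sup>2)"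
      by (simp add: g_def sum.distrib)
  next
    have Xh_col: "(\<Sum>b\<in>B. (cmod (Xh j b a))\<^sup>2) \<le> (\<Sum>b\<in>Q j. (cmod (V b a))\<^sup>2)" if "j \<in> J" for j a
    proof -
      have "Xh j b a = (\<Sum>c\<in>B. cnj (V c b) * (\<Sum>c'\<in>B. X j c c' * V c' a))" for b
        by (simp add: Xh_def sum_distrib_left mult.assoc)
      then have "(\<Sum>b\<in>B. (cmod (Xh j b a))\<^sup>2) = (\<Sum>c\<in>B. (cmod (\<Sum>c'\<in>B. X j c c' * V c' a))\<^sup>2)"
        using unitary_norm[where W = V and J = B, OF fin(2) rows] by simp
      also have "\<dots> \<le> (\<Sum>b\<in>Q j. (cmod (V b a))\<^sup>2)"
        by (rule form_bound_norm_le(1)[OF fin(2) Q[OF that] X[OF that]])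
      finally show ?thesis .
    qed
    have Xh_row: "sqnorm B (Xh j b) \<le> (\<Sum>c\<in>Q j. (cmod (V c b))\<^sup>2)" if "j \<in> J" for j b
    proof -
      have "Xh j b a = (\<Sum>c'\<in>B. cnj (cnj (V c' a)) * (\<Sum>c\<in>B. cnj (V c b) * X j c c'))" for a
        unfolding Xh_def sum_distrib_left by (subst sum.swap) (simp add: mult_ac)
      then have "sqnorm B (Xh j b) = (\<Sum>c'\<in>B. (cmod (\<Sum>c\<in>B. cnj (V c b) * X j c c'))\<^sup>2)"
        using unitary_norm[where W = "\<lambda>c a. cnj (V c a)" and J = B, OF fin(2) rows'] by simp
      also have "\<dots> \<le> (\<Sum>c\<in>Q j. (cmod (V c b))\<^sup>2)"
        by (rule form_bound_norm_le(2)[OF fin(2) Q[OF that] X[OF that]])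
      finally show ?thesis .
    qed
    have s0: "0 \<le> s a" if "a \<in> B" for a using spectralD(3)[OF V that] .
    let ?x = "\<lambda>j. \<Sum>a\<in>B0. \<Sum>b\<in>B0. sqrt (s a * s b) * (cmod (Xh j b a))\<^sup>2"
    let ?q = "\<lambda>j a. \<Sum>c\<in>Q j. (cmod (V c a))\<^sup>2"
    \<comment> \<open>Replacing \<open>sqrt (s a * s b)\<close> by the arithmetic mean separates the
      rows from the columns of \<open>Xh j\<close>; each is bounded by the mass of one eigenvector
      on \<open>Q j\<close>. The right side is the trace of \<sigma> on \<open>Q j\<close>.\<close>
    have "(?x j) \<le> (\<Sum>a\<in>B. s a * (?q j a))" if j: "j \<in> J" for j
    proof -
      have "(?x j) =
          (\<Sum>p\<in>B0 \<times> B0. sqrt (s (fst p) * s (snd p)) * (cmod (Xh j (snd p) (fst p)))\<^sup>2)"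
        by (simp add: sum_Times)
      also have "\<dots> \<le> (\<Sum>p\<in>B \<times> B. sqrt (s (fst p) * s (snd p)) * (cmod (Xh j (snd p) (fst p)))\<^sup>2)"
        by (intro sum_mono2) (use fin fin0 s0 in auto)
      also have "\<dots> \<le> (\<Sum>p\<in>B \<times> B. (s (fst p) + s (snd p)) / 2 * (cmod (Xh j (snd p) (fst p)))\<^sup>2)"
        by (intro sum_mono mult_right_mono arith_geo_mean_sqrt) (use s0 in auto)
      also have "\<dots> = ((\<Sum>a\<in>B. s a * (\<Sum>b\<in>B. (cmod (Xh j b a))\<^sup>2)) + (\<Sum>b\<in>B. s b * (sqnorm B (Xh j b)))) / 2"
      proof -
        have "(\<Sum>b\<in>B. s b * (sqnorm B (Xh j b))) = (\<Sum>a\<in>B. \<Sum>b\<in>B. s b * (cmod (Xh j b a))\<^sup>2)"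
          unfolding sum_distrib_left by (rule sum.swap)
        then show ?thesis
          unfolding sum_Times sum_distrib_left sum_divide_distrib
          by (simp add: sum.distrib[symmetric] sum_divide_distrib add_divide_distrib distrib_right)
      qed
      also have "\<dots> \<le> ((\<Sum>a\<in>B. s a * (?q j a)) + (\<Sum>b\<in>B. s b * (?q j b))) / 2"
        by (intro divide_right_mono add_mono sum_mono mult_left_mono Xh_col Xh_row j s0) auto
      finally show ?thesis by simp
    qed
    then have "(\<Sum>j\<in>J. w j * (?x j)) \<le>
        (\<Sum>j\<in>J. w j * (\<Sum>a\<in>B. s a * (?q j a)))"
      by (intro sum_mono mult_left_mono) (auto simp: less_imp_le[OF w])
    also have "\<dots> = (\<Sum>j\<in>J. \<Sum>p\<in>B \<times> B. if snd p \<in> Q j then w j * (s (fst p) * (cmod (V (snd p) (fst p)))\<^sup>2) else 0)"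
    proof (rule sum.cong[OF refl])
      fix j assume "j \<in> J"
      have "(?q j a) = (\<Sum>c\<in>B. if c \<in> Q j then (cmod (V c a))\<^sup>2 else 0)" for a
        using fin Q[OF \<open>j \<in> J\<close>] by (simp add: sum.If_cases Int_absorb1 Int_def[symmetric])
      then show "w j * (\<Sum>a\<in>B. s a * (?q j a)) =
          (\<Sum>p\<in>B \<times> B. if snd p \<in> Q j then w j * (s (fst p) * (cmod (V (snd p) (fst p)))\<^sup>2) else 0)"
        unfolding sum_Times by (simp add: sum_distrib_left if_mult_right cong: if_cong)
    qed
    also have "\<dots> = (\<Sum>p\<in>B \<times> B. \<Sum>j\<in>J. if snd p \<in> Q j then w j * (s (fst p) * (cmod (V (snd p) (fst p)))\<^sup>2) else 0)"
      by (rule sum.swap)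
    also have "\<dots> = (\<Sum>p\<in>B \<times> B. (s (fst p) * (cmod (V (snd p) (fst p)))\<^sup>2) * (\<Sum>j | j \<in> J \<and> snd p \<in> Q j. w j))"
      using fin by (intro sum.cong refl) (simp add: sum.If_cases sum_distrib_left Int_def mult_ac)
    \<comment> \<open>For a fixed label, the weights of the outcomes that see it sum to at most
      \<open>L\<close>; the remaining factor is the trace of \<sigma>.\<close>
    also have "\<dots> \<le> (\<Sum>p\<in>B \<times> B. (s (fst p) * (cmod (V (snd p) (fst p)))\<^sup>2) * L)"
      by (intro sum_mono mult_left_mono L) (use s0 in auto)
    also have "\<dots> = (\<Sum>a\<in>B. s a * (\<Sum>b\<in>B. (cmod (V b a))\<^sup>2)) * L"
      unfolding sum_Times by (simp add: sum_distrib_right sum_distrib_left)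
    also have "\<dots> = L"
    proof -
      have V1: "(\<Sum>b\<in>B. (cmod (V b a))\<^sup>2) = 1" if "a \<in> B" for a
      proof -
        have "complex_of_real (\<Sum>b\<in>B. (cmod (V b a))\<^sup>2) = 1"
          unfolding of_real_sum_cmod_square using cols[OF that that] by simp
        then show ?thesis by (simp only: of_real_eq_1_iff)
      qed
      have "op_trace B \<sigma> = (\<Sum>b\<in>B. \<Sum>a\<in>B. of_real (s a) * (cnj (V b a) * V b a))"
        by (simp add: op_trace_def spectralD(4)[OF V] mult_ac)
      also have "\<dots> = (\<Sum>a\<in>B. of_real (s a) * (\<Sum>b\<in>B. cnj (V b a) * V b a))"
        unfolding sum_distrib_left by (rule sum.swap)
      also have "\<dots> = of_real (\<Sum>a\<in>B. s a)" by (simp add: cols)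
      finally have "(\<Sum>a\<in>B. s a) = 1" using tr(2) by (metis of_real_eq_1_iff)
      then show ?thesis by (simp add: V1)
    qed
    finally show "(\<Sum>j\<in>J. w j * (?x j)) \<le> L" .
  qed (use fin fin0 uh_orth w coll L \<theta> in \<open>auto simp: B0_def\<close>)
  define K where "K = complex_of_real (N \<alpha> powr (1 / \<alpha>))"
  let ?h = "\<lambda>z j i a b. K * (of_real (?d i a b) * (of_real (A j z) * Xh j b a * uh i z a * cnj (uh i z b)))"
  let ?k = "\<lambda>z j i p. K * (of_real (?d i (fst p) (snd p)) * (Xh j (snd p) (fst p) * uh i z (fst p) * cnj (uh i z (snd p))))"
  have "?S =
    (\<Sum>r\<in>Z \<times> J. \<Sum>q\<in>I0 \<times> B0 \<times> B0. ?h (fst r) (snd r) (fst q) (fst (snd q)) (snd (snd q)))"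
  proof -
    have "(\<Sum>b\<in>B. \<Sum>b'\<in>B. X j b b' * \<rho> (z, b') (z, b)) = (\<Sum>i\<in>I0. \<Sum>a\<in>B0. \<Sum>b\<in>B0. K *
        (of_real (?d i a b) * (Xh j b a * uh i z a * cnj (uh i z b))))"
      if "z \<in> Z" for z j
    proof -
      have "(\<Sum>b\<in>B. \<Sum>b'\<in>B. X j b b' * \<rho> (z, b') (z, b)) = (\<Sum>p\<in>B0 \<times> B0. Rh z (fst p) (snd p) * Xh j (snd p) (fst p))"
        unfolding trace_hat[OF that] sum_Times by (simp add: Xh_def)
      also have "\<dots> = (\<Sum>p\<in>B0 \<times> B0. \<Sum>i\<in>I0. ?k z j i p)"
      proof (rule sum.cong[OF refl])
        fix p assume p: "p \<in> B0 \<times> B0"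
        have \<tau>: "complex_of_real (\<tau> i) = K * of_real (D i powr (1 - \<theta> / 2))" if "i \<in> I0" for i
          unfolding K_def by (subst \<tau>D[OF that]) simp
        have "Rh z (fst p) (snd p) * Xh j (snd p) (fst p) = (\<Sum>i\<in>I0. of_real (s (fst p) powr (\<theta> / 4) * s (snd p) powr (\<theta> / 4)) *
           (of_real (\<tau> i) * uh i z (fst p) * cnj (uh i z (snd p))) * Xh j (snd p) (fst p))"
          using p by (subst Rh_eq[OF \<open>z \<in> Z\<close>]) (auto simp: sum_distribs)
        then show "Rh z (fst p) (snd p) * Xh j (snd p) (fst p) = (\<Sum>i\<in>I0. ?k z j i p)"
          by (simp add: \<tau> mult_ac)
      qed
      also have "\<dots> = (\<Sum>i\<in>I0. \<Sum>p\<in>B0 \<times> B0. ?k z j i p)"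
        by (rule sum.swap)
      finally show ?thesis unfolding sum_Times by simp
    qed
    then show ?thesis unfolding sum_Times by (simp add: sum_distrib_left mult_ac)
  qed
  also have "\<dots> = (\<Sum>q\<in>I0 \<times> B0 \<times> B0. \<Sum>r\<in>Z \<times> J. ?h (fst r) (snd r) (fst q) (fst (snd q)) (snd (snd q)))"
    by (rule sum.swap)
  also have "\<dots> = K * ?C"
    unfolding sum_Times sum_distrib_left by simp
  finally have sum_eq: "?S =
    K * ?C" .
  have "cmod K = N \<alpha> powr (1 / \<alpha>)" by (simp add: K_def)
  then have "cmod ?S =
     N \<alpha> powr (1 / \<alpha>) * cmod ?C"
    unfolding sum_eq norm_mult by (simp only:)
  also have "\<dots> \<le> N \<alpha> powr (1 / \<alpha>) * (2 powr (1 - \<theta>) * sqrt L powr \<theta>)"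
    by (intro mult_left_mono core) simp
  finally show ?bound
    unfolding \<theta>(5) by (simp add: \<theta>_def mult_ac)
qed

subsection \<open>Sandwiched Renyi entropy and conditioning\<close>

definition renyi_trace :: "real \<Rightarrow> 'a set \<Rightarrow> 'b set \<Rightarrow> ('a \<times> 'b) op \<Rightarrow> 'b op \<Rightarrow> real" where
  "renyi_trace \<alpha> A B \<rho> \<sigma> =
     Re (op_trace (A \<times> B) (op_powr (A \<times> B) (sandwich ((1 - \<alpha>) / (2 * \<alpha>)) A B \<rho> \<sigma>) \<alpha>))"

abbreviation entropy_powr :: "real \<Rightarrow> 'a set \<Rightarrow> 'b set \<Rightarrow> ('a \<times> 'b) op \<Rightarrow> real" where
  "entropy_powr \<alpha> A B \<rho> \<equiv> 2 powr (- ((\<alpha> - 1) / \<alpha>) * real_of_ereal (sandwiched_renyi_entropy \<alpha> A B \<rho>))"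

lemma state_on_nonempty: "state_on I \<rho> \<Longrightarrow> I \<noteq> {}"
  by (auto simp: state_on_def op_trace_def)

abbreviation max_mixed :: "'b set \<Rightarrow> 'b op" where
  "max_mixed B \<equiv> op_diag (\<lambda>_. 1 / real (card B))"

text \<open>A full-rank state meets the support condition for every \<rho>, which keeps the supremum
  in the entropy above minus infinity.\<close>

lemma maximally_mixed_state:
  assumes "finite B" "B \<noteq> {}"
  shows "state_on B (max_mixed B)"
    and "op_supp (A \<times> B) \<rho> \<subseteq> op_supp (A \<times> B) (op_tensor op_id (max_mixed B))"
proof -
  have card: "0 < card B" using assms by (simp add: card_gt_0_iff)
  have "quad_form B (max_mixed B) v = of_real ((sqnorm B v) / real (card B))" for v
  proof -
    have "quad_form B (max_mixed B) v = (\<Sum>b\<in>B. cnj (v b) * v b) / of_real (real (card B))"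
      using assms by (simp add: quad_form_def op_diag_def sum_divide_distrib if_mults cong: if_cong)
    then show ?thesis unfolding of_real_sum_cmod_square[symmetric] by simp
  qed
  then have "op_psd B (max_mixed B)"
    unfolding op_psd_iff by (simp only: nonneg_Reals_of_real_iff) (simp add: sum_nonneg)
  then show "state_on B (max_mixed B)"
    using card by (simp add: state_on_def op_trace_def op_diag_def)
  show "op_supp (A \<times> B) \<rho> \<subseteq> op_supp (A \<times> B) (op_tensor op_id (max_mixed B))"
  proof (cases "finite A")
    case True
    have "op_apply (A \<times> B) (op_tensor op_id (max_mixed B)) w p = w p / of_real (real (card B))"
      if "p \<in> A \<times> B" for w p
    proof -
      have "op_apply (A \<times> B) (op_tensor op_id (max_mixed B)) w p =
         (\<Sum>q\<in>A \<times> B. if p = q then w p / of_real (real (card B)) else 0)"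
        unfolding op_apply_def
        by (intro sum.cong refl) (auto simp: op_tensor_def op_id_def op_diag_def split: prod.splits)
      then show ?thesis using that True assms by simp
    qed
    then have "w p = 0" if "p \<in> A \<times> B" "\<forall>i\<in>A \<times> B. op_apply (A \<times> B) (op_tensor op_id (max_mixed B)) w i = 0" for w p
      using that card by (metis divide_eq_0_iff less_irrefl of_nat_0_less_iff of_real_eq_0_iff)
    then show ?thesis unfolding op_supp_def vec_inner_def by (auto intro!: sum.neutral)
  next
    case False
    then have "infinite (A \<times> B)" using assms finite_cartesian_productD1 by blast
    then show ?thesis by (simp add: op_supp_def vec_inner_def)
  qed
qed

lemma renyi_prefactor: "1 / (1 - \<alpha>) * x = - (x / (\<alpha> - 1))" for \<alpha> x :: real
  by (simp add: minus_divide_right)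

lemma cauchy_schwarz_half:
  "cmod (\<Sum>b\<in>B. cnj (y b) * x b) \<le> (sqnorm B x + sqnorm B y) / 2"
proof -
  have "cmod (\<Sum>b\<in>B. cnj (y b) * x b) \<le> (\<Sum>b\<in>B. ((cmod (x b))\<^sup>2 + (cmod (y b))\<^sup>2) / 2)"
  proof (rule sum_norm_le)
    fix b show "cmod (cnj (y b) * x b) \<le> ((cmod (x b))\<^sup>2 + (cmod (y b))\<^sup>2) / 2"
      using sum_squares_bound[of "cmod (y b)" "cmod (x b)"] by (simp add: norm_mult)
  qed
  then show ?thesis by (simp add: sum.distrib add_divide_distrib sum_divide_distrib)
qed

section \<open>The exponentiated entropy as a greatest lower bound of Renyi traces\<close>

context
  fixes \<alpha> :: real and A :: "'a set" and B :: "'b set" and \<rho> :: "('a \<times> 'b) op"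
  assumes \<alpha>: "1 < \<alpha>" "\<alpha> < 2" and fin: "finite A" "finite B" and \<rho>: "state_on (A \<times> B) \<rho>"
begin

text \<open>The interpolation bound for the identity map: outcomes are the labels in
  \<open>A\<close>, coefficients are Kronecker deltas, and the left side becomes the trace of
  \<rho>. What results is a lower bound that does not depend on \<sigma>.\<close>

lemma renyi_trace_lower_bound:
  assumes \<sigma>: "state_on B \<sigma>" and supp: "supported_by A B \<rho> \<sigma>"
  shows "0 < renyi_trace \<alpha> A B \<rho> \<sigma>"
    and "1 \<le> 2 powr (2 / \<alpha> - 1) * sqrt (card A) powr (2 * (\<alpha> - 1) / \<alpha>) * renyi_trace \<alpha> A B \<rho> \<sigma> powr (1 / \<alpha>)"
proof -
  have card: "0 < card A" using state_on_nonempty[OF \<rho>] fin by (auto simp: card_gt_0_iff)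
  have form: "cmod (\<Sum>b\<in>B. \<Sum>b'\<in>B. cnj (y b) * op_id b b' * x b') \<le> (sqnorm B x + sqnorm B y) / 2" for x y
  proof -
    have "(\<Sum>b\<in>B. \<Sum>b'\<in>B. cnj (y b) * op_id b b' * x b') = (\<Sum>b\<in>B. cnj (y b) * x b)"
      using fin by (simp add: op_id_def if_mult_right if_mult_left cong: if_cong)
    then show ?thesis using cauchy_schwarz_half[where B = B and y = y and x = x] by simp
  qed
  note interp = decoupling_interpolation[where J = A and A = "\<lambda>j z. if j = z then 1 else 0" and w = "\<lambda>_. 1"
      and X = "\<lambda>_. op_id" and Q = "\<lambda>_. B" and L = "real (card A)" and Z = A and B = B and \<alpha> = \<alpha> and \<rho> = \<rho> and \<sigma> = \<sigma>,
      OF fin fin(1) \<alpha> \<rho> \<sigma> supp, folded renyi_trace_def]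
  show "0 < renyi_trace \<alpha> A B \<rho> \<sigma>"
    by (rule interp(1)) (use fin card form in \<open>auto simp: if_distrib[of abs] if_mult_left cong: if_cong\<close>)
  have "cmod (\<Sum>z\<in>A. \<Sum>j\<in>A. of_real (if j = z then 1 else 0) * (\<Sum>b\<in>B. \<Sum>b'\<in>B. op_id b b' * \<rho> (z, b') (z, b)))
      \<le> 2 powr (2 / \<alpha> - 1) * sqrt (card A) powr (2 * (\<alpha> - 1) / \<alpha>) * renyi_trace \<alpha> A B \<rho> \<sigma> powr (1 / \<alpha>)"
    by (rule interp(2)) (use fin card form in \<open>auto simp: if_distrib[of abs] if_mult_left cong: if_cong\<close>)
  also have "(\<Sum>z\<in>A. \<Sum>j\<in>A. of_real (if j = z then 1 else 0) * (\<Sum>b\<in>B. \<Sum>b'\<in>B. op_id b b' * \<rho> (z, b') (z, b))) = op_trace (A \<times> B) \<rho>"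
    using fin by (simp add: op_id_def op_trace_def sum_Times if_mult_left if_distrib[of of_real] cong: if_cong)
  finally show "1 \<le> 2 powr (2 / \<alpha> - 1) * sqrt (card A) powr (2 * (\<alpha> - 1) / \<alpha>) * renyi_trace \<alpha> A B \<rho> \<sigma> powr (1 / \<alpha>)"
    using \<rho> by (simp add: state_on_def)
qed

text \<open>The prefactor \<open>1 / (1 - \<alpha>)\<close> is negative, so a lower bound on the
  trace for every \<sigma> is an upper bound on the supremum.\<close>

lemma entropy_le:
  assumes K: "0 < K" "0 < T"
    and bound: "\<And>\<sigma>. state_on B \<sigma> \<Longrightarrow> supported_by A B \<rho> \<sigma> \<Longrightarrow>
       T \<le> K * renyi_trace \<alpha> A B \<rho> \<sigma> powr (1 / \<alpha>)"
  shows "sandwiched_renyi_entropy \<alpha> A B \<rho> \<le> ereal (\<alpha> / (\<alpha> - 1) * log 2 (K / T))"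
  unfolding sandwiched_renyi_entropy_def
proof (rule SUP_least)
  fix \<sigma> assume "\<sigma> \<in> {\<sigma>. state_on B \<sigma>}"
  then have \<sigma>: "state_on B \<sigma>" by simp
  show "sandwiched_renyi_rel \<alpha> A B \<rho> \<sigma> \<le> ereal (\<alpha> / (\<alpha> - 1) * log 2 (K / T))"
  proof (cases "supported_by A B \<rho> \<sigma>")
    case True
    define N where "N = renyi_trace \<alpha> A B \<rho> \<sigma>"
    have N: "0 < N" "T \<le> K * N powr (1 / \<alpha>)"
      using renyi_trace_lower_bound(1)[OF \<sigma> True] bound[OF \<sigma> True] by (auto simp: N_def)
    have "log 2 (T / K) \<le> log 2 (N powr (1 / \<alpha>))"
      using N K by (simp add: field_simps)
    also have "\<dots> = log 2 N / \<alpha>" using N by (simp add: log_powr)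
    finally have "\<alpha> * log 2 (T / K) \<le> log 2 N" using \<alpha> by (simp add: field_simps)
    moreover have "log 2 (T / K) = - log 2 (K / T)" using K by (simp add: log_divide)
    ultimately have "- log 2 N / (\<alpha> - 1) \<le> \<alpha> * log 2 (K / T) / (\<alpha> - 1)"
      using \<alpha> by (intro divide_right_mono) auto
    then have "1 / (1 - \<alpha>) * log 2 N \<le> \<alpha> / (\<alpha> - 1) * log 2 (K / T)"
      unfolding renyi_prefactor by simp
    then show ?thesis using True by (simp add: sandwiched_renyi_rel_eq N_def renyi_trace_def)
  qed (simp add: sandwiched_renyi_rel_eq)
qed

text \<open>Ensures that \<open>real_of_ereal\<close> returns the actual entropy and not the default
  0 for an infinite value.\<close>

lemma entropy_finite: "\<exists>h. sandwiched_renyi_entropy \<alpha> A B \<rho> = ereal h"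
proof -
  have "B \<noteq> {}" "A \<noteq> {}" using state_on_nonempty[OF \<rho>] by auto
  have "sandwiched_renyi_entropy \<alpha> A B \<rho> \<le>
    ereal (\<alpha> / (\<alpha> - 1) * log 2 (2 powr (2 / \<alpha> - 1) * sqrt (card A) powr (2 * (\<alpha> - 1) / \<alpha>) / 1))"
    by (rule entropy_le) (use renyi_trace_lower_bound(2) \<open>A \<noteq> {}\<close> fin in \<open>auto simp: card_gt_0_iff\<close>)
  moreover have "- \<infinity> < sandwiched_renyi_entropy \<alpha> A B \<rho>"
    unfolding sandwiched_renyi_entropy_def less_SUP_iff
    using maximally_mixed_state[OF fin(2) \<open>B \<noteq> {}\<close>]
    by (intro bexI[of _ "max_mixed B"]) (auto simp: sandwiched_renyi_rel_eq)
  ultimately show ?thesis by (cases "sandwiched_renyi_entropy \<alpha> A B \<rho>") auto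
qed

text \<open>An estimate valid for every admissible \<sigma> passes to the entropy without choosing a
  maximiser. The case \<open>T \<le> 0\<close> is separate because the logarithm of \<open>T\<close>
  is taken.\<close>

lemma le_entropy_bound:
  assumes K: "0 < K"
    and bound: "\<And>\<sigma>. state_on B \<sigma> \<Longrightarrow> supported_by A B \<rho> \<sigma> \<Longrightarrow>
       T \<le> K * renyi_trace \<alpha> A B \<rho> \<sigma> powr (1 / \<alpha>)"
  shows "T \<le> K * entropy_powr \<alpha> A B \<rho>"
proof (cases "0 < T")
  case True
  obtain h where h: "sandwiched_renyi_entropy \<alpha> A B \<rho> = ereal h" using entropy_finite by blast
  have "h \<le> \<alpha> / (\<alpha> - 1) * log 2 (K / T)"
    using entropy_le[OF K True bound] h by simp
  then have "(\<alpha> - 1) / \<alpha> * h \<le> log 2 (K / T)" using \<alpha> by (simp add: field_simps)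
  moreover have "log 2 (T / K) = - log 2 (K / T)" using K True by (simp add: log_divide)
  ultimately have "log 2 (T / K) \<le> - ((\<alpha> - 1) / \<alpha>) * h" by simp
  then have "T / K \<le> 2 powr (- ((\<alpha> - 1) / \<alpha>) * h)"
    using K True by (subst (asm) log_le_iff) auto
  then show ?thesis using K h by (simp add: field_simps)
next
  case False
  have "0 \<le> K * entropy_powr \<alpha> A B \<rho>"
    using K by simp
  then show ?thesis using False by linarith
qed

lemma powr_entropy_le:
  assumes \<sigma>: "state_on B \<sigma>" and supp: "supported_by A B \<rho> \<sigma>"
  shows "entropy_powr \<alpha> A B \<rho> \<le> renyi_trace \<alpha> A B \<rho> \<sigma> powr (1 / \<alpha>)"
proof -
  define N where "N = renyi_trace \<alpha> A B \<rho> \<sigma>"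
  have N: "0 < N" using renyi_trace_lower_bound(1)[OF assms] by (simp add: N_def)
  obtain h where h: "sandwiched_renyi_entropy \<alpha> A B \<rho> = ereal h" using entropy_finite by blast
  have "sandwiched_renyi_rel \<alpha> A B \<rho> \<sigma> \<le> sandwiched_renyi_entropy \<alpha> A B \<rho>"
    unfolding sandwiched_renyi_entropy_def using \<sigma> by (intro SUP_upper) simp
  then have "1 / (1 - \<alpha>) * log 2 N \<le> h"
    using supp h by (simp add: sandwiched_renyi_rel_eq N_def renyi_trace_def)
  then have "- log 2 N \<le> (\<alpha> - 1) * h" unfolding renyi_prefactor minus_divide_left
    using \<alpha> by (subst (asm) pos_divide_le_eq) (auto simp: mult.commute)
  then have "- ((\<alpha> - 1) * h) / \<alpha> \<le> log 2 N / \<alpha>" using \<alpha> by (intro divide_right_mono) auto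
  then have "- ((\<alpha> - 1) / \<alpha>) * h \<le> log 2 N / \<alpha>" by simp
  also have "\<dots> = log 2 (N powr (1 / \<alpha>))" using N by (simp add: log_powr)
  finally show ?thesis using N h by (subst (asm) le_log_iff) (auto simp: N_def)
qed

end

text \<open>Since no entries connect \<open>W\<close> with its complement, the form of \<rho> splits
  into two nonnegative parts. Dropping the part outside \<open>W\<close> shows that the conditional
  state is dominated by \<rho> divided by the probability.\<close>

lemma cond_state_state:
  assumes "finite I" "state_on I \<rho>" "0 < event_prob I \<rho> W"
    and block: "\<And>p q. p \<in> I \<Longrightarrow> q \<in> I \<Longrightarrow> p \<in> W \<Longrightarrow> q \<notin> W \<Longrightarrow> \<rho> p q = 0"
  shows "quad_form I (cond_state I \<rho> W) v = quad_form I \<rho> (\<lambda>i. if i \<in> W then v i else 0) / of_real (event_prob I \<rho> W)"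
    and "Re (quad_form I (cond_state I \<rho> W) v) \<le> 1 / event_prob I \<rho> W * Re (quad_form I \<rho> v)"
    and "state_on I (cond_state I \<rho> W)"
    and "op_supp I (cond_state I \<rho> W) \<subseteq> op_supp I \<rho>"
proof -
  have psd: "op_psd I \<rho>" using assms by (simp add: state_on_def)
  have block': "\<rho> p q = 0" if "p \<in> I" "q \<in> I" "p \<notin> W" "q \<in> W" for p q
    using psd_hermitian[OF assms(1) psd, of q p] block[of q p] that by simp
  show eq: "quad_form I (cond_state I \<rho> W) v = quad_form I \<rho> (\<lambda>i. if i \<in> W then v i else 0) / of_real (event_prob I \<rho> W)" for v
    unfolding quad_form_def sum_divide_distrib cond_state_def by (intro sum.cong refl) auto
  have split: "quad_form I \<rho> v = quad_form I \<rho> (\<lambda>i. if i \<in> W then v i else 0) + quad_form I \<rho> (\<lambda>i. if i \<in> W then 0 else v i)" for v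
    unfolding quad_form_def sum.distrib[symmetric]
    by (intro sum.cong refl) (use block block' in auto)
  show "Re (quad_form I (cond_state I \<rho> W) v) \<le> 1 / event_prob I \<rho> W * Re (quad_form I \<rho> v)"
    unfolding eq Re_divide_of_real split[of v] using quad_form_nonneg[OF psd] assms(3) by (simp add: divide_right_mono)
  have "op_psd I (cond_state I \<rho> W)"
    using psd assms(3) unfolding op_psd_iff eq by (simp add: complex_nonneg_Reals_iff Re_divide_of_real Im_divide_of_real)
  moreover have "op_trace I (cond_state I \<rho> W) = 1"
  proof -
    have "op_trace I (cond_state I \<rho> W) = (\<Sum>i\<in>I. if i \<in> W then \<rho> i i else 0) / of_real (event_prob I \<rho> W)"
      unfolding op_trace_def sum_divide_distrib cond_state_def by (intro sum.cong refl) auto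
    also have "(\<Sum>i\<in>I. if i \<in> W then \<rho> i i else 0) = (\<Sum>i\<in>I \<inter> W. \<rho> i i)"
      using assms(1) by (simp add: sum.If_cases)
    also have "\<dots> = of_real (event_prob I \<rho> W)"
    proof -
      have "Im (\<rho> i i) = 0" if "i \<in> I" for i
        using psd_hermitian[OF assms(1) psd that that] by (simp add: complex_eq_iff)
      then show ?thesis by (simp add: event_prob_def complex_eq_iff Im_sum)
    qed
    finally show ?thesis using assms(3) by simp
  qed
  ultimately show "state_on I (cond_state I \<rho> W)" by (simp add: state_on_def)
  have "op_apply I (cond_state I \<rho> W) w i = (if i \<in> W then op_apply I \<rho> w i / of_real (event_prob I \<rho> W) else 0)"
    if "i \<in> I" for w i
    unfolding op_apply_def cond_state_def using that block
    by (auto simp: sum_divide_distrib intro!: sum.cong sum.neutral)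
  then show "op_supp I (cond_state I \<rho> W) \<subseteq> op_supp I \<rho>"
    unfolding op_supp_def by auto
qed

text \<open>For each \<sigma>, the domination costs a factor \<open>(1 / P) powr \<alpha>\<close> in
  the trace, hence \<open>1 / P\<close> after the root. Every \<sigma> that supports \<rho> also
  supports the conditional state, so the comparison is made with the same \<sigma>.\<close>

lemma entropy_cond_bound:
  assumes \<alpha>: "1 < \<alpha>" "\<alpha> < 2" and fin: "finite A" "finite B" and \<rho>: "state_on (A \<times> B) \<rho>"
    and p: "0 < event_prob (A \<times> B) \<rho> W"
    and block: "\<And>p q. p \<in> A \<times> B \<Longrightarrow> q \<in> A \<times> B \<Longrightarrow> p \<in> W \<Longrightarrow> q \<notin> W \<Longrightarrow> \<rho> p q = 0"
  shows "event_prob (A \<times> B) \<rho> W *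
      entropy_powr \<alpha> A B (cond_state (A \<times> B) \<rho> W)
    \<le> entropy_powr \<alpha> A B \<rho>"
proof -
  define P where "P = event_prob (A \<times> B) \<rho> W"
  define \<rho>' where "\<rho>' = cond_state (A \<times> B) \<rho> W"
  have finAB: "finite (A \<times> B)" using fin by simp
  note cond = cond_state_state[OF finAB \<rho> p block, folded \<rho>'_def P_def]
  have "P * entropy_powr \<alpha> A B \<rho>'
    \<le> 1 * entropy_powr \<alpha> A B \<rho>"
  proof (rule le_entropy_bound[OF \<alpha> fin \<rho>])
    fix \<sigma> assume \<sigma>: "state_on B \<sigma>" and supp: "supported_by A B \<rho> \<sigma>"
    have psd: "op_psd B \<sigma>" "op_psd (A \<times> B) \<rho>" "op_psd (A \<times> B) \<rho>'" using \<sigma> \<rho> cond(3) by (auto simp: state_on_def)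
    have "renyi_trace \<alpha> A B \<rho>' \<sigma> \<le> (1 / P) powr \<alpha> * renyi_trace \<alpha> A B \<rho> \<sigma>"
      unfolding renyi_trace_def
    proof (rule trace_powr_mono[OF finAB _ _ \<alpha>(1)])
      show "0 \<le> 1 / P" using p by (simp add: P_def)
      show "Re (quad_form (A \<times> B) (sandwich r A B \<rho>' \<sigma>) v) \<le> 1 / P * Re (quad_form (A \<times> B) (sandwich r A B \<rho> \<sigma>) v)" for r v
        unfolding quad_form_sandwich[OF fin(2) psd(1)] by (rule cond(2))
    qed (intro sandwich_psd fin psd)+
    moreover have "0 < renyi_trace \<alpha> A B \<rho>' \<sigma>" "0 < renyi_trace \<alpha> A B \<rho> \<sigma>"
      using renyi_trace_lower_bound(1)[OF \<alpha> fin \<rho> \<sigma> supp] renyi_trace_lower_bound(1)[OF \<alpha> fin cond(3) \<sigma>] cond(4) supp by auto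
    ultimately have "renyi_trace \<alpha> A B \<rho>' \<sigma> powr (1 / \<alpha>) \<le> ((1 / P) powr \<alpha> * renyi_trace \<alpha> A B \<rho> \<sigma>) powr (1 / \<alpha>)"
      using \<alpha> by (intro powr_mono2) auto
    also have "\<dots> = renyi_trace \<alpha> A B \<rho> \<sigma> powr (1 / \<alpha>) / P"
      using p \<alpha> \<open>0 < renyi_trace \<alpha> A B \<rho> \<sigma>\<close> by (simp add: powr_mult powr_powr P_def)
    finally have "P * renyi_trace \<alpha> A B \<rho>' \<sigma> powr (1 / \<alpha>) \<le> renyi_trace \<alpha> A B \<rho> \<sigma> powr (1 / \<alpha>)"
      using p by (simp add: P_def field_simps)
    moreover have "P * entropy_powr \<alpha> A B \<rho>' \<le> P * renyi_trace \<alpha> A B \<rho>' \<sigma> powr (1 / \<alpha>)"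
      using powr_entropy_le[OF \<alpha> fin cond(3) \<sigma>] cond(4) supp p by (intro mult_left_mono) (auto simp: P_def)
    ultimately show "P * entropy_powr \<alpha> A B \<rho>' \<le> 1 * renyi_trace \<alpha> A B \<rho> \<sigma> powr (1 / \<alpha>)"
      by simp
  qed simp
  then show ?thesis by (simp add: P_def \<rho>'_def)
qed

text \<open>The diagonal entry is a sum of terms \<open>d k * (cmod (U i k))^2\<close>; if it
  vanishes, each term does, and the whole row of \<open>M\<close> is 0.\<close>

lemma psd_zero_diag:
  assumes "finite I" "op_psd I M" "i \<in> I" "j \<in> I" "M i i = 0"
  shows "M i j = 0"
proof -
  obtain U d where U: "spectral_data I M U d" using psd_spectral[OF assms(1,2)] by blast
  have "M i i = of_real (\<Sum>k\<in>I. d k * (cmod (U i k))\<^sup>2)"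
    unfolding spectralD(4)[OF U assms(3,3)] of_real_sum of_real_mult complex_norm_square by (simp add: mult_ac)
  then have "(\<Sum>k\<in>I. d k * (cmod (U i k))\<^sup>2) = 0" using assms(5) by (metis of_real_eq_0_iff)
  then have "\<forall>k\<in>I. d k * (cmod (U i k))\<^sup>2 = 0"
    using assms(1) spectralD(3)[OF U] by (subst (asm) sum_nonneg_eq_0_iff) auto
  then show ?thesis unfolding spectralD(4)[OF U assms(3,4)] by (intro sum.neutral) auto
qed

lemma psd_diag_nonneg:
  assumes "finite I" "op_psd I M" "i \<in> I"
  shows "0 \<le> Re (M i i)" "Im (M i i) = 0"
proof -
  show "Im (M i i) = 0" using psd_hermitian[OF assms(1,2,3,3)] by (simp add: complex_eq_iff)
  have "quad_form I M (\<lambda>k. if k = i then 1 else 0) = M i i"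
    using assms by (simp add: quad_form_def if_distrib[of cnj] if_mults cong: if_cong)
  then show "0 \<le> Re (M i i)" using quad_form_nonneg[OF assms(2)] by metis
qed

subsection \<open>Two-universal hashing\<close>

lemma finite_bits [simp]: "finite (bits l)" and card_bits: "card (bits l) = 2 ^ l"
  using finite_lists_length_eq[of "UNIV :: bool set" l] card_lists_length_eq[of "UNIV :: bool set" l]
  by (auto simp: bits_def)

lemma finite_bits_upto [simp]: "finite (bits_upto n)"
  using finite_lists_length_le[of "UNIV :: bool set" n] by (simp add: bits_upto_def)

text \<open>Finiteness, on which \<open>pmf_of_set\<close> relies, holds because there are only
  finitely many partial maps from \<open>bits i\<close> to \<open>bits l\<close>.\<close>

lemma two_universalD:
  assumes "two_universal i l F"
  shows "finite F" "F \<noteq> {}" "f \<in> F \<Longrightarrow> dom f = bits i"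
    and "f \<in> F \<Longrightarrow> z \<in> bits i \<Longrightarrow> \<exists>k\<in>bits l. f z = Some k"
proof -
  have F: "F \<noteq> {}" "\<And>f. f \<in> F \<Longrightarrow> dom f = bits i" "\<And>f. f \<in> F \<Longrightarrow> ran f \<subseteq> bits l"
    using assms by (auto simp: two_universal_def)
  have "finite {m. dom m = bits i \<and> ran m \<subseteq> bits l}"
    by (rule finite_set_of_finite_maps) auto
  moreover have "F \<subseteq> {m. dom m = bits i \<and> ran m \<subseteq> bits l}" using F by auto
  ultimately show "finite F" using finite_subset by blast
  show "F \<noteq> {}" "f \<in> F \<Longrightarrow> dom f = bits i" using F by auto
  show "\<exists>k\<in>bits l. f z = Some k" if "f \<in> F" "z \<in> bits i"
  proof -
    have "z \<in> dom f" using F that by simp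
    then obtain k where k: "f z = Some k" by auto
    then have "k \<in> bits l" using F(3)[OF that(1)] by (auto simp: ran_def)
    with k show ?thesis by blast
  qed
qed

text \<open>The domain of a partial map reveals the input length, so the families for different
  lengths are disjoint.\<close>

lemma two_universal_length_unique:
  assumes "two_universal i l F" "two_universal i' l F'" "f \<in> F" "f \<in> F'"
  shows "i = i'"
proof -
  have "bits i = bits i'" using two_universalD(3)[OF assms(1,3)] two_universalD(3)[OF assms(2,4)] by simp
  moreover have "replicate i True \<in> bits i" by (simp add: bits_def)
  ultimately show ?thesis by (simp add: bits_def)
qed

abbreviation hash_labels :: "nat \<Rightarrow> nat \<Rightarrow> (nat \<Rightarrow> hash_fun set) \<Rightarrow> 'c set \<Rightarrow> 'e set \<Rightarrow> (bool list \<times> ('c \<times> hash_fun) \<times> 'e) set" where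
  "hash_labels n l F C E \<equiv> bits l \<times> (C \<times> hash_register n F) \<times> E"

text \<open>The kernel of the hashing channel minus the ideal channel: the coefficient with which
  the block of \<rho> at \<open>z\<close> enters the output block at \<open>(k, f)\<close>.\<close>

definition hash_coeff :: "(nat \<Rightarrow> hash_fun set) \<Rightarrow> nat \<Rightarrow> bool list \<times> hash_fun \<Rightarrow> bool list \<Rightarrow> real" where
  "hash_coeff F l = (\<lambda>(k, f) z. if f \<in> F (length z)
     then ((if f z = Some k then 1 else 0) - 1 / 2 ^ l) / real (card (F (length z))) else 0)"

text \<open>The probability of \<open>f\<close> given its input length. That length is unique under
  two-universality, so for \<open>f\<close> in the register the sum has one term; this form avoids
  choosing the length.\<close>

definition hash_weight :: "nat \<Rightarrow> (nat \<Rightarrow> hash_fun set) \<Rightarrow> hash_fun \<Rightarrow> real" where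
  "hash_weight n F f = (\<Sum>i | i \<le> n \<and> f \<in> F i. 1 / real (card (F i)))"

context
  fixes n l :: nat and F :: "nat \<Rightarrow> hash_fun set"
  assumes univ: "\<And>i. i \<le> n \<Longrightarrow> two_universal i l (F i)"
begin

lemma hash_card_pos: "i \<le> n \<Longrightarrow> 0 < card (F i)"
  using two_universalD(1,2)[OF univ] by (auto simp: card_gt_0_iff)

lemma hash_weight_eq:
  assumes "i \<le> n" "f \<in> F i"
  shows "hash_weight n F f = 1 / real (card (F i))"
proof -
  have "{j. j \<le> n \<and> f \<in> F j} = {i}"
    using two_universal_length_unique[OF univ univ] assms by blast
  then show ?thesis by (simp add: hash_weight_def)
qed

lemma finite_hash_register: "finite (hash_register n F)"
  unfolding hash_register_def using two_universalD(1)[OF univ] by blast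

lemma sum_hash_register:
  assumes "i \<le> n"
  shows "(\<Sum>f\<in>hash_register n F. if f \<in> F i then g f else 0) = (\<Sum>f\<in>F i. g f)"
proof -
  have "hash_register n F \<inter> F i = F i" using assms by (auto simp: hash_register_def)
  then show ?thesis using finite_hash_register by (simp add: sum.If_cases)
qed

lemma sum_hash_output:
  assumes "i \<le> n" "f \<in> F i" "z \<in> bits i"
  shows "(\<Sum>k\<in>bits l. if f z = Some k then 1 else 0) = (1 :: 'a :: semiring_1)"
proof -
  obtain k0 where "k0 \<in> bits l" "f z = Some k0" using two_universalD(4)[OF univ[OF assms(1)] assms(2,3)] by blast
  then show ?thesis by simp
qed

text \<open>Averaged over \<open>f\<close>, the actual output contributes 1 and the uniform
  distribution another 1; this is the constant 2 on the left edge.\<close>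

lemma hash_coeff_sum_abs:
  assumes "z \<in> bits_upto n"
  shows "(\<Sum>j\<in>bits l \<times> hash_register n F. \<bar>hash_coeff F l j z\<bar>) \<le> 2"
proof -
  define i where "i = length z"
  have i: "i \<le> n" "z \<in> bits i" using assms by (auto simp: i_def bits_def bits_upto_def)
  have "(\<Sum>j\<in>bits l \<times> hash_register n F. \<bar>hash_coeff F l j z\<bar>) =
     (\<Sum>f\<in>hash_register n F. \<Sum>k\<in>bits l. \<bar>hash_coeff F l (k, f) z\<bar>)"
    unfolding sum_Times by (rule sum.swap)
  also have "\<dots> \<le> (\<Sum>f\<in>hash_register n F. if f \<in> F i then 2 / real (card (F i)) else 0)"
  proof (rule sum_mono)
    fix f assume "f \<in> hash_register n F"
    show "(\<Sum>k\<in>bits l. \<bar>hash_coeff F l (k, f) z\<bar>) \<le> (if f \<in> F i then 2 / real (card (F i)) else 0)"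
    proof (cases "f \<in> F i")
      case True
      have "(\<Sum>k\<in>bits l. \<bar>hash_coeff F l (k, f) z\<bar>) \<le> (\<Sum>k\<in>bits l. ((if f z = Some k then 1 else 0) + 1 / 2 ^ l) / real (card (F i)))"
        using True by (intro sum_mono) (auto simp: hash_coeff_def i_def[symmetric] abs_divide intro!: divide_right_mono)
      also have "\<dots> = ((\<Sum>k\<in>bits l. if f z = Some k then 1 else 0) + (\<Sum>k\<in>bits l. 1 / 2 ^ l)) / real (card (F i))"
        by (simp only: sum.distrib sum_divide_distrib add_divide_distrib)
      also have "\<dots> = 2 / real (card (F i))"
        unfolding sum_hash_output[OF i(1) True i(2)] by (simp add: card_bits)
      finally show ?thesis using True by simp
    qed (simp add: hash_coeff_def i_def)
  qed
  also have "\<dots> = 2" unfolding sum_hash_register[OF i(1)] using hash_card_pos[OF i(1)] by simp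
  finally show ?thesis .
qed

text \<open>For equal lengths the sum is the collision probability minus \<open>2^-l\<close>, hence
  at most 0 for distinct strings by two-universality. For different lengths it is 0, as no function
  accepts both strings; so two-universality within each length suffices.\<close>

lemma hash_coeff_collision:
  assumes z: "z \<in> bits_upto n" "z' \<in> bits_upto n"
  shows "(\<Sum>j\<in>bits l \<times> hash_register n F. hash_coeff F l j z * hash_coeff F l j z' / hash_weight n F (snd j)) \<le> (if z = z' then 1 else 0)"
proof (cases "length z = length z'")
  case False
  have "hash_coeff F l j z * hash_coeff F l j z' = 0" for j
  proof -
    have "length z \<le> n" "length z' \<le> n" using z by (simp_all add: bits_upto_def)
    then have "\<not> (snd j \<in> F (length z) \<and> snd j \<in> F (length z'))"
      using False two_universal_length_unique[OF univ[of "length z"] univ[of "length z'"]] by blast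
    moreover have "hash_coeff F l j y = 0" if "snd j \<notin> F (length y)" for y
      using that by (simp add: hash_coeff_def case_prod_unfold)
    ultimately show ?thesis by (cases "snd j \<in> F (length z)") simp_all
  qed
  then show ?thesis by (simp only: div_0 sum.neutral_const) simp
next
  case True
  define i where "i = length z"
  have i: "i \<le> n" "z \<in> bits i" "z' \<in> bits i" "length z = i" "length z' = i" using z True by (auto simp: i_def bits_def bits_upto_def)
  define q :: real where "q = 1 / 2 ^ l"
  let ?P = "measure_pmf.prob (pmf_of_set (F i)) {f. f z = f z'}"
  have card: "0 < card (F i)" using hash_card_pos[OF i(1)] .
  have "(\<Sum>j\<in>bits l \<times> hash_register n F. hash_coeff F l j z * hash_coeff F l j z' / hash_weight n F (snd j)) =
     (\<Sum>f\<in>hash_register n F. \<Sum>k\<in>bits l. hash_coeff F l (k, f) z * hash_coeff F l (k, f) z' / hash_weight n F f)"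
    unfolding sum_Times by (subst sum.swap) simp
  also have "\<dots> = (\<Sum>f\<in>hash_register n F. if f \<in> F i then ((if f z = f z' then 1 else 0) - q) / real (card (F i)) else 0)"
  proof (rule sum.cong[OF refl])
    fix f
    show "(\<Sum>k\<in>bits l. hash_coeff F l (k, f) z * hash_coeff F l (k, f) z' / hash_weight n F f) =
       (if f \<in> F i then ((if f z = f z' then 1 else 0) - q) / real (card (F i)) else 0)"
    proof (cases "f \<in> F i")
      case True
      obtain k1 k2 where k: "k1 \<in> bits l" "f z = Some k1" "k2 \<in> bits l" "f z' = Some k2"
        using two_universalD(4)[OF univ[OF i(1)] True i(2)] two_universalD(4)[OF univ[OF i(1)] True i(3)] by blast
      have "(\<Sum>k\<in>bits l. hash_coeff F l (k, f) z * hash_coeff F l (k, f) z' / hash_weight n F f) =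
        (\<Sum>k\<in>bits l. (if k = k1 then (if k = k2 then 1 else 0) else 0) - q * (if k = k1 then 1 else 0) - q * (if k = k2 then 1 else 0) + q * q) / real (card (F i))"
        unfolding sum_divide_distrib using True k card
        by (intro sum.cong refl) (auto simp: hash_coeff_def hash_weight_eq[OF i(1) True] i q_def[symmetric] field_simps)
      also have "(\<Sum>k\<in>bits l. (if k = k1 then (if k = k2 then 1 else 0) else 0) - q * (if k = k1 then 1 else 0) - q * (if k = k2 then 1 else 0) + q * q) =
         (if k1 = k2 then 1 else 0) - q - q + 2 ^ l * (q * q)"
        using k by (simp add: sum.distrib sum_subtractf card_bits flip: sum_distrib_left)
      also have "2 ^ l * (q * q) = q" by (simp add: q_def)
      finally show ?thesis using True k by simp
    qed (simp add: hash_coeff_def i)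
  qed
  also have "\<dots> = (\<Sum>f\<in>F i. ((if f z = f z' then 1 else 0) - q) / real (card (F i)))"
    by (rule sum_hash_register[OF i(1)])
  also have "\<dots> = real (card (F i \<inter> {f. f z = f z'})) / real (card (F i)) - q"
  proof -
    have "(\<Sum>f\<in>F i. if f z = f z' then 1 else 0 :: real) = real (card (F i \<inter> {f. f z = f z'}))"
      using two_universalD(1)[OF univ[OF i(1)]] by (simp add: sum.If_cases)
    then show ?thesis using card by (simp add: sum_subtractf diff_divide_distrib flip: sum_divide_distrib)
  qed
  also have "real (card (F i \<inter> {f. f z = f z'})) / real (card (F i)) = ?P"
    using two_universalD(1,2)[OF univ[OF i(1)]] by (simp add: measure_pmf_of_set Int_commute)
  also have "\<dots> - q \<le> (if z = z' then 1 else 0)"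
  proof (cases "z = z'")
    case True
    have "0 \<le> q" by (simp add: q_def)
    moreover have "?P \<le> 1" by (rule measure_pmf.prob_le_1)
    ultimately have "?P - q \<le> 1" by linarith
    then show ?thesis unfolding if_P[OF True] .
  next
    case False
    then have "?P \<le> 2 powr (- real l)"
      using univ[OF i(1)] i(2,3) unfolding two_universal_def by blast
    also have "\<dots> = q" by (simp add: q_def powr_minus powr_realpow inverse_eq_divide)
    finally show ?thesis unfolding if_not_P[OF False] by simp
  qed
  finally show ?thesis .
qed

text \<open>The functions of one length have total probability 1, and every output string counts
  them once. The condition \<open>i \<le> n\<close> stands inside the set because \<open>F\<close>
  is controlled only up to \<open>n\<close>; beyond that the sum is empty.\<close>

lemma hash_weight_total:
  "(\<Sum>j | j \<in> bits l \<times> hash_register n F \<and> i \<le> n \<and> snd j \<in> F i. hash_weight n F (snd j)) \<le> 2 ^ l"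
proof (cases "i \<le> n")
  case True
  have "(\<Sum>j | j \<in> bits l \<times> hash_register n F \<and> i \<le> n \<and> snd j \<in> F i. hash_weight n F (snd j)) =
    (\<Sum>j\<in>bits l \<times> hash_register n F. if snd j \<in> F i then hash_weight n F (snd j) else 0)"
    using True finite_hash_register by (simp add: sum.If_cases Int_def)
  also have "\<dots> = (\<Sum>k\<in>bits l. \<Sum>f\<in>F i. hash_weight n F f)"
    unfolding sum_Times by (simp add: sum_hash_register[OF True])
  also have "(\<Sum>f\<in>F i. hash_weight n F f) = 1"
    using hash_card_pos[OF True] by (simp add: hash_weight_eq[OF True])
  finally show ?thesis by (simp add: card_bits)
qed simp

end

lemma sum_fibre:
  assumes "finite K" "finite C" "finite R" "finite E" and "k \<in> K" "c \<in> C" "f \<in> R"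
    and "\<And>k' c' f' e. (k', (c', f'), e) \<noteq> (k, (c, f), e) \<Longrightarrow> h (k', (c', f'), e) = 0"
  shows "(\<Sum>p\<in>K \<times> (C \<times> R) \<times> E. h p) = (\<Sum>e\<in>E. h (k, (c, f), e))"
proof -
  have "(\<Sum>p\<in>K \<times> (C \<times> R) \<times> E. h p) = (\<Sum>p\<in>(\<lambda>e. (k, (c, f), e)) ` E. h p)"
  proof (rule sum.mono_neutral_right)
    show "\<forall>p\<in>K \<times> (C \<times> R) \<times> E - (\<lambda>e. (k, (c, f), e)) ` E. h p = 0"
    proof
      fix p assume p: "p \<in> K \<times> (C \<times> R) \<times> E - (\<lambda>e. (k, (c, f), e)) ` E"
      obtain k' c' f' e where "p = (k', (c', f'), e)" by (metis prod.collapse)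
      then show "h p = 0" using p assms(8)[of k' c' f' e] by auto
    qed
  qed (use assms in auto)
  then show ?thesis by (simp add: sum.reindex inj_on_def)
qed

text \<open>Only the blocks of the dual contraction that are diagonal in \<open>k\<close>,
  \<open>c\<close> and \<open>f\<close> meet \<open>M\<close>. For each \<open>(k, f)\<close> they
  form an operator on \<open>C \<times> E\<close>, cut down to those \<open>c\<close> whose length
  \<open>f\<close> accepts. This cut keeps the total weight at a label at \<open>2 ^ l\<close>,
  instead of a multiple counting the possible lengths.\<close>

lemma hash_trace_norm_bound:
  fixes \<rho> :: "(bool list \<times> 'c \<times> 'e) op" and M :: "(bool list \<times> ('c \<times> hash_fun) \<times> 'e) op"
  assumes univ: "\<And>i. i \<le> n \<Longrightarrow> two_universal i l (F i)"
    and \<alpha>: "1 < \<alpha>" "\<alpha> < 2" and fin: "finite C" "finite E"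
    and \<rho>: "state_on (bits_upto n \<times> C \<times> E) \<rho>" and \<sigma>: "state_on (C \<times> E) \<sigma>"
    and supp: "supported_by (bits_upto n) (C \<times> E) \<rho> \<sigma>"
    and classical: "\<And>z c e c' e'. z \<in> bits_upto n \<Longrightarrow> c \<in> C \<Longrightarrow> c' \<in> C \<Longrightarrow> e \<in> E \<Longrightarrow> e' \<in> E \<Longrightarrow> c \<noteq> c' \<Longrightarrow> \<rho> (z, c, e) (z, c', e') = 0"
    and len: "\<And>z c e e'. z \<in> bits_upto n \<Longrightarrow> c \<in> C \<Longrightarrow> e \<in> E \<Longrightarrow> e' \<in> E \<Longrightarrow> length z \<noteq> len_of c \<Longrightarrow> \<rho> (z, c, e) (z, c, e') = 0"
    and M: "\<And>k c f e k' c' f' e'. (k, (c, f), e) \<in> hash_labels n l F C E \<Longrightarrow>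
       (k', (c', f'), e') \<in> hash_labels n l F C E \<Longrightarrow>
       M (k, (c, f), e) (k', (c', f'), e') =
         (if k = k' \<and> f = f' then \<Sum>z\<in>bits_upto n. of_real (hash_coeff F l (k, f) z) * \<rho> (z, c, e) (z, c', e') else 0)"
  shows "trace_norm (hash_labels n l F C E) M \<le>
     2 powr (2 / \<alpha> - 1) * sqrt (2 ^ l) powr (2 * (\<alpha> - 1) / \<alpha>) * renyi_trace \<alpha> (bits_upto n) (C \<times> E) \<rho> \<sigma> powr (1 / \<alpha>)"
proof -
  define R where "R = hash_register n F"
  have finR: "finite R" unfolding R_def by (rule finite_hash_register[OF univ])
  define I where "I = bits l \<times> (C \<times> R) \<times> E"
  have finI: "finite I" using fin finR by (simp add: I_def)
  from trace_norm_dual[OF finI, of M] obtain X where X': "\<forall>x y. cmod (\<Sum>i\<in>I. \<Sum>j\<in>I. cnj (y i) * X i j * x j) \<le>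
      (sqnorm I x + sqnorm I y) / 2"
    and tn: "trace_norm I M = Re (\<Sum>i\<in>I. \<Sum>j\<in>I. X i j * M j i)"
    by (elim exE conjE)
  note X = X'[rule_format]
  \<comment> \<open>A value \<open>len_of c > n\<close> is possible, but then every entry of \<rho>
    at \<open>c\<close> vanishes by \<open>len\<close>; the first conjunct removes such labels
    because \<open>F\<close> is arbitrary there.\<close>
  define ok where "ok = (\<lambda>c f. len_of c \<le> n \<and> f \<in> F (len_of c))"
  define Q where "Q = (\<lambda>j :: bool list \<times> hash_fun. {b \<in> C \<times> E. ok (fst b) (snd j)})"
  define Xj where "Xj = (\<lambda>j b b'. if fst b = fst b' \<and> ok (fst b) (snd j)
     then X (fst j, (fst b, snd j), snd b) (fst j, (fst b', snd j), snd b') else 0)"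
  let ?S = "(\<Sum>z\<in>bits_upto n. \<Sum>j\<in>bits l \<times> R. of_real (hash_coeff F l j z) * (\<Sum>b\<in>C \<times> E. \<Sum>b'\<in>C \<times> E. Xj j b b' * \<rho> (z, b') (z, b)))"
  \<comment> \<open>A diagonal block of a contraction is one too: vectors on \<open>E\<close> are
    padded with zeros to vectors on the full output register.\<close>
  have block: "cmod (\<Sum>e\<in>E. \<Sum>e'\<in>E. cnj (y e) * X (k, (c, f), e) (k, (c, f), e') * x e') \<le>
     (sqnorm E x + sqnorm E y) / 2"
    if kcf: "k \<in> bits l" "c \<in> C" "f \<in> R" for k c f x y
  proof -
    define lift where "lift = (\<lambda>v :: 'e \<Rightarrow> complex. \<lambda>(k', (c', f'), e). if k' = k \<and> c' = c \<and> f' = f then v e else 0)"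
    note fib = sum_fibre[OF finite_bits fin(1) finR fin(2) kcf, folded I_def]
    have n: "sqnorm I (lift v) = sqnorm E v" for v
      by (subst fib) (auto simp: lift_def)
    have "(\<Sum>i\<in>I. \<Sum>j\<in>I. cnj (lift y i) * X i j * lift x j) = (\<Sum>e\<in>E. \<Sum>e'\<in>E. cnj (y e) * X (k, (c, f), e) (k, (c, f), e') * x e')"
    proof -
      have "(\<Sum>j\<in>I. cnj (lift y i) * X i j * lift x j) = (\<Sum>e'\<in>E. cnj (lift y i) * X i (k, (c, f), e') * x e')" for i
        by (subst fib) (auto simp: lift_def)
      then show ?thesis by (simp, subst fib) (auto simp: lift_def)
    qed
    then show ?thesis using X[of "lift y" "lift x"] unfolding n by simp
  qed
  have bound: "cmod ?S
       \<le> 2 powr (2 / \<alpha> - 1) * sqrt (2 ^ l) powr (2 * (\<alpha> - 1) / \<alpha>) * renyi_trace \<alpha> (bits_upto n) (C \<times> E) \<rho> \<sigma> powr (1 / \<alpha>)"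
    unfolding renyi_trace_def
  proof (rule decoupling_interpolation(2)[where Q = Q and w = "\<lambda>j. hash_weight n F (snd j)"])
    show "Q j \<subseteq> C \<times> E" for j by (auto simp: Q_def)
    show "(\<Sum>j\<in>bits l \<times> R. \<bar>hash_coeff F l j z\<bar>) \<le> 2" if "z \<in> bits_upto n" for z
      unfolding R_def by (rule hash_coeff_sum_abs[OF univ that])
    show "(\<Sum>j\<in>bits l \<times> R. hash_coeff F l j z * hash_coeff F l j z' / hash_weight n F (snd j)) \<le> (if z = z' then 1 else 0)"
      if "z \<in> bits_upto n" "z' \<in> bits_upto n" for z z'
      unfolding R_def by (rule hash_coeff_collision[OF univ that])
    show "0 < hash_weight n F (snd j)" if "j \<in> bits l \<times> R" for j
    proof -
      have "snd j \<in> hash_register n F" using that by (auto simp: R_def)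
      then obtain i where "i \<le> n" "snd j \<in> F i" by (auto simp: hash_register_def)
      then show ?thesis using hash_weight_eq[OF univ] hash_card_pos[OF univ] by simp
    qed
    show "(\<Sum>j | j \<in> bits l \<times> R \<and> b \<in> Q j. hash_weight n F (snd j)) \<le> 2 ^ l" if "b \<in> C \<times> E" for b
    proof -
      have "{j. j \<in> bits l \<times> R \<and> b \<in> Q j} = {j. j \<in> bits l \<times> hash_register n F \<and> len_of (fst b) \<le> n \<and> snd j \<in> F (len_of (fst b))}"
        using that by (auto simp: Q_def R_def ok_def)
      then show ?thesis using hash_weight_total[where n = n and i = "len_of (fst b)", OF univ] by simp
    qed
  next
    fix j x y assume j: "j \<in> bits l \<times> R"
    define k f where "k = fst j" and "f = snd j"
    have kf: "k \<in> bits l" "f \<in> R" using j by (auto simp: k_def f_def)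
    define C' where "C' = {c\<in>C. ok c f}"
    have Q: "Q j = C' \<times> E" by (auto simp: Q_def C'_def f_def)
    have "(\<Sum>b\<in>C \<times> E. \<Sum>b'\<in>C \<times> E. cnj (y b) * Xj j b b' * x b') =
       (\<Sum>c\<in>C. \<Sum>e\<in>E. \<Sum>c'\<in>C. if c = c' then (\<Sum>e'\<in>E. if ok c f then cnj (y (c, e)) * X (k, (c, f), e) (k, (c, f), e') * x (c, e') else 0) else 0)"
      unfolding sum_Times by (intro sum.cong refl) (auto simp: Xj_def k_def f_def intro!: sum.cong cong: if_cong)
    also have "\<dots> = (\<Sum>c\<in>C. if ok c f then (\<Sum>e\<in>E. \<Sum>e'\<in>E. cnj (y (c, e)) * X (k, (c, f), e) (k, (c, f), e') * x (c, e')) else 0)"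
      using fin by (intro sum.cong refl) simp
    also have "\<dots> = (\<Sum>c\<in>C'. \<Sum>e\<in>E. \<Sum>e'\<in>E. cnj (y (c, e)) * X (k, (c, f), e) (k, (c, f), e') * x (c, e'))"
      using fin by (simp add: sum.If_cases C'_def Int_def)
    also have "cmod \<dots> \<le> (\<Sum>c\<in>C'. ((\<Sum>e\<in>E. (cmod (x (c, e)))\<^sup>2) + (\<Sum>e\<in>E. (cmod (y (c, e)))\<^sup>2)) / 2)"
      by (intro sum_norm_le block kf) (simp add: C'_def)
    also have "\<dots> = (sqnorm (Q j) x + sqnorm (Q j) y) / 2"
      unfolding Q sum_Times by (simp add: sum.distrib sum_divide_distrib add_divide_distrib)
    finally show "cmod (\<Sum>b\<in>C \<times> E. \<Sum>b'\<in>C \<times> E. cnj (y b) * Xj j b b' * x b') \<le>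
        (sqnorm (Q j) x + sqnorm (Q j) y) / 2" .
  qed (use fin finR \<alpha> \<rho> \<sigma> supp in auto)
  have "(\<Sum>i\<in>I. \<Sum>j\<in>I. X i j * M j i) = ?S"
  proof -
    define t where "t = (\<lambda>k c f e e' z. X (k, (c, f), e) (k, (c, f), e') * (of_real (hash_coeff F l (k, f) z) * \<rho> (z, c, e') (z, c, e)))"
    let ?g = "\<lambda>z k f c e e'. of_real (hash_coeff F l (k, f) z) * (Xj (k, f) (c, e) (c, e') * \<rho> (z, c, e') (z, c, e))"
    have "(\<Sum>j\<in>I. X i j * M j i) = (\<Sum>e'\<in>E. \<Sum>z\<in>bits_upto n. t (fst i) (fst (fst (snd i))) (snd (fst (snd i))) (snd (snd i)) e' z)" if "i \<in> I" for i
    proof -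
      obtain k c f e where i: "i = (k, (c, f), e)" by (metis prod.collapse)
      have mem: "k \<in> bits l" "c \<in> C" "f \<in> R" "e \<in> E" using that by (auto simp: I_def i)
      have "(\<Sum>j\<in>I. X i j * M j i) = (\<Sum>j\<in>I. if fst j = k \<and> fst (snd j) = (c, f) then X i j * M j i else 0)"
      proof (rule sum.cong[OF refl])
        fix j assume j: "j \<in> I"
        obtain k' c' f' e' where j': "j = (k', (c', f'), e')" by (metis prod.collapse)
        show "X i j * M j i = (if fst j = k \<and> fst (snd j) = (c, f) then X i j * M j i else 0)"
          using j that M[of k' c' f' e' k c f e] classical mem unfolding i j' I_def R_def
          by (auto simp: sum.neutral)
      qed
      also have "\<dots> = (\<Sum>e'\<in>E. X i (k, (c, f), e') * M (k, (c, f), e') i)"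
        unfolding I_def by (subst sum_fibre[OF finite_bits fin(1) finR fin(2) mem(1-3)]) auto
      also have "\<dots> = (\<Sum>e'\<in>E. \<Sum>z\<in>bits_upto n. t k c f e e' z)"
        using mem by (intro sum.cong refl) (simp add: i M R_def t_def sum_distrib_left)
      finally show ?thesis by (simp add: i)
    qed
    then have "(\<Sum>i\<in>I. \<Sum>j\<in>I. X i j * M j i) = (\<Sum>k\<in>bits l. \<Sum>c\<in>C. \<Sum>f\<in>R. \<Sum>e\<in>E. \<Sum>e'\<in>E. \<Sum>z\<in>bits_upto n. t k c f e e' z)"
      by (simp add: I_def sum_Times)
    also have "\<dots> = (\<Sum>k\<in>bits l. \<Sum>f\<in>R. \<Sum>c\<in>C. \<Sum>e\<in>E. \<Sum>e'\<in>E. \<Sum>z\<in>bits_upto n. t k c f e e' z)"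
      by (rule sum.cong[OF refl], rule sum.swap)
    also have "\<dots> = (\<Sum>s\<in>bits l \<times> R \<times> C \<times> E \<times> E. \<Sum>z\<in>bits_upto n. t (fst s) (fst (snd (snd s))) (fst (snd s)) (fst (snd (snd (snd s)))) (snd (snd (snd (snd s)))) z)"
      by (simp add: sum_Times)
    also have "\<dots> = (\<Sum>z\<in>bits_upto n. \<Sum>s\<in>bits l \<times> R \<times> C \<times> E \<times> E. t (fst s) (fst (snd (snd s))) (fst (snd s)) (fst (snd (snd (snd s)))) (snd (snd (snd (snd s)))) z)"
      by (rule sum.swap)
    also have "\<dots> = (\<Sum>z\<in>bits_upto n. \<Sum>k\<in>bits l. \<Sum>f\<in>R. \<Sum>c\<in>C. \<Sum>e\<in>E. \<Sum>e'\<in>E. t k c f e e' z)"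
      by (simp add: sum_Times)
    also have "\<dots> = (\<Sum>z\<in>bits_upto n. \<Sum>k\<in>bits l. \<Sum>f\<in>R. \<Sum>c\<in>C. \<Sum>e\<in>E. \<Sum>c'\<in>C. if c = c' then (\<Sum>e'\<in>E. ?g z k f c e e') else 0)"
    proof (intro sum.cong refl)
      fix z k f c e assume z: "z \<in> bits_upto n" and c: "c \<in> C" and e: "e \<in> E"
      have "t k c f e e' z = ?g z k f c e e'" if "e' \<in> E" for e'
      \<comment> \<open>Pairs discarded from \<open>Xj\<close> contribute nothing: either the length
        of \<open>z\<close> is wrong for \<open>c\<close> and \<rho> vanishes, or \<open>f\<close>
        does not accept that length and the coefficient vanishes.\<close>
      proof (cases "ok c f")
        case False
        have "\<rho> (z, c, e') (z, c, e) = 0 \<or> hash_coeff F l (k, f) z = 0"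
        proof (cases "length z = len_of c")
          case True
          then show ?thesis using False z by (auto simp: ok_def hash_coeff_def bits_upto_def)
        next
          case False
          then show ?thesis using len[OF z c \<open>e' \<in> E\<close> e] by simp
        qed
        then show ?thesis by (auto simp: t_def)
      qed (simp add: t_def Xj_def)
      then show "(\<Sum>e'\<in>E. t k c f e e' z) = (\<Sum>c'\<in>C. if c = c' then (\<Sum>e'\<in>E. ?g z k f c e e') else 0)"
        using fin c by simp
    qed
    also have "\<dots> = ?S"
      unfolding sum_Times sum_distrib_left by (intro sum.cong refl) (auto simp: Xj_def)
    finally show ?thesis .
  qed
  note sum_eq = this
  have "trace_norm I M \<le> cmod ?S"
    unfolding tn sum_eq by (rule complex_Re_le_cmod)
  then show ?thesis using bound unfolding I_def R_def by linarith
qed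

section \<open>Matrix entries and event probabilities of the hashed and the ideal state\<close>

context
  fixes n l :: nat and F :: "nat \<Rightarrow> hash_fun set"
  assumes univ: "\<And>i. i \<le> n \<Longrightarrow> two_universal i l (F i)"
begin

lemma hashed_state_entry:
  "hashed_state n F \<rho> (k, (c, f), e) (k', (c', f'), e') = (if k = k' \<and> f = f' then
     \<Sum>z\<in>bits_upto n. if f \<in> F (length z) \<and> f z = Some k then \<rho> (z, c, e) (z, c', e') / of_nat (card (F (length z))) else 0
   else 0)"
proof -
  have "complex_of_real (pmf (pmf_of_set (F (length z))) f) * x = x / of_nat (card (F (length z)))"
    if "z \<in> bits_upto n" "f \<in> F (length z)" for z x
    using two_universalD(1,2)[OF univ, of "length z"] that by (simp add: bits_upto_def)
  then show ?thesis
    unfolding hashed_state_def by (auto simp: sum.inter_filter[symmetric] intro!: sum.cong)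
qed

text \<open>Each admissible \<open>f\<close> sends \<open>z\<close> to exactly one string in
  \<open>bits l\<close>, so summing over \<open>k\<close> only removes the condition on the
  output.\<close>

lemma hashed_state_sum_output:
  "(\<Sum>k\<in>bits l. hashed_state n F \<rho> (k, (c, f), e) (k, (c', f'), e')) = (if f = f' then
    \<Sum>z\<in>bits_upto n. if f \<in> F (length z) then \<rho> (z, c, e) (z, c', e') / of_nat (card (F (length z))) else 0 else 0)"
proof (cases "f = f'")
  case True
  let ?b = "\<lambda>z. \<rho> (z, c, e) (z, c', e') / of_nat (card (F (length z)))"
  have "(\<Sum>k\<in>bits l. hashed_state n F \<rho> (k, (c, f), e) (k, (c', f'), e')) =
    (\<Sum>k\<in>bits l. \<Sum>z\<in>bits_upto n. if f \<in> F (length z) \<and> f z = Some k then ?b z else 0)"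
    by (simp add: hashed_state_entry True)
  also have "\<dots> = (\<Sum>z\<in>bits_upto n. \<Sum>k\<in>bits l. if f \<in> F (length z) \<and> f z = Some k then ?b z else 0)"
    by (rule sum.swap)
  also have "\<dots> = (\<Sum>z\<in>bits_upto n. if f \<in> F (length z) then ?b z else 0)"
  proof (rule sum.cong[OF refl])
    fix z assume z: "z \<in> bits_upto n"
    define a where "a = ?b z"
    show "(\<Sum>k\<in>bits l. if f \<in> F (length z) \<and> f z = Some k then a else 0) = (if f \<in> F (length z) then a else 0)"
    proof (cases "f \<in> F (length z)")
      case True
      have "(\<Sum>k\<in>bits l. if f z = Some k then 1 else 0) = (1 :: complex)"
        by (rule sum_hash_output[where n = n and i = "length z", OF univ _ True]) (use z in \<open>auto simp: bits_upto_def bits_def\<close>)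
      then have "(\<Sum>k\<in>bits l. a * (if f z = Some k then 1 else 0)) = a"
        by (simp only: sum_distrib_left[symmetric] mult_1_right)
      then show ?thesis using True by (simp add: if_mult_right cong: if_cong)
    qed simp
  qed
  finally show ?thesis using True by simp
qed (simp add: hashed_state_entry)

lemma ideal_state_entry:
  "ideal_state (bits l) (hashed_state n F \<rho>) (k, (c, f), e) (k', (c', f'), e') = (if k = k' \<and> f = f' then
    (\<Sum>z\<in>bits_upto n. if f \<in> F (length z) then \<rho> (z, c, e) (z, c', e') / of_nat (card (F (length z))) else 0) / 2 ^ l
   else 0)"
  by (simp add: ideal_state_def op_tensor_def op_id_def partial_trace_fst_def hashed_state_sum_output card_bits)

lemma hashed_state_diff:
  "hashed_state n F \<rho> (k, (c, f), e) (k', (c', f'), e') - ideal_state (bits l) (hashed_state n F \<rho>) (k, (c, f), e) (k', (c', f'), e') =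
    (if k = k' \<and> f = f' then \<Sum>z\<in>bits_upto n. of_real (hash_coeff F l (k, f) z) * \<rho> (z, c, e) (z, c', e') else 0)"
  unfolding hashed_state_entry ideal_state_entry sum_divide_distrib
  by (auto simp: hash_coeff_def left_diff_distrib diff_divide_distrib sum_subtractf[symmetric] intro!: sum.cong)

text \<open>Neither channel touches \<open>c\<close>, and for each \<open>z\<close> the
  probabilities of the functions add up to 1. Equal normalisers will let conditioning be moved in
  front of the difference of the two states.\<close>

lemma event_prob_hashed:
  fixes \<rho> :: "(bool list \<times> 'c \<times> 'e) op"
  assumes fin: "finite C" "finite E" and \<Omega>: "\<Omega> \<subseteq> C"
  shows "event_prob (hash_labels n l F C E) (hashed_state n F \<rho>) {(k, (c, f), e). c \<in> \<Omega>} =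
      event_prob (bits_upto n \<times> C \<times> E) \<rho> {(z, c, e). c \<in> \<Omega>}" (is ?hashed)
    and "event_prob (hash_labels n l F C E) (ideal_state (bits l) (hashed_state n F \<rho>)) {(k, (c, f), e). c \<in> \<Omega>} =
      event_prob (bits_upto n \<times> C \<times> E) \<rho> {(z, c, e). c \<in> \<Omega>}" (is ?ideal)
proof -
  define R where "R = hash_register n F"
  define S where "S = (\<lambda>c f e. \<Sum>z\<in>bits_upto n. if f \<in> F (length z) then \<rho> (z, c, e) (z, c, e) / of_nat (card (F (length z))) else 0)"
  let ?b2 = "\<lambda>z c e. \<rho> (z, c, e) (z, c, e) / of_nat (card (F (length z)))"
  let ?b = "\<lambda>p z. if snd (fst p) \<in> F (length z) then \<rho> (z, fst (fst p), snd p) (z, fst (fst p), snd p) / of_nat (card (F (length z))) else 0"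
  let ?S = "(\<Sum>p\<in>(\<Omega> \<times> R) \<times> E. S (fst (fst p)) (snd (fst p)) (snd p))"
  have I1: "hash_labels n l F C E \<inter> {(k, (c, f), e). c \<in> \<Omega>} = bits l \<times> (\<Omega> \<times> R) \<times> E"
    and I2: "bits_upto n \<times> C \<times> E \<inter> {(z, c, e). c \<in> \<Omega>} = bits_upto n \<times> \<Omega> \<times> E"
    using \<Omega> by (auto simp: R_def)
  have total: "?S = (\<Sum>z\<in>bits_upto n. \<Sum>c\<in>\<Omega>. \<Sum>e\<in>E. \<rho> (z, c, e) (z, c, e))"
  proof -
    have "?S =
      (\<Sum>z\<in>bits_upto n. \<Sum>p\<in>(\<Omega> \<times> R) \<times> E. ?b p z)"
      unfolding S_def by (rule sum.swap)
    also have "\<dots> = (\<Sum>z\<in>bits_upto n. \<Sum>c\<in>\<Omega>. \<Sum>e\<in>E. \<rho> (z, c, e) (z, c, e))"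
    proof (rule sum.cong[OF refl])
      fix z assume "z \<in> bits_upto n"
      then have i: "length z \<le> n" by (simp add: bits_upto_def)
      have "(\<Sum>p\<in>(\<Omega> \<times> R) \<times> E. ?b p z) =
        (\<Sum>c\<in>\<Omega>. \<Sum>f\<in>R. \<Sum>e\<in>E. if f \<in> F (length z) then ?b2 z c e else 0)"
        by (simp only: sum_Times fst_conv snd_conv)
      also have "\<dots> = (\<Sum>c\<in>\<Omega>. \<Sum>e\<in>E. \<Sum>f\<in>R. if f \<in> F (length z) then ?b2 z c e else 0)"
        by (rule sum.cong[OF refl], rule sum.swap)
      also have "\<dots> = (\<Sum>c\<in>\<Omega>. \<Sum>e\<in>E. \<rho> (z, c, e) (z, c, e))"
      proof (intro sum.cong refl)
        fix c e
        have "(\<Sum>f\<in>hash_register n F. if f \<in> F (length z) then ?b2 z c e else 0) =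
          (\<Sum>f\<in>F (length z). ?b2 z c e)"
          by (rule sum_hash_register[OF univ i])
        moreover have "0 < card (F (length z))" by (rule hash_card_pos[OF univ i])
        ultimately show "(\<Sum>f\<in>R. if f \<in> F (length z) then ?b2 z c e else 0) = \<rho> (z, c, e) (z, c, e)"
          by (simp add: R_def)
      qed
      finally show "(\<Sum>p\<in>(\<Omega> \<times> R) \<times> E. ?b p z) =
        (\<Sum>c\<in>\<Omega>. \<Sum>e\<in>E. \<rho> (z, c, e) (z, c, e))" .
    qed
    finally show ?thesis .
  qed
  have "(\<Sum>i\<in>bits l \<times> (\<Omega> \<times> R) \<times> E. hashed_state n F \<rho> i i) =
      (\<Sum>k\<in>bits l. \<Sum>p\<in>(\<Omega> \<times> R) \<times> E. hashed_state n F \<rho> (k, (fst (fst p), snd (fst p)), snd p) (k, (fst (fst p), snd (fst p)), snd p))"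
    by (simp add: sum_Times)
  also have "\<dots> = (\<Sum>p\<in>(\<Omega> \<times> R) \<times> E. \<Sum>k\<in>bits l. hashed_state n F \<rho> (k, (fst (fst p), snd (fst p)), snd p) (k, (fst (fst p), snd (fst p)), snd p))"
    by (rule sum.swap)
  also have "\<dots> = ?S"
    unfolding hashed_state_sum_output by (simp add: S_def)
  finally show ?hashed
    unfolding event_prob_def I1 I2 total by (simp add: sum_Times)
  have "(\<Sum>i\<in>bits l \<times> (\<Omega> \<times> R) \<times> E. ideal_state (bits l) (hashed_state n F \<rho>) i i) = (\<Sum>k\<in>bits l. ?S / 2 ^ l)"
    by (simp only: sum_Times fst_conv snd_conv ideal_state_entry S_def sum_divide_distrib simp_thms if_True)
  also have "\<dots> = ?S"
    by (simp add: card_bits)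
  finally show ?ideal
    unfolding event_prob_def I1 I2 total by (simp add: sum_Times)
qed

end

text \<open>The hypothesis speaks of probabilities, hence of diagonal entries only; positivity
  extends the vanishing to whole rows. For a label \<open>c\<close> of probability 0, where the
  conditional statement is silent, the diagonal entries vanish anyway.\<close>

lemma length_support:
  fixes \<rho> :: "(bool list \<times> 'c \<times> 'e) op"
  assumes fin: "finite C" "finite E" and \<rho>: "state_on (bits_upto n \<times> C \<times> E) \<rho>"
    and len: "\<forall>c\<in>C. event_prob (bits_upto n \<times> C \<times> E) \<rho> {(z, c', e). c' = c} > 0 \<longrightarrow>
           (\<forall>z\<in>bits_upto n.
              event_prob (bits_upto n \<times> C \<times> E)
                (cond_state (bits_upto n \<times> C \<times> E) \<rho> {(z, c', e). c' = c})
                {(z', c', e). z' = z} \<noteq> 0 \<longrightarrow> z \<in> bits (len_of c))"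
    and mem: "z \<in> bits_upto n" "c \<in> C" "e \<in> E" "e' \<in> E" and "length z \<noteq> len_of c"
  shows "\<rho> (z, c, e) (z, c, e') = 0"
proof -
  define I where "I = bits_upto n \<times> C \<times> E"
  define W where "W = {(z :: bool list, c', e :: 'e). c' = c}"
  have finI: "finite I" using fin by (simp add: I_def)
  have psd: "op_psd I \<rho>" using \<rho> by (simp add: state_on_def I_def)
  have nonneg: "0 \<le> Re (\<rho> i i)" "Im (\<rho> i i) = 0" if "i \<in> I" for i
    using psd_diag_nonneg[OF finI psd that] by auto
  have zero: "Re (\<rho> (z, c, e) (z, c, e)) = 0"
  proof (cases "event_prob I \<rho> W > 0")
    case True
    define P where "P = event_prob I \<rho> W"
    have "event_prob I (cond_state I \<rho> W) {(z', c', e). z' = z} = 0"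
      using len mem(1,2) True assms(9) unfolding I_def W_def by (auto simp: bits_def)
    moreover have "event_prob I (cond_state I \<rho> W) {(z', c', e). z' = z} = (\<Sum>i\<in>I \<inter> {(z', c', e). z' = z}. if i \<in> W then Re (\<rho> i i) / P else 0)"
      unfolding event_prob_def Re_sum by (intro sum.cong refl) (simp add: cond_state_def P_def event_prob_def)
    ultimately have "(\<Sum>i\<in>I \<inter> {(z', c', e). z' = z}. if i \<in> W then Re (\<rho> i i) / P else 0) = 0" by simp
    then have "\<forall>i\<in>I \<inter> {(z', c', e). z' = z}. (if i \<in> W then Re (\<rho> i i) / P else 0) = 0"
      using finI nonneg True by (subst (asm) sum_nonneg_eq_0_iff) (auto simp: P_def)
    from bspec[OF this, of "(z, c, e)"] have "Re (\<rho> (z, c, e) (z, c, e)) / P = 0"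
      using mem by (simp add: I_def W_def)
    then show ?thesis using True by (simp add: P_def)
  next
    case False
    have "event_prob I \<rho> W = (\<Sum>i\<in>I \<inter> W. Re (\<rho> i i))" by (simp add: event_prob_def Re_sum)
    moreover have "0 \<le> (\<Sum>i\<in>I \<inter> W. Re (\<rho> i i))" using nonneg by (intro sum_nonneg) auto
    ultimately have "(\<Sum>i\<in>I \<inter> W. Re (\<rho> i i)) = 0" using False by linarith
    then have "\<forall>i\<in>I \<inter> W. Re (\<rho> i i) = 0"
      using finI nonneg by (subst (asm) sum_nonneg_eq_0_iff) auto
    then show ?thesis using mem by (auto simp: I_def W_def)
  qed
  have "(z, c, e) \<in> I" "(z, c, e') \<in> I" using mem by (auto simp: I_def)
  then show ?thesis
    using zero nonneg(2) psd_zero_diag[OF finI psd] by (simp add: complex_eq_iff)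
qed

theorem lemma4:
  fixes n l :: nat
    and \<alpha> :: real
    and C :: "'c set"
    and E :: "'e set"
    and \<rho> :: "(bool list \<times> 'c \<times> 'e) op"
    and len_of :: "'c \<Rightarrow> nat"
    and F :: "nat \<Rightarrow> hash_fun set"
    and \<Omega> :: "'c set"
  assumes "1 < \<alpha>" and "\<alpha> < 2"
    and "finite C" and "finite E"
    and "state_on (bits_upto n \<times> C \<times> E) \<rho>"
    and "classical_in (bits_upto n \<times> C \<times> E) (\<lambda>(z, c, e). (z, c)) \<rho>"
    and "\<forall>c\<in>C. event_prob (bits_upto n \<times> C \<times> E) \<rho> {(z, c', e). c' = c} > 0 \<longrightarrow>
           (\<forall>z\<in>bits_upto n.
              event_prob (bits_upto n \<times> C \<times> E)
                (cond_state (bits_upto n \<times> C \<times> E) \<rho> {(z, c', e). c' = c})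
                {(z', c', e). z' = z} \<noteq> 0 \<longrightarrow> z \<in> bits (len_of c))"
    and "\<forall>i\<le>n. two_universal i l (F i)"
    and "\<Omega> \<subseteq> C"
    and "event_prob (bits_upto n \<times> C \<times> E) \<rho> {(z, c, e). c \<in> \<Omega>} > 0"
  shows
    "1/2 * event_prob (bits_upto n \<times> C \<times> E) \<rho> {(z, c, e). c \<in> \<Omega>} *
       trace_norm (bits l \<times> (C \<times> hash_register n F) \<times> E)
         (op_minus
           (cond_state (bits l \<times> (C \<times> hash_register n F) \<times> E)
             (hashed_state n F \<rho>) {(k, (c, f), e). c \<in> \<Omega>})
           (cond_state (bits l \<times> (C \<times> hash_register n F) \<times> E)
             (ideal_state (bits l) (hashed_state n F \<rho>)) {(k, (c, f), e). c \<in> \<Omega>}))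
     \<le> 1/2 * event_prob (bits_upto n \<times> C \<times> E) \<rho> {(z, c, e). c \<in> \<Omega>} *
       2 powr (- ((\<alpha> - 1) / \<alpha>) *
           (real_of_ereal (sandwiched_renyi_entropy \<alpha> (bits_upto n) (C \<times> E)
              (cond_state (bits_upto n \<times> C \<times> E) \<rho> {(z, c, e). c \<in> \<Omega>})) - real l)
           + 2 / \<alpha> - 1)
     \<and>
     1/2 * event_prob (bits_upto n \<times> C \<times> E) \<rho> {(z, c, e). c \<in> \<Omega>} *
       2 powr (- ((\<alpha> - 1) / \<alpha>) *
           (real_of_ereal (sandwiched_renyi_entropy \<alpha> (bits_upto n) (C \<times> E)
              (cond_state (bits_upto n \<times> C \<times> E) \<rho> {(z, c, e). c \<in> \<Omega>})) - real l)
           + 2 / \<alpha> - 1)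
     \<le> 1/2 *
       2 powr (- ((\<alpha> - 1) / \<alpha>) *
           (real_of_ereal (sandwiched_renyi_entropy \<alpha> (bits_upto n) (C \<times> E) \<rho>) - real l)
           + 2 / \<alpha> - 1)"
proof -
  let ?I = "bits_upto n \<times> C \<times> E"
  let ?W = "{(z :: bool list, c, e :: 'e). c \<in> \<Omega>}"
  define p where "p = event_prob ?I \<rho> ?W"
  define \<rho>' where "\<rho>' = cond_state ?I \<rho> ?W"
  define M where "M = op_minus
      (cond_state (hash_labels n l F C E) (hashed_state n F \<rho>) {(k, (c, f), e). c \<in> \<Omega>})
      (cond_state (hash_labels n l F C E) (ideal_state (bits l) (hashed_state n F \<rho>)) {(k, (c, f), e). c \<in> \<Omega>})"
  define \<kappa> where "\<kappa> = (\<alpha> - 1) / \<alpha>"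
  note \<alpha> = assms(1,2) and fin = assms(3,4) and \<rho> = assms(5)
  have univ: "\<And>i. i \<le> n \<Longrightarrow> two_universal i l (F i)" using assms(8) by blast
  have p: "0 < p" using assms(10) by (simp add: p_def)
  have finB: "finite (C \<times> E)" and finI: "finite ?I" using fin by auto
  have classical: "\<rho> (z, c, e) (z', c', e') = 0"
    if "z \<in> bits_upto n" "c \<in> C" "e \<in> E" "z' \<in> bits_upto n" "c' \<in> C" "e' \<in> E" "c \<noteq> c'" for z c e z' c' e'
    using assms(6) that unfolding classical_in_def by fastforce
  have block: "\<rho> i j = 0" if "i \<in> ?I" "j \<in> ?I" "i \<in> ?W" "j \<notin> ?W" for i j
    using that by (auto intro!: classical)
  have \<rho>': "state_on ?I \<rho>'"
    unfolding \<rho>'_def by (rule cond_state_state(3)[OF finI \<rho> assms(10) block])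
  have prob: "event_prob (hash_labels n l F C E) (hashed_state n F \<rho>) {(k, (c, f), e). c \<in> \<Omega>} = p"
    "event_prob (hash_labels n l F C E) (ideal_state (bits l) (hashed_state n F \<rho>)) {(k, (c, f), e). c \<in> \<Omega>} = p"
    unfolding p_def by (rule event_prob_hashed[OF univ fin assms(9)]; assumption)+
  have diff: "hashed_state n F \<rho> (k, (c, f), e) (k', (c', f'), e') - ideal_state (bits l) (hashed_state n F \<rho>) (k, (c, f), e) (k', (c', f'), e') =
    (if k = k' \<and> f = f' then \<Sum>z\<in>bits_upto n. of_real (hash_coeff F l (k, f) z) * \<rho> (z, c, e) (z, c', e') else 0)"
    for k c f e k' c' f' e'
    by (rule hashed_state_diff[OF univ])
  \<comment> \<open>Both conditional states have the normaliser \<open>p\<close>, so their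
    difference is the difference channel applied to \<rho> conditioned beforehand.\<close>
  have M_entry: "M (k, (c, f), e) (k', (c', f'), e') =
      (if k = k' \<and> f = f' then \<Sum>z\<in>bits_upto n. of_real (hash_coeff F l (k, f) z) * \<rho>' (z, c, e) (z, c', e') else 0)"
    for k c f e k' c' f' e'
  proof (cases "c \<in> \<Omega> \<and> c' \<in> \<Omega>")
    case True
    then have "M (k, (c, f), e) (k', (c', f'), e') =
      (hashed_state n F \<rho> (k, (c, f), e) (k', (c', f'), e') - ideal_state (bits l) (hashed_state n F \<rho>) (k, (c, f), e) (k', (c', f'), e')) / of_real p"
      unfolding M_def op_minus_def cond_state_def prob by (simp add: diff_divide_distrib)
    also have "\<dots> = (if k = k' \<and> f = f' then \<Sum>z\<in>bits_upto n. of_real (hash_coeff F l (k, f) z) * \<rho>' (z, c, e) (z, c', e') else 0)"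
      unfolding diff using True by (simp add: \<rho>'_def cond_state_def p_def sum_divide_distrib)
    finally show ?thesis .
  qed (auto simp: M_def op_minus_def cond_state_def \<rho>'_def)
  \<comment> \<open>The right-edge value \<open>sqrt (2 ^ l)\<close> raised to the interpolation
    parameter gives the \<open>l\<close>-dependent part of the exponent.\<close>
  have sqrt_eq: "sqrt (2 ^ l) powr (2 * (\<alpha> - 1) / \<alpha>) = 2 powr (\<kappa> * real l)"
  proof -
    have "sqrt (2 ^ l) = 2 powr (real l / 2)"
      by (simp add: powr_half_sqrt[symmetric] powr_powr flip: powr_realpow)
    moreover have "real l / 2 * (2 * (\<alpha> - 1) / \<alpha>) = \<kappa> * real l"
      using \<alpha> by (simp add: \<kappa>_def field_simps)
    ultimately show ?thesis by (simp only: powr_powr)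
  qed
  define H where "H = real_of_ereal (sandwiched_renyi_entropy \<alpha> (bits_upto n) (C \<times> E) \<rho>)"
  define H' where "H' = real_of_ereal (sandwiched_renyi_entropy \<alpha> (bits_upto n) (C \<times> E) \<rho>')"
  have expo: "2 powr (2 / \<alpha> - 1) * 2 powr (\<kappa> * real l) * 2 powr (- \<kappa> * h) = 2 powr (- \<kappa> * (h - real l) + 2 / \<alpha> - 1)" for h
    unfolding powr_add[symmetric] by (rule arg_cong[of _ _ "\<lambda>x. 2 powr x"]) (simp add: algebra_simps)
  have "trace_norm (hash_labels n l F C E) M \<le> 2 powr (2 / \<alpha> - 1) * 2 powr (\<kappa> * real l) * 2 powr (- \<kappa> * H')"
    unfolding H'_def \<kappa>_def
  proof (rule le_entropy_bound[OF \<alpha> finite_bits_upto finB \<rho>'])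
    fix \<sigma> assume \<sigma>: "state_on (C \<times> E) \<sigma>" "supported_by (bits_upto n) (C \<times> E) \<rho>' \<sigma>"
    have "trace_norm (hash_labels n l F C E) M \<le>
     2 powr (2 / \<alpha> - 1) * sqrt (2 ^ l) powr (2 * (\<alpha> - 1) / \<alpha>) * renyi_trace \<alpha> (bits_upto n) (C \<times> E) \<rho>' \<sigma> powr (1 / \<alpha>)"
    proof (rule hash_trace_norm_bound[where len_of = len_of, OF univ \<alpha> fin \<rho>' \<sigma>])
      show "\<rho>' (z, c, e) (z, c', e') = 0" if "z \<in> bits_upto n" "c \<in> C" "c' \<in> C" "e \<in> E" "e' \<in> E" "c \<noteq> c'" for z c e c' e'
        using classical that by (simp add: \<rho>'_def cond_state_def)
      show "\<rho>' (z, c, e) (z, c, e') = 0" if "z \<in> bits_upto n" "c \<in> C" "e \<in> E" "e' \<in> E" "length z \<noteq> len_of c" for z c e e'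
        using length_support[OF fin \<rho> assms(7) that] by (simp add: \<rho>'_def cond_state_def)
    qed (assumption | rule M_entry)+
    then show "trace_norm (hash_labels n l F C E) M \<le>
      2 powr (2 / \<alpha> - 1) * 2 powr ((\<alpha> - 1) / \<alpha> * real l) * renyi_trace \<alpha> (bits_upto n) (C \<times> E) \<rho>' \<sigma> powr (1 / \<alpha>)"
      unfolding sqrt_eq \<kappa>_def .
  qed simp
  then have first: "trace_norm (hash_labels n l F C E) M \<le> 2 powr (- \<kappa> * (H' - real l) + 2 / \<alpha> - 1)"
    unfolding expo .
  \<comment> \<open>The loss of \<open>1 / p\<close> caused by conditioning is exactly compensated
    by the prefactor \<open>p\<close> of the claim.\<close>
  have "p * 2 powr (- \<kappa> * H') \<le> 2 powr (- \<kappa> * H)"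
    unfolding H_def H'_def p_def \<rho>'_def \<kappa>_def
    by (rule entropy_cond_bound[OF \<alpha> finite_bits_upto finB \<rho> assms(10) block])
  then have "(2 powr (2 / \<alpha> - 1) * 2 powr (\<kappa> * real l)) * (p * 2 powr (- \<kappa> * H')) \<le>
      (2 powr (2 / \<alpha> - 1) * 2 powr (\<kappa> * real l)) * 2 powr (- \<kappa> * H)"
    by (intro mult_left_mono) auto
  then have second: "p * 2 powr (- \<kappa> * (H' - real l) + 2 / \<alpha> - 1) \<le> 2 powr (- \<kappa> * (H - real l) + 2 / \<alpha> - 1)"
    unfolding expo[symmetric] by (simp only: mult_ac)
  show ?thesis
    unfolding M_def[symmetric] \<rho>'_def[symmetric] p_def[symmetric] H_def[symmetric] H'_def[symmetric] \<kappa>_def[symmetric]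
  proof
    show "1/2 * p * trace_norm (hash_labels n l F C E) M \<le> 1/2 * p * 2 powr (- \<kappa> * (H' - real l) + 2 / \<alpha> - 1)"
      using first p by (intro mult_left_mono) auto
    show "1/2 * p * 2 powr (- \<kappa> * (H' - real l) + 2 / \<alpha> - 1) \<le> 1/2 * 2 powr (- \<kappa> * (H - real l) + 2 / \<alpha> - 1)"
      using second by simp
  qed
qed

end
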